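(* Let $p,m\ge1$ be integers, let $P\subset\mathbb{R}^p$ be an integral polytope of full dimension $p$ with vertex set $V$, and let a signed decomposition $$[\![P]\!]=\sum_{\mathbf{v}\in V}\sum_{i\in I_{\mathbf{v}}}(-1)^{t_{\mathbf{v},i}}[\![C_{\mathbf{v},i}]\!],\qquad C_{\mathbf{v},i}:=\{\mathbf{v}+A_{\mathbf{v},i}\mathbf{x}\colon\mathbf{x}\in\mathbb{R}^+_{J_{\mathbf{v},i}}\},$$ be given, where $[\![\cdot]\!]$ denotes the indicator function and, for each $\mathbf{v}\in V$, $I_{\mathbf{v}}$ is a finite set and, for each $i\in I_{\mathbf{v}}$, $t_{\mathbf{v},i}\in\{0,1\}$, $A_{\mathbf{v},i}$ is a unimodular $p\times p$ matrix over $\mathbb{Z}$, and $J_{\mathbf{v},i}\subseteq[p]$. Let $f\colon\mathbb{R}^p\to\mathbb{R}$ be $2m$-times continuously differentiable and compactly supported. Then $$\sum_{\mathbf{k}\in P\cap\mathbb{Z}^p}f(\mathbf{k})=A_m(f,P)-R_m(f,P),$$ where $$A_m(f,P):=\sum_{\boldsymbol{\beta}=(1-m)\mathbf{1}}^{(m-1)\mathbf{1}}\tau_{m,\mathbf{1}+|\boldsymbol{\beta}|}\sum_{\mathbf{v}\in V}\sum_{i\in I_{\mathbf{v}}}(-1)^{t_{\mathbf{v},i}}\int_{C_{\mathbf{v},i}+A_{\mathbf{v},i}(\mathbf{1}_{J_{\mathbf{v},i}}-(\mathbf{1}+\boldsymbol{\beta})/2)}d\mathbf{x}\,f(\mathbf{x})$$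 is the integral approximation to the sum $\sum_{\mathbf{k}\in P\cap\mathbb{Z}^p}f(\mathbf{k})$ and $R_m(f,P)$ is the remainder given by $$R_m(f,P):=\frac{m}{2^{2m+p-1}}\sum_{\|\boldsymbol{\alpha}\|=2m}\frac1{\boldsymbol{\alpha}!}\int_0^1ds\,(1-s)^{2m-1}\int_{[-1,1]^p}d\mathbf{u}\,\mathbf{u}^{\boldsymbol{\alpha}}\sum_{\mathbf{j}=\mathbf{1}}^{m\mathbf{1}}\gamma_{m,\mathbf{j}}\,\mathbf{j}^{\boldsymbol{\alpha}+\mathbf{1}}\sum_{\mathbf{v}\in V}\sum_{i\in I_{\mathbf{v}}}(-1)^{t_{\mathbf{v},i}}\sum_{\mathbf{k}\ge\mathbf{0}}g_{\mathbf{v},i}^{(\boldsymbol{\alpha})}(\mathbf{k}+\mathbf{1}_{J_{\mathbf{v},i}}+s\mathbf{j}\mathbf{u}/2),$$ with $g_{\mathbf{v},i}(\mathbf{y}):=f(\mathbf{v}+A_{\mathbf{v},i}\mathbf{y})$ for $\mathbf{y}\in\mathbb{R}^p$. If $M_{2m}$ is a real number such that $$\Big|\sum_{\mathbf{v}\in V}\sum_{i\in I_{\mathbf{v}}}(-1)^{t_{\mathbf{v},i}}\sum_{\mathbf{k}\ge\mathbf{0}}g_{\mathbf{v},i}^{(\boldsymbol{\alpha})}(\mathbf{k}+\mathbf{u})\Big|\le M_{2m}\quad\text{whenever }\boldsymbol{\alpha}\in\mathbb{Z}_+^p,\ \|\boldsymbol{\alpha}\|=2m,\text{ and }\mathbf{u}\in\mathbb{R}^p,\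 |\mathbf{u}|\le(\tfrac m2+1)\mathbf{1},$$ then $$|R_m(f,P)|\le M_{2m}\,\frac{1.0331\,(\pi m)^{(p+1)/2}}{(2m+1)!}\,(\kappa pm)^{2m},$$ where $\kappa:=\sqrt{\Lambda_*/4}=0.27754\dots$ and $\Lambda_*:=\max_{0<t<1}(1-t)^{t-1}(1+t)^{-1-t}t^2=0.3081\dots$.
   Context: The symbol $[\![S]\!]$ (double brackets around a set) denotes the indicator function of $S\subseteq\mathbb{R}^p$, equal to $1$ on $S$ and $0$ off $S$. An integral polytope in $\mathbb{R}^p$ is the convex hull of a finite subset of $\mathbb{Z}^p$; its vertices are its extreme points. A matrix is unimodular if its determinant is $1$ or $-1$. $[p]:=\{1,\dots,p\}$. For $J\subseteq[p]$, $\mathbb{R}^+_J:=\prod_{j\in[p]}S_j$ with $S_j=(0,\infty)$ if $j\in J$ and $S_j=[0,\infty)$ if $j\notin J$; $\mathbf{1}_J\in\{0,1\}^p$ is the vector whose $r$th coordinate is $1$ if $r\in J$ and $0$ otherwise. (Decompositions of the required form with unimodular matrices exist for every full-dimensional integral polytope.) Notation. $\mathbb{Z}_+:=\mathbb{Z}\cap[0,\infty)$. Boldface letters denote vectors with $p$ coordinates, the coordinates being denoted by the corresponding non-bold letters with indices. $\mathbf{1}:=(1,\dots,1)$, $\mathbf{0}:=(0,\dots,0)$. For $\boldsymbol{\alpha}\in\mathbb{Z}_+^p$: $\|\boldsymbol{\alpha}\|:=\alpha_1+\dots+\alpha_p$, $\boldsymbol{\alpha}!:=\alpha_1!\cdots\alpha_p!$,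 $\mathbf{x}^{\boldsymbol{\alpha}}:=x_1^{\alpha_1}\cdots x_p^{\alpha_p}$, and $h^{(\boldsymbol{\alpha})}$ is the corresponding partial derivative of $h$. $|\mathbf{u}|:=(|u_1|,\dots,|u_p|)$. The product $\mathbf{j}\mathbf{u}$ and inequalities between vectors are coordinatewise. $\sum_{\mathbf{i}=\mathbf{a}}^{\mathbf{b}}$ is the sum over all $\mathbf{i}\in\mathbb{Z}^p$ with $\mathbf{a}\le\mathbf{i}\le\mathbf{b}$; $\sum_{\mathbf{k}\ge\mathbf{0}}$ is over $\mathbf{k}\in\mathbb{Z}_+^p$; $\sum_{\|\boldsymbol{\alpha}\|=2m}$ is over $\boldsymbol{\alpha}\in\mathbb{Z}_+^p$. For a set $C$ and a vector $\mathbf{a}$, $C+\mathbf{a}:=\{\mathbf{x}+\mathbf{a}\colon\mathbf{x}\in C\}$. Coefficients: for integers $j\ge1$, $$\gamma_{m,j}:=(-1)^{j-1}\frac2j\binom{2m}{m+j}\Big/\binom{2m}{m},\qquad \tau_{m,j}:=\sum_{\beta=0}^{\infty}\gamma_{m,j+2\beta}$$ (with $\binom{2m}{m+j}=0$ for $j>m$), and for $\mathbf{j}\in\mathbb{Z}_+^p$ with $\mathbf{j}\ge\mathbf{1}$, $\gamma_{m,\mathbf{j}}:=\prod_{r=1}^p\gamma_{m,j_r}$ and $\tau_{m,\mathbf{j}}:=\prod_{r=1}^p\tau_{m,j_r}$.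
   Formalization: The bound M_{2m} is required of the signed sums of g_{v,i}^{(α)}(k+1_{J_{v,i}}+u) for |u| ≤ (m/2)·1, instead of g_{v,i}^{(α)}(k+u) for |u| ≤ (m/2+1)·1; as printed the estimate fails for p=m=1, P=[0,1]=[0,∞)−(1,∞), f=x²/2 near P. *)

theory Defs
  imports "HOL-Analysis.Analysis"
begin

section \<open>Multi-indices, partial derivatives, and smoothness\<close>

text \<open>The dimension \<open>p\<close> is \<open>CARD('n)\<close> and \<open>[p]\<close> is the index type \<open>'n\<close>. Multi-indices have type
  \<open>nat ^ 'n\<close>; the library order on vectors is coordinatewise.\<close>

definition mi_norm :: "nat ^ 'n::finite \<Rightarrow> nat" where
  "mi_norm \<alpha> = (\<Sum>r\<in>UNIV. \<alpha> $ r)"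

definition mi_fact :: "nat ^ 'n::finite \<Rightarrow> real" where
  "mi_fact \<alpha> = (\<Prod>r\<in>UNIV. fact (\<alpha> $ r))"

definition mi_power :: "real ^ 'n::finite \<Rightarrow> nat ^ 'n \<Rightarrow> real" where
  "mi_power x \<alpha> = (\<Prod>r\<in>UNIV. (x $ r) ^ (\<alpha> $ r))"

definition real_vec :: "nat ^ 'n \<Rightarrow> real ^ 'n" where
  "real_vec k = (\<chi> r. real (k $ r))"

definition int_points :: "(real ^ 'n) set" where
  "int_points = {x. \<forall>r. x $ r \<in> \<int>}"

definition partial :: "'n::finite \<Rightarrow> (real ^ 'n \<Rightarrow> real) \<Rightarrow> real ^ 'n \<Rightarrow> real" where
  "partial r h x = deriv (\<lambda>t. h (x + t *\<^sub>R axis r 1)) 0"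

fun iter_partial :: "'n::finite list \<Rightarrow> (real ^ 'n \<Rightarrow> real) \<Rightarrow> real ^ 'n \<Rightarrow> real" where
  "iter_partial [] h = h"
| "iter_partial (r # rs) h = partial r (iter_partial rs h)"

text \<open>The derivative \<open>h\<^sup>(\<^sup>\<alpha>\<^sup>)\<close> differentiates \<open>\<alpha> $ r\<close> times in direction \<open>r\<close> for each \<open>r\<close>. The order in
  which this is done is left to the choice operator; for the functions it is applied to, which are
  at least \<open>mi_norm \<alpha>\<close> times continuously differentiable, the order is immaterial.\<close>

definition mixed_partial :: "nat ^ 'n::finite \<Rightarrow> (real ^ 'n \<Rightarrow> real) \<Rightarrow> real ^ 'n \<Rightarrow> real" where
  "mixed_partial \<alpha> h = iter_partial (SOME rs. \<forall>r. count_list rs r = \<alpha> $ r) h"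

primrec cont_diff :: "nat \<Rightarrow> (real ^ 'n::finite \<Rightarrow> real) \<Rightarrow> bool" where
  "cont_diff 0 h \<longleftrightarrow> continuous_on UNIV h"
| "cont_diff (Suc k) h \<longleftrightarrow> (\<forall>x. h differentiable (at x)) \<and> (\<forall>r. cont_diff k (partial r h))"

definition compactly_supported :: "(real ^ 'n::finite \<Rightarrow> real) \<Rightarrow> bool" where
  "compactly_supported h \<longleftrightarrow> compact (closure (support_on UNIV h))"

section \<open>Integral polytopes and unimodular cones\<close>

definition integral_polytope :: "(real ^ 'n::finite) set \<Rightarrow> bool" where
  "integral_polytope P \<longleftrightarrow> (\<exists>S. finite S \<and> S \<subseteq> int_points \<and> P = convex hull S)"

definition vertices :: "(real ^ 'n::finite) set \<Rightarrow> (real ^ 'n) set" where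
  "vertices P = {v. v extreme_point_of P}"

definition unimodular :: "int ^ 'n::finite ^ 'n \<Rightarrow> bool" where
  "unimodular A \<longleftrightarrow> det A = 1 \<or> det A = -1"

definition pos_orthant :: "'n set \<Rightarrow> (real ^ 'n::finite) set" where
  "pos_orthant J = {x. \<forall>r. if r \<in> J then 0 < x $ r else 0 \<le> x $ r}"

definition one_on :: "'n set \<Rightarrow> real ^ 'n::finite" where
  "one_on J = (\<chi> r. if r \<in> J then 1 else 0)"

definition chart :: "real ^ 'n::finite \<Rightarrow> int ^ 'n ^ 'n \<Rightarrow> real ^ 'n \<Rightarrow> real ^ 'n" where
  "chart v A x = v + map_matrix real_of_int A *v x"

definition cone_at :: "real ^ 'n::finite \<Rightarrow> int ^ 'n ^ 'n \<Rightarrow> 'n set \<Rightarrow> (real ^ 'n) set" where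
  "cone_at v A J = chart v A ` pos_orthant J"

section \<open>Coefficients\<close>

definition gamma_coeff :: "nat \<Rightarrow> nat \<Rightarrow> real" where
  "gamma_coeff m j =
     (-1) ^ (j - 1) * (2 / real j) * real ((2 * m) choose (m + j)) / real ((2 * m) choose m)"

definition tau_coeff :: "nat \<Rightarrow> nat \<Rightarrow> real" where
  "tau_coeff m j = (\<Sum>b. gamma_coeff m (j + 2 * b))"

definition gamma_vec :: "nat \<Rightarrow> nat ^ 'n::finite \<Rightarrow> real" where
  "gamma_vec m j = (\<Prod>r\<in>UNIV. gamma_coeff m (j $ r))"

definition tau_vec :: "nat \<Rightarrow> nat ^ 'n::finite \<Rightarrow> real" where
  "tau_vec m j = (\<Prod>r\<in>UNIV. tau_coeff m (j $ r))"

definition Lambda_fun :: "real \<Rightarrow> real" where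
  "Lambda_fun t = (1 - t) powr (t - 1) * (1 + t) powr (- 1 - t) * t\<^sup>2"

definition Lambda_star :: real where
  "Lambda_star = (SUP t\<in>{0<..<1}. Lambda_fun t)"

definition kappa :: real where
  "kappa = sqrt (Lambda_star / 4)"

section \<open>The integral approximation and the remainder\<close>

definition approx_A ::
  "nat \<Rightarrow> (real ^ 'n::finite) set \<Rightarrow> (real ^ 'n \<Rightarrow> 'i set) \<Rightarrow> (real ^ 'n \<Rightarrow> 'i \<Rightarrow> nat) \<Rightarrow>
   (real ^ 'n \<Rightarrow> 'i \<Rightarrow> int ^ 'n ^ 'n) \<Rightarrow> (real ^ 'n \<Rightarrow> 'i \<Rightarrow> 'n set) \<Rightarrow> (real ^ 'n \<Rightarrow> real) \<Rightarrow> real"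
  where
  "approx_A m V I t A J f =
     (\<Sum>\<beta>\<in>{vec (1 - int m) .. vec (int m - 1)}.
        tau_vec m (\<chi> r. 1 + nat \<bar>\<beta> $ r\<bar>) *
        (\<Sum>v\<in>V. \<Sum>i\<in>I v. (-1) ^ t v i *
          (LINT x : (\<lambda>y. y + map_matrix real_of_int (A v i) *v
                           (\<chi> r. one_on (J v i) $ r - (1 + real_of_int (\<beta> $ r)) / 2))
                    ` cone_at v (A v i) (J v i) | lborel. f x)))"

text \<open>\<open>signed_lattice_sum\<close> is the signed sum of derivatives of \<open>g\<^sub>v\<^sub>,\<^sub>i = f \<circ> chart v (A v i)\<close> occurring in the
  remainder, as a function of the common part \<open>u\<close> of the offset \<open>1\<^sub>J + u\<close>, where \<open>J\<close> depends on
  \<open>(v, i)\<close>. For \<open>\<bar>u $ r\<bar> \<le> m / 2\<close> all offsets satisfy \<open>\<bar>(1\<^sub>J + u) $ r\<bar> \<le> m / 2 + 1\<close>. The bound \<open>M\<close> of the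
  theorem is imposed on this function. Imposing it on the sums with one offset \<open>u\<close>, \<open>\<bar>u $ r\<bar> \<le> m / 2 + 1\<close>,
  shared by all \<open>(v, i)\<close> and without \<open>1\<^sub>J\<close> would make the remainder estimate false: for \<open>m = p = 1\<close>,
  \<open>[0,1] = [0,\<infinity>) - (1,\<infinity>)\<close>, and \<open>f x = x\<^sup>2 / 2\<close> on \<open>[-2,2]\<close>, such sums reduce to \<open>f''(u) = 1\<close>, so \<open>M = 1\<close> would be
  admissible and the estimate would be about \<open>1/24\<close>, while the remainder is \<open>1/12\<close>. The sums over lattice points have only finitely many nonzero terms when \<open>f\<close> is compactly
  supported and the matrices are unimodular.\<close>

definition signed_lattice_sum ::
  "(real ^ 'n::finite) set \<Rightarrow> (real ^ 'n \<Rightarrow> 'i set) \<Rightarrow> (real ^ 'n \<Rightarrow> 'i \<Rightarrow> nat) \<Rightarrow>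
   (real ^ 'n \<Rightarrow> 'i \<Rightarrow> int ^ 'n ^ 'n) \<Rightarrow> (real ^ 'n \<Rightarrow> 'i \<Rightarrow> 'n set) \<Rightarrow> (real ^ 'n \<Rightarrow> real) \<Rightarrow>
   nat ^ 'n \<Rightarrow> real ^ 'n \<Rightarrow> real"
  where
  "signed_lattice_sum V I t A J f \<alpha> u =
     (\<Sum>v\<in>V. \<Sum>i\<in>I v. (-1) ^ t v i *
        (\<Sum>\<^sub>\<infinity>k\<in>UNIV. mixed_partial \<alpha> (\<lambda>y. f (chart v (A v i) y))
                     (real_vec k + one_on (J v i) + u)))"

definition remainder_R ::
  "nat \<Rightarrow> (real ^ 'n::finite) set \<Rightarrow> (real ^ 'n \<Rightarrow> 'i set) \<Rightarrow> (real ^ 'n \<Rightarrow> 'i \<Rightarrow> nat) \<Rightarrow>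
   (real ^ 'n \<Rightarrow> 'i \<Rightarrow> int ^ 'n ^ 'n) \<Rightarrow> (real ^ 'n \<Rightarrow> 'i \<Rightarrow> 'n set) \<Rightarrow> (real ^ 'n \<Rightarrow> real) \<Rightarrow> real"
  where
  "remainder_R m V I t A J f =
     real m / 2 ^ (2 * m + CARD('n) - 1) *
     (\<Sum>\<alpha> | mi_norm \<alpha> = 2 * m. 1 / mi_fact \<alpha> *
        (LINT s : {0..1} | lborel. (1 - s) ^ (2 * m - 1) *
          (LINT u : {x. \<forall>r. x $ r \<in> {-1..1}} | lborel. mi_power u \<alpha> *
            (\<Sum>j\<in>{1 .. vec m}. gamma_vec m j * mi_power (real_vec j) (\<alpha> + 1) *
               signed_lattice_sum V I t A J f \<alpha> (\<chi> r. s * real (j $ r) * u $ r / 2)))))"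

end

theory Submission
  imports Defs "HOL-Library.Multiset"
begin

text \<open>Taylor's formula of order \<open>2 * m\<close> at a point \<open>x\<close> is averaged over the boxes
\<open>x + j * [-1/2, 1/2]\<^sup>p\<close>, \<open>j \<in> [m]\<^sup>p\<close>, with the weights \<open>gamma_vec m j\<close> times the volume of the box. The weights
are chosen so that every monomial of degree between \<open>1\<close> and \<open>2 * m - 1\<close> averages to zero: odd powers vanish by
symmetry, even powers because a finite difference of order \<open>2 * m\<close> kills polynomials of smaller degree
(\<open>gamma_vec_moment\<close>). Hence \<open>h x\<close> is a combination of integrals of \<open>h\<close> over boxes around \<open>x\<close>, minus the
Taylor remainder (\<open>taylor_quadrature\<close>).

Summation over \<open>x = k + 1\<^sub>J\<close>, \<open>k \<ge> 0\<close>, turns boxes into orthants. A box with integer side lengths splits into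
unit cells, the unit cells belonging to consecutive \<open>k\<close> fill a shifted orthant, and counting how often a given
shift \<open>\<beta>\<close> arises turns \<open>gamma\<close> into \<open>tau\<close> (\<open>orthant_decomposition\<close>). This gives the formula for one cone
(\<open>cone_summation_formula\<close>). A unimodular map permutes \<open>\<int>\<^sup>p\<close> and preserves Lebesgue measure, so the formula
transfers to every cone of the given decomposition of the polytope, and adding up with signs proves the
summation formula.

For the bound, \<open>M\<close> is pulled out of the remainder. The sum over \<open>\<alpha>\<close> collapses by the multinomial theorem to
\<open>(\<Sum>r. j\<^sub>r \<bar>u\<^sub>r\<bar>)\<^sup>2\<^sup>m / (2 m)!\<close>, and the power mean inequality separates the coordinates. What remains are two sums
in one variable: \<open>\<Sum>j. \<bar>gamma m j\<bar> j = 4\<^sup>m / (2m choose m) - 1 \<le> sqrt (pi m)\<close> from the Wallis product, and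
\<open>\<Sum>j. \<bar>gamma m j\<bar> j\<^sup>2\<^sup>m\<^sup>+\<^sup>1\<close>. The latter is estimated by a Chernoff bound \<open>j\<^sup>2\<^sup>m \<le> const * exp (l j)\<close> followed by the
binomial theorem; minimising over \<open>l\<close> yields exactly \<open>Lambda_star\<close>, since maximising \<open>Lambda_fun\<close> over
\<open>t\<close> and minimising the Chernoff bound over \<open>l\<close> are dual problems with a common saddle point
(\<open>Lambda_fun_le_dual\<close>, \<open>Lambda_saddle_point\<close>). The constant \<open>1.0331\<close> is nearly attained for \<open>m = p = 1\<close>; for
\<open>m \<ge> 2\<close> the Chernoff bound leaves room.\<close>

section \<open>The constants: the maximum of the function defining Lambda, and sums of gamma coefficients\<close>

lemma Lambda_fun_eq_exp:
  assumes "0 < t" "t < 1"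
  shows "Lambda_fun t = exp ((t - 1) * ln (1 - t) - (1 + t) * ln (1 + t) + 2 * ln t)"
proof -
  have "exp (2 * ln t) = t\<^sup>2"
    using assms by (simp add: exp_double)
  moreover have "(- 1 - t) * ln (1 + t) = - ((1 + t) * ln (1 + t))"
    by (simp add: algebra_simps)
  ultimately show ?thesis
    using assms by (simp only: Lambda_fun_def powr_def diff_conv_add_uminus exp_add) auto
qed

text \<open>The logarithm of \<open>Lambda_fun t\<close> is, up to a constant, \<open>2 ln t\<close> plus twice the entropy of
the weights \<open>(1 \<plusminus> t) / 2\<close>. Both are bounded by tangent lines, that is, by
\<open>ln z \<le> z - 1\<close>: the first at \<open>t = 2 / l\<close>, the entropy at the tilted weights \<open>exp (\<plusminus> l / 2) / (2 cosh (l / 2))\<close>. The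
terms \<open>\<plusminus> t * l\<close> cancel.\<close>

lemma Lambda_fun_le_dual:
  assumes t: "0 < t" "t < 1" and l: "0 < l"
  shows "Lambda_fun t \<le> (2 * cosh (l / 2) / (exp 1 * l))\<^sup>2"
proof -
  define c where "c = cosh (l / 2)"
  have c: "c > 0" by (simp add: c_def)
  have c2: "exp (l / 2) + exp (- (l / 2)) = 2 * c"
    by (simp add: c_def cosh_def)
  have a: "ln t + ln l - ln 2 \<le> t * l / 2 - 1"
    using ln_le_minus_one[of "t * l / 2"] t l by (simp add: ln_mult ln_div)
  have bound: "w * (z - ln w - ln c) \<le> exp z / c - w" if "w > 0" for w z :: real
  proof -
    have "z - ln w - ln c = ln (exp z / (w * c))"
      using that c by (simp add: ln_mult ln_div)
    also have "\<dots> \<le> exp z / (w * c) - 1"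
      using that c by (intro ln_le_minus_one) simp
    finally have "w * (z - ln w - ln c) \<le> w * (exp z / (w * c) - 1)"
      using that by (intro mult_left_mono) auto
    also have "\<dots> = exp z / c - w"
      using that by (simp add: field_simps)
    finally show ?thesis .
  qed
  have b: "(1 + t) * (l / 2 - ln (1 + t) - ln c) \<le> exp (l / 2) / c - (1 + t)"
    "(1 - t) * (- (l / 2) - ln (1 - t) - ln c) \<le> exp (- (l / 2)) / c - (1 - t)"
    using bound[of "1 + t" "l / 2"] bound[of "1 - t" "- (l / 2)"] t by auto
  have s: "exp (l / 2) / c + exp (- (l / 2)) / c = 2"
    using c2 c by (simp add: field_simps)
  have "(t - 1) * ln (1 - t) - (1 + t) * ln (1 + t) + 2 * ln t
      \<le> 2 * (ln 2 + ln c - 1 - ln l)"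
  proof -
    have "(1 + t) * (l / 2 - ln (1 + t) - ln c) + (1 - t) * (- (l / 2) - ln (1 - t) - ln c)
        = t * l - (1 + t) * ln (1 + t) + (t - 1) * ln (1 - t) - 2 * ln c"
      by (simp add: field_simps)
    with b s have "t * l + ((t - 1) * ln (1 - t) - (1 + t) * ln (1 + t)) - 2 * ln c \<le> 0" by linarith
    moreover have "t * l / 2 = t * l * (1/2)" by simp
    ultimately show ?thesis using a unfolding right_diff_distrib distrib_left by linarith
  qed
  also have "\<dots> = ln ((2 * c / (exp 1 * l))\<^sup>2)"
    using c l by (simp add: ln_mult ln_div ln_realpow)
  finally have "Lambda_fun t \<le> exp (ln ((2 * c / (exp 1 * l))\<^sup>2))"
    using t by (simp add: Lambda_fun_eq_exp)
  then show ?thesis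
    using c l by (simp add: c_def)
qed

lemma exp_ge_taylor:
  assumes "0 \<le> (x::real)"
  shows "(\<Sum>k<n. x ^ k / fact k) \<le> exp x"
proof -
  have "(\<lambda>k. x ^ k / fact k) sums exp x"
    using exp_converges[of x] by (simp add: divide_inverse mult.commute)
  then show ?thesis
    using assms sum_le_suminf[of "\<lambda>k. x ^ k / fact k" "{..<n}"]
    by (auto simp: sums_iff)
qed

text \<open>Equality in the dual bound needs \<open>t = 2 / l\<close> and \<open>exp l = (1 + t) / (1 - t)\<close>, hence \<open>2 / t = ln ((1 + t) / (1 - t))\<close>.
This equation has a root in \<open>[1/2, 9/10]\<close> by the intermediate value theorem.\<close>

lemma Lambda_saddle_point:
  obtains t where "0 < t" "t < 1" "Lambda_fun t = (2 * cosh (2 / t / 2) / (exp 1 * (2 / t)))\<^sup>2"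
proof -
  define h where "h t = ln (1 + t) - ln (1 - t) - 2 / t" for t :: real
  have "h (1/2) \<le> 0"
  proof -
    have "h (1/2) = ln 3 - 4"
      by (simp add: h_def ln_div)
    also have "ln 3 \<le> (3::real) - 1"
      by (rule ln_le_minus_one) simp
    finally show ?thesis by simp
  qed
  moreover have "0 \<le> h (9/10)"
  proof -
    have "exp (20/9 :: real) \<le> 19"
    proof -
      have "exp (20/9 :: real) \<le> exp (9/4)" by simp
      also have "\<dots> = exp (1/4) ^ 9" by (simp add: exp_of_nat_mult[symmetric])
      also have "\<dots> \<le> (1 + 1/4 + (1/4)\<^sup>2) ^ 9"
        by (intro power_mono exp_bound) auto
      also have "(1 + 1/4 + (1/4 :: real)\<^sup>2) ^ 9 \<le> 19"
        by (simp add: power2_eq_square power_divide)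
      finally show ?thesis by simp
    qed
    then have "20/9 \<le> ln (19::real)"
      by (subst ln_ge_iff) auto
    then show ?thesis
      by (simp add: h_def ln_div)
  qed
  moreover have "continuous_on {1/2..9/10} h"
    unfolding h_def by (intro continuous_intros) auto
  ultimately obtain t where t: "1/2 \<le> t" "t \<le> 9/10" "h t = 0"
    using IVT'[of h "1/2" 0 "9/10"] by auto
  then have t01: "0 < t" "t < 1" by auto
  define c where "c = cosh (1 / t)"
  have c: "c > 0" by (simp add: c_def)
  have e2: "exp (2 / t) = (1 + t) / (1 - t)"
  proof -
    have "2 / t = ln ((1 + t) / (1 - t))"
      using t01 t(3) by (simp add: h_def ln_div)
    then show ?thesis using t01 by simp
  qed
  have "exp (1 / t) = exp (2 / t) * exp (- (1 / t))"
    by (simp flip: exp_add)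
  then have "c * (1 - t) = exp (- (1 / t))"
    using t01 e2 by (simp add: c_def cosh_def field_simps)
  then have "ln (c * (1 - t)) = - (1 / t)" by simp
  then have l1: "ln (1 - t) = - (1 / t) - ln c"
    using t01 c by (simp add: ln_mult)
  then have l2: "ln (1 + t) = 1 / t - ln c"
    using t(3) by (simp add: h_def)
  have "(t - 1) * ln (1 - t) - (1 + t) * ln (1 + t) + 2 * ln t = 2 * (ln c + ln t - 1)"
    using t01 by (simp add: l1 l2 field_simps)
  also have "\<dots> = ln ((c * t / exp 1)\<^sup>2)"
    using c t01 by (simp add: ln_mult ln_div ln_realpow)
  finally have "Lambda_fun t = (c * t / exp 1)\<^sup>2"
    using t01 c by (simp add: Lambda_fun_eq_exp)
  then have "Lambda_fun t = (2 * cosh (2 / t / 2) / (exp 1 * (2 / t)))\<^sup>2"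
    using t01 by (simp add: c_def field_simps)
  then show thesis using t01 that by blast
qed

text \<open>At the saddle point the upper bound, valid for all arguments, is a value of \<open>Lambda_fun\<close>; so the supremum is attained,
and it is also a value of the dual function.\<close>

lemma Lambda_star_max:
  obtains t l where "t \<in> {0<..<1}" "0 < l" "Lambda_star = Lambda_fun t"
    "\<And>s. s \<in> {0<..<1} \<Longrightarrow> Lambda_fun s \<le> Lambda_fun t"
    "Lambda_star = (2 * cosh (l / 2) / (exp 1 * l))\<^sup>2"
proof -
  obtain t where t: "0 < t" "t < 1" "Lambda_fun t = (2 * cosh (2 / t / 2) / (exp 1 * (2 / t)))\<^sup>2"
    by (rule Lambda_saddle_point)
  have max: "Lambda_fun s \<le> Lambda_fun t" if "s \<in> {0<..<1}" for s
    using that t Lambda_fun_le_dual[of s "2 / t"] by auto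
  have "Lambda_star = Lambda_fun t"
    unfolding Lambda_star_def using t(1,2) max by (intro cSup_eq_maximum) auto
  with t max show thesis
    by (intro that[of t "2 / t"]) (simp_all del: times_divide_eq_right)
qed

text \<open>The rational point \<open>5/6\<close> is close to the maximiser and makes the sixth power of \<open>Lambda_fun\<close> rational:
\<open>5 ^ 12 / 11 ^ 11\<close>.\<close>

lemma Lambda_star_lower: "0.30812 \<le> Lambda_star"
proof -
  have "Lambda_fun (5/6) ^ 6 = 5 ^ 12 / 11 ^ 11"
  proof -
    have "Lambda_fun (5/6) ^ 6 = ((1/6) powr (-1/6)) ^ 6 * ((11/6) powr (-11/6)) ^ 6 * ((5/6)\<^sup>2) ^ 6"
      by (simp add: Lambda_fun_def power_mult_distrib)
    also have "((1/6::real) powr (-1/6)) ^ 6 = 6"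
    proof -
      have "((1/6::real) powr (-1/6)) ^ 6 = (1/6) powr (- 1)"
        by (simp add: powr_power)
      also have "\<dots> = 6"
        by (subst powr_minus) simp
      finally show ?thesis .
    qed
    also have "((11/6::real) powr (-11/6)) ^ 6 = (6/11) ^ 11"
    proof -
      have "((11/6::real) powr (-11/6)) ^ 6 = (11/6) powr (- real 11)"
        by (simp add: powr_power)
      also have "\<dots> = inverse ((11/6) ^ 11)"
        by (subst powr_minus, subst powr_realpow) auto
      finally show ?thesis by (simp add: power_divide)
    qed
    finally show ?thesis by (simp add: power_divide power_mult_distrib)
  qed
  moreover have "(0.30812::real) ^ 6 \<le> 5 ^ 12 / 11 ^ 11"
    by (simp add: power_divide)
  ultimately have "(0.30812::real) ^ 6 \<le> Lambda_fun (5/6) ^ 6" by simp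
  then have "0.30812 \<le> Lambda_fun (5/6)"
    using power_le_imp_le_base[of "0.30812" 5 "Lambda_fun (5/6)"] by (simp add: Lambda_fun_def)
  moreover have "Lambda_fun (5/6) \<le> Lambda_star"
  proof -
    obtain t where "Lambda_star = Lambda_fun t" "\<And>s. s \<in> {0<..<1} \<Longrightarrow> Lambda_fun s \<le> Lambda_fun t"
      using Lambda_star_max by metis
    then show ?thesis by simp
  qed
  ultimately show ?thesis by simp
qed

text \<open>The dual bound at \<open>l = 12/5\<close>, which is \<open>2 / t\<close> for \<open>t = 5/6\<close>.\<close>

lemma Lambda_star_upper: "Lambda_star < 0.308136"
proof -
  obtain t where t: "t \<in> {0<..<1}" "Lambda_star = Lambda_fun t"
    using Lambda_star_max by metis
  have e1: "exp (1/5 :: real) \<le> 1.22141"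
  proof -
    obtain x where x: "\<bar>x\<bar> \<le> \<bar>1/5\<bar>"
      "exp (1/5::real) = (\<Sum>k<6. (1/5) ^ k / fact k) + exp x / fact 6 * (1/5) ^ 6"
      using Maclaurin_exp_le[of "1/5" 6] by blast
    have "exp x \<le> exp 1" using x(1) by simp
    then have "exp x \<le> 3" using exp_le by linarith
    then show ?thesis
      using x(2) by (simp add: eval_nat_numeral fact_numeral)
  qed
  have e2: "exp (- (11/5) :: real) \<le> 0.110805"
  proof -
    have "1/0.110805 \<le> (\<Sum>k<12. (11/5::real) ^ k / fact k)"
      by (simp add: eval_nat_numeral fact_numeral)
    also have "\<dots> \<le> exp (11/5)" by (rule exp_ge_taylor) simp
    finally show ?thesis by (simp add: exp_minus field_simps)
  qed
  have "cosh (12/5/2) * 2 / (exp 1 * (12/5)) = (exp (6/5) / exp 1 + exp (-(6/5)) / exp 1) / (12/5::real)"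
    by (simp add: cosh_def field_simps)
  also have "\<dots> = (exp (1/5) + exp (- (11/5))) / (12/5::real)"
    by (simp flip: exp_diff)
  also have "\<dots> \<le> (1.22141 + 0.110805) / (12/5::real)"
    using e1 e2 by (intro divide_right_mono add_mono) auto
  finally have "(2 * cosh (12/5/2) / (exp 1 * (12/5)))\<^sup>2 \<le> ((1.22141 + 0.110805) / (12/5::real))\<^sup>2"
    by (intro power_mono) (auto simp: mult.commute)
  also have "\<dots> < 0.308136"
    by (simp add: power2_eq_square)
  finally have "(2 * cosh (12/5/2) / (exp 1 * (12/5)))\<^sup>2 < (0.308136::real)" .
  moreover have "Lambda_fun t \<le> (2 * cosh (12/5/2) / (exp 1 * (12/5)))\<^sup>2"
    using t by (intro Lambda_fun_le_dual) auto
  ultimately show ?thesis using t by linarith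
qed


lemma gamma_coeff_abs_times:
  assumes "1 \<le> j"
  shows "\<bar>gamma_coeff m j\<bar> * real j = 2 * real ((2 * m) choose (m + j)) / real ((2 * m) choose m)"
  using assms by (simp add: gamma_coeff_def abs_mult power_abs)

lemma four_power_div_central_binomial_Suc:
  "4 ^ Suc m / real ((2 * Suc m) choose (Suc m))
     = 4 ^ m / real ((2 * m) choose m) * ((2 * real m + 2) / (2 * real m + 1))"
proof -
  have a: "real ((2 * Suc m) choose (Suc m)) = fact (2 * m + 2) / (fact (Suc m) * fact (Suc m))"
    by (subst binomial_fact) (auto simp: algebra_simps simp del: fact_Suc)
  have b: "real ((2 * m) choose m) = fact (2 * m) / (fact m * fact m)"
    by (subst binomial_fact) (auto simp: mult_2)
  have c: "fact (2 * m + 2) = (2 * real m + 2) * (2 * real m + 1) * fact (2 * m)"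
    by (simp add: algebra_simps)
  have d: "fact (Suc m) = (real m + 1) * fact m" by (simp add: algebra_simps)
  show ?thesis
    unfolding a b c d by (simp add: divide_simps) (simp add: algebra_simps)
qed

lemma four_power_div_central_binomial_le_linear:
  assumes "2 \<le> m"
  shows "4 ^ m / real ((2 * m) choose m) \<le> 4 / 3 * real m"
  using assms
proof (induction m rule: dec_induct)
  case base
  show ?case by (simp add: eval_nat_numeral)
next
  case (step m)
  have "(2 * real m + 2) / (2 * real m + 1) \<le> (real m + 1) / real m"
    using step.hyps by (simp add: divide_simps) (simp add: algebra_simps)
  then have "4 ^ Suc m / real ((2 * Suc m) choose (Suc m)) \<le> 4 / 3 * real m * ((real m + 1) / real m)"
    unfolding four_power_div_central_binomial_Suc using step.IH by (intro mult_mono) auto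
  then show ?case using step.hyps by simp
qed

text \<open>The square of the left-hand side is \<open>2 m + 1\<close> times the \<open>m\<close>-th partial Wallis product, and these increase to
\<open>pi / 2\<close>.\<close>

lemma four_power_div_central_binomial_le_sqrt:
  "4 ^ m / real ((2 * m) choose m) \<le> sqrt (pi * (real m + 1 / 2))"
proof -
  define W where "W n = (\<Prod>k=1..n. (4 * real k ^ 2) / (4 * real k ^ 2 - 1))" for n
  have W: "W \<longlonglongrightarrow> pi / 2"
    using wallis unfolding W_def .
  have "incseq W"
  proof (rule incseq_SucI)
    fix n
    have "W n \<ge> 0"
      unfolding W_def
    proof (intro prod_nonneg)
      fix k assume "k \<in> {1..n}"
      then have "1 \<le> real k ^ 2" by simp
      then show "0 \<le> 4 * (real k)\<^sup>2 / (4 * (real k)\<^sup>2 - 1)" by simp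
    qed
    moreover have "1 \<le> (4 * real (Suc n) ^ 2) / (4 * real (Suc n) ^ 2 - 1)"
    proof -
      have "1 \<le> real (Suc n) ^ 2" by simp
      then have "0 < 4 * real (Suc n) ^ 2 - 1" by linarith
      then show ?thesis by (subst le_divide_eq_1_pos) linarith+
    qed
    ultimately have "W n * 1 \<le> W n * ((4 * real (Suc n) ^ 2) / (4 * real (Suc n) ^ 2 - 1))"
      by (intro mult_left_mono)
    then show "W n \<le> W (Suc n)" by (simp add: W_def)
  qed
  then have le: "W m \<le> pi / 2" using W by (rule incseq_le)
  have "(4 ^ m / real ((2 * m) choose m))\<^sup>2 = (2 * real m + 1) * W m"
  proof (induction m)
    case 0
    show ?case by (simp add: W_def)
  next
    case (Suc m)
    have W_Suc: "W (Suc m) = W m * ((2 * real m + 2)\<^sup>2 / ((2 * real m + 1) * (2 * real m + 3)))"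
      by (simp add: W_def power2_eq_square algebra_simps)
    have "(4 ^ Suc m / real ((2 * Suc m) choose (Suc m)))\<^sup>2
        = ((2 * real m + 1) * W m) * ((2 * real m + 2) / (2 * real m + 1))\<^sup>2"
      unfolding four_power_div_central_binomial_Suc power_mult_distrib Suc.IH ..
    also have "\<dots> = (2 * real (Suc m) + 1) * W (Suc m)"
      unfolding W_Suc by (simp add: divide_simps power2_eq_square)
    finally show ?case .
  qed
  also have "\<dots> \<le> (2 * real m + 1) * (pi / 2)"
    using le by (intro mult_left_mono) auto
  also have "\<dots> = pi * (real m + 1 / 2)" by (simp add: algebra_simps)
  finally show ?thesis by (rule real_le_rsqrt)
qed

text \<open>Index the row \<open>2 m\<close> of Pascal's triangle by the distance from its centre.\<close>

lemma central_binomial_sum_symmetric: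
  fixes h :: "int \<Rightarrow> real"
  shows "(\<Sum>i\<le>2 * m. real ((2 * m) choose i) * h (int i - int m))
    = real ((2 * m) choose m) * h 0
      + (\<Sum>j=1..m. real ((2 * m) choose (m + j)) * (h (int j) + h (- int j)))"
proof -
  let ?F = "\<lambda>i. real ((2 * m) choose i) * h (int i - int m)"
  have "{..2 * m} = {..<m} \<union> ({m} \<union> {m+1..2*m})" by auto
  then have "sum ?F {..2 * m} = sum ?F {..<m} + (?F m + sum ?F {m+1..2*m})"
    by (simp only:) (subst sum.union_disjoint; auto)+
  also have "sum ?F {m+1..2*m} = (\<Sum>j=1..m. real ((2 * m) choose (m + j)) * h (int j))"
    by (rule sum.reindex_bij_witness[of _ "\<lambda>j. m + j" "\<lambda>i. i - m"]) auto
  also have "sum ?F {..<m} = (\<Sum>j=1..m. real ((2 * m) choose (m + j)) * h (- int j))"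
  proof (rule sum.reindex_bij_witness[of _ "\<lambda>j. m - j" "\<lambda>i. m - i"])
    fix i assume "i \<in> {..<m}"
    then have i: "i < m" by simp
    then have "(2 * m) choose (m + (m - i)) = (2 * m) choose i"
      by (subst binomial_symmetric) (auto simp: mult_2)
    then show "real ((2 * m) choose (m + (m - i))) * h (- int (m - i)) = ?F i"
      using i by (simp add: of_nat_diff)
  qed auto
  finally show ?thesis
    by (simp add: sum.distrib distrib_left algebra_simps)
qed

lemma sum_gamma_coeff_abs_times:
  "(\<Sum>j=1..m. \<bar>gamma_coeff m j\<bar> * real j) = 4 ^ m / real ((2 * m) choose m) - 1"
proof -
  have "(\<Sum>i\<le>2 * m. real ((2 * m) choose i)) = 4 ^ m"
    using choose_row_sum[of "2 * m"] by (simp flip: of_nat_sum add: power_mult)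
  then have "4 ^ m = real ((2 * m) choose m) + (\<Sum>j=1..m. 2 * real ((2 * m) choose (m + j)))"
    using central_binomial_sum_symmetric[of m "\<lambda>_. 1"] by (simp add: mult.commute)
  moreover have "(\<Sum>j=1..m. \<bar>gamma_coeff m j\<bar> * real j)
      = (\<Sum>j=1..m. 2 * real ((2 * m) choose (m + j))) / real ((2 * m) choose m)"
    unfolding sum_divide_distrib by (intro sum.cong) (auto simp: gamma_coeff_abs_times)
  ultimately show ?thesis by (simp add: field_simps)
qed

lemma sum_gamma_coeff_abs_times_le:
  assumes "1 \<le> m"
  shows "(\<Sum>j=1..m. \<bar>gamma_coeff m j\<bar> * real j) \<le> sqrt (pi * real m)"
proof -
  have "pi * (real m + 1 / 2) \<le> (sqrt (pi * real m) + 1)\<^sup>2"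
  proof -
    have "1 \<le> pi * real m"
      using assms pi_gt3 mult_mono[of 1 pi 1 "real m"] by simp
    then have "1 \<le> sqrt (pi * real m)" "(sqrt (pi * real m))\<^sup>2 = pi * real m" by simp_all
    then show ?thesis
      using pi_less_4 unfolding power2_sum distrib_left one_power2 mult_1_right by linarith
  qed
  then have "sqrt (pi * (real m + 1 / 2)) \<le> sqrt (pi * real m) + 1"
    by (rule real_le_lsqrt[rotated]) simp
  then show ?thesis
    using four_power_div_central_binomial_le_sqrt[of m] unfolding sum_gamma_coeff_abs_times by linarith
qed

text \<open>The function \<open>x\<^sup>n exp (- l x)\<close> is largest at \<open>x = n / l\<close>; the proof uses \<open>z \<le> exp (z - 1)\<close> with \<open>z = l x / n\<close>.\<close>

lemma power_mult_exp_le: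
  fixes x l :: real
  assumes "0 \<le> x" "0 < l" "0 < n"
  shows "x ^ n \<le> (real n / (exp 1 * l)) ^ n * exp (l * x)"
proof -
  have "l * x / n \<le> exp (l * x / n - 1)"
    using exp_ge_add_one_self[of "l * x / n - 1"] by simp
  then have "x \<le> real n / (exp 1 * l) * exp (l * x / n)"
    using assms unfolding exp_diff by (simp add: field_simps)
  then have "x ^ n \<le> (real n / (exp 1 * l) * exp (l * x / n)) ^ n"
    using assms by (intro power_mono)
  also have "\<dots> = (real n / (exp 1 * l)) ^ n * exp (l * x)"
    using assms by (simp only: power_mult_distrib exp_of_nat_mult[symmetric]) simp
  finally show ?thesis .
qed

text \<open>Chernoff's method: replace \<open>j\<^sup>2\<^sup>m\<close> by a multiple of \<open>exp (l j)\<close>, extend the sum to the whole row of Pascal's triangle,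
and apply the binomial theorem.\<close>

lemma sum_central_binomial_power_le:
  assumes "0 < l" "1 \<le> m"
  shows "(\<Sum>j=1..m. real ((2 * m) choose (m + j)) * real j ^ (2 * m))
     \<le> (4 * real m ^ 2 * (2 * cosh (l / 2) / (exp 1 * l))\<^sup>2) ^ m"
proof -
  define K where "K = (2 * real m / (exp 1 * l)) ^ (2 * m)"
  have K: "K \<ge> 0" by (simp add: K_def)
  have "(\<Sum>j=1..m. real ((2 * m) choose (m + j)) * real j ^ (2 * m))
      \<le> (\<Sum>j=1..m. real ((2 * m) choose (m + j)) * (K * exp (l * real j)))"
    using power_mult_exp_le[of _ l "2 * m"] assms
    by (intro sum_mono mult_left_mono) (auto simp: K_def)
  also have "\<dots> = K * (\<Sum>j=1..m. real ((2 * m) choose (m + j)) * exp (l * real j))"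
    by (simp add: sum_distrib_left algebra_simps)
  also have "\<dots> \<le> K * (\<Sum>i\<le>2 * m. real ((2 * m) choose i) * exp (l * (real i - real m)))"
  proof (intro mult_left_mono K)
    have "(\<Sum>j=1..m. real ((2 * m) choose (m + j)) * exp (l * real j))
       \<le> (\<Sum>j=1..m. real ((2 * m) choose (m + j)) * (exp (l * real j) + exp (- (l * real j))))"
      by (intro sum_mono mult_left_mono) auto
    also have "\<dots> \<le> (\<Sum>i\<le>2 * m. real ((2 * m) choose i) * exp (l * (real i - real m)))"
      using central_binomial_sum_symmetric[of m "\<lambda>x. exp (l * of_int x)"] by simp
    finally show "(\<Sum>j=1..m. real ((2 * m) choose (m + j)) * exp (l * real j))
       \<le> (\<Sum>i\<le>2 * m. real ((2 * m) choose i) * exp (l * (real i - real m)))" .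
  qed
  also have "(\<Sum>i\<le>2 * m. real ((2 * m) choose i) * exp (l * (real i - real m)))
      = (\<Sum>i\<le>2 * m. real ((2 * m) choose i) * exp (l / 2) ^ i * exp (- (l / 2)) ^ (2 * m - i))"
  proof (intro sum.cong refl)
    fix i assume "i \<in> {..2 * m}"
    then have "l * (real i - real m) = real i * (l / 2) + real (2 * m - i) * (- (l / 2))"
      by (simp add: of_nat_diff field_simps)
    then show "real ((2 * m) choose i) * exp (l * (real i - real m))
        = real ((2 * m) choose i) * exp (l / 2) ^ i * exp (- (l / 2)) ^ (2 * m - i)"
      by (simp only: exp_add exp_of_nat_mult mult.assoc)
  qed
  also have "\<dots> = (exp (l / 2) + exp (- (l / 2))) ^ (2 * m)"
    by (simp add: binomial_ring)
  also have "exp (l / 2) + exp (- (l / 2)) = 2 * cosh (l / 2)"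
    by (simp add: cosh_def)
  also have "K * (2 * cosh (l / 2)) ^ (2 * m) = (4 * real m ^ 2 * (2 * cosh (l / 2) / (exp 1 * l))\<^sup>2) ^ m"
    unfolding K_def power_mult power_mult_distrib[symmetric]
    by (simp add: power_mult_distrib power_divide)
  finally show ?thesis .
qed

lemma pi_lower: "3.14159 \<le> pi"
  using pi_approx by simp

text \<open>Up to the factor \<open>2 * 4 ^ m / (2 m choose m)\<close>, which is at most linear in \<open>m\<close>, the Chernoff bound at the saddle point
is the claim; this is enough for \<open>m \<ge> 2\<close>. For \<open>m = 1\<close> the sum equals \<open>1\<close>, and the claim reduces to
\<open>1 \<le> 1.0331 * pi * Lambda_star\<close>, which holds only narrowly.\<close>

lemma sum_gamma_coeff_power_le:
  assumes "1 \<le> m"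
  shows "(\<Sum>j=1..m. \<bar>gamma_coeff m j\<bar> * real j * real j ^ (2 * m))
    \<le> 1.0331 * (pi * real m) * (4 * kappa\<^sup>2 * real m ^ 2) ^ m"
proof -
  obtain l where l: "0 < l" "Lambda_star = (2 * cosh (l / 2) / (exp 1 * l))\<^sup>2"
    using Lambda_star_max by metis
  have L0: "0 \<le> Lambda_star" using Lambda_star_lower by simp
  then have kap: "4 * kappa\<^sup>2 = Lambda_star"
    by (simp add: kappa_def)
  have "\<And>j. j \<in> {1..m} \<Longrightarrow> \<bar>gamma_coeff m j\<bar> * real j * real j ^ (2 * m)
     = 2 / real ((2 * m) choose m) * (real ((2 * m) choose (m + j)) * real j ^ (2 * m))"
    by (subst gamma_coeff_abs_times) auto
  then have S: "(\<Sum>j=1..m. \<bar>gamma_coeff m j\<bar> * real j * real j ^ (2 * m))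
     = 2 / real ((2 * m) choose m) * (\<Sum>j=1..m. real ((2 * m) choose (m + j)) * real j ^ (2 * m))"
    unfolding sum_distrib_left by (intro sum.cong) auto
  show ?thesis
  proof (cases "m = 1")
    case True
    \<comment> \<open>The product is about \<open>1.00003\<close>.\<close>
    have "1 \<le> 1.0331 * 3.14159 * (0.30812::real)" by simp
    also have "\<dots> \<le> 1.0331 * pi * Lambda_star"
      using pi_lower Lambda_star_lower by (intro mult_mono) auto
    finally show ?thesis
      using True unfolding S kap by (simp add: numeral_2_eq_2)
  next
    case False
    with assms have m: "2 \<le> m" by simp
    have "(\<Sum>j=1..m. \<bar>gamma_coeff m j\<bar> * real j * real j ^ (2 * m))
       \<le> 2 / real ((2 * m) choose m) * (4 * real m ^ 2 * Lambda_star) ^ m"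
      unfolding S l(2) using l(1) assms
      by (intro mult_left_mono sum_central_binomial_power_le) auto
    also have "\<dots> = 2 * (4 ^ m / real ((2 * m) choose m)) * (Lambda_star * real m ^ 2) ^ m"
      by (simp add: power_mult_distrib)
    also have "\<dots> \<le> 2 * (4 / 3 * real m) * (Lambda_star * real m ^ 2) ^ m"
      using m L0 by (intro mult_left_mono mult_right_mono four_power_div_central_binomial_le_linear) auto
    also have "\<dots> \<le> 1.0331 * (pi * real m) * (Lambda_star * real m ^ 2) ^ m"
    proof (intro mult_right_mono)
      have "2 * (4 / 3) * real m \<le> 1.0331 * pi * real m"
        using pi_gt3 by (intro mult_right_mono) auto
      then show "2 * (4 / 3 * real m) \<le> 1.0331 * (pi * real m)" by simp
    qed (use L0 in auto)
    finally show ?thesis unfolding kap .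
  qed
qed

lemma kappa_bounds: "0.27754 \<le> kappa" "kappa < 0.27755"
proof -
  show "0.27754 \<le> kappa"
    unfolding kappa_def using Lambda_star_lower
    by (intro real_le_rsqrt) (simp add: power2_eq_square)
  have "sqrt (Lambda_star / 4) < sqrt (0.27755\<^sup>2)"
    using Lambda_star_upper by (simp add: power2_eq_square)
  then show "kappa < 0.27755"
    unfolding kappa_def by (simp only: real_sqrt_abs) simp
qed

section \<open>Unimodular maps preserve Lebesgue measure\<close>

definition int_vec :: "int ^ 'n \<Rightarrow> real ^ 'n" where
  "int_vec k = (\<chi> r. real_of_int (k $ r))"

definition unit_cell :: "(real ^ 'n) set" where
  "unit_cell = {x. \<forall>r. 0 \<le> x $ r \<and> x $ r < 1}"

abbreviation real_matrix :: "int ^ 'n ^ 'n \<Rightarrow> real ^ 'n ^ 'n" where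
  "real_matrix A \<equiv> map_matrix real_of_int A"

lemma det_map_matrix_of_int: "det (map_matrix real_of_int A) = real_of_int (det A)"
  by (simp add: det_def)

lemma unimodular_det_cases:
  assumes "unimodular A"
  shows "det (map_matrix real_of_int A) = 1 \<or> det (map_matrix real_of_int A) = -1"
  using assms unfolding unimodular_def det_map_matrix_of_int by auto

lemma det_Ints:
  fixes B :: "real ^ 'n ^ 'n"
  assumes "\<And>i j. B $ i $ j \<in> \<int>"
  shows "det B \<in> \<int>"
  unfolding det_def using assms by (intro Ints_sum Ints_mult Ints_prod) auto

lemma real_matrix_int_points:
  assumes "x \<in> int_points"
  shows "real_matrix A *v x \<in> int_points"
  using assms by (auto simp: int_points_def matrix_vector_mult_def intro!: Ints_sum Ints_mult)

text \<open>By Cramer's rule the inverse image of an integer point has coordinates that are integer determinants divided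
by \<open>\<plusminus>1\<close>.\<close>

lemma unimodular_int_points_iff:
  assumes "unimodular A"
  shows "real_matrix A *v x \<in> int_points \<longleftrightarrow> x \<in> int_points"
proof
  assume b: "real_matrix A *v x \<in> int_points"
  let ?D = "det (real_matrix A)"
  have D: "?D = 1 \<or> ?D = -1" using assms by (rule unimodular_det_cases)
  then have "?D \<noteq> 0" by auto
  then have "x = (\<chi> k. det (\<chi> i j. if j = k then (real_matrix A *v x) $ i else real_matrix A $ i $ j) / ?D)"
    using iffD1[OF cramer refl] by blast
  then have x: "x $ k = det (\<chi> i j. if j = k then (real_matrix A *v x) $ i else real_matrix A $ i $ j) / ?D" for k
    by (rule arg_cong[where f = "\<lambda>y. y $ k", THEN trans]) simp
  show "x \<in> int_points"
    unfolding int_points_def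
  proof safe
    fix k
    have "det (\<chi> i j. if j = k then (real_matrix A *v x) $ i else real_matrix A $ i $ j) \<in> \<int>"
      using b by (intro det_Ints) (auto simp: int_points_def)
    with D have "det (\<chi> i j. if j = k then (real_matrix A *v x) $ i else real_matrix A $ i $ j) / ?D \<in> \<int>"
      by auto
    then show "x $ k \<in> \<int>"
      by (simp only: x[of k, symmetric])
  qed
qed (rule real_matrix_int_points)

lemma unimodular_inverse:
  assumes "unimodular (A :: int ^ 'n::finite ^ 'n)"
  obtains B where "\<And>x. real_matrix A *v (B *v x) = x" "\<And>x. B *v (real_matrix A *v x) = x"
proof -
  have "invertible (real_matrix A)"
    using unimodular_det_cases[OF assms] by (auto simp: invertible_det_nz)
  then obtain B where "real_matrix A ** B = mat 1" "B ** real_matrix A = mat 1"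
    by (auto simp: invertible_def)
  then show thesis
    by (intro that[of B]) (simp_all add: matrix_vector_mul_assoc)
qed

lemma nn_integral_lborel_translate:
  fixes f :: "'a::euclidean_space \<Rightarrow> ennreal"
  assumes [measurable]: "f \<in> borel_measurable borel"
  shows "(\<integral>\<^sup>+x. f (x + a) \<partial>lborel) = (\<integral>\<^sup>+x. f x \<partial>lborel)"
proof -
  have "(\<integral>\<^sup>+x. f x \<partial>lborel) = (\<integral>\<^sup>+x. f x \<partial>distr lborel borel ((+) a))"
    by (simp only: lborel_distr_plus)
  also have "\<dots> = (\<integral>\<^sup>+x. f (x + a) \<partial>lborel)"
    by (subst nn_integral_distr) (auto simp: add.commute)
  finally show ?thesis ..
qed

lemma nn_integral_lborel_reflect:
  fixes f :: "'a::euclidean_space \<Rightarrow> ennreal"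
  assumes [measurable]: "f \<in> borel_measurable borel"
  shows "(\<integral>\<^sup>+y. f (x - y) \<partial>lborel) = (\<integral>\<^sup>+y. f y \<partial>lborel)"
proof -
  let ?N = "distr lborel borel (\<lambda>y :: 'a. x + (-1) *\<^sub>R y)"
  have "density ?N (\<lambda>_. ennreal (\<bar>-1\<bar> ^ DIM('a))) = lborel"
    by (rule lborel_affine[symmetric]) simp
  then have "density ?N (\<lambda>_. 1) = lborel" by simp
  then have N: "?N = lborel" by (simp only: density_1)
  have "(\<integral>\<^sup>+y. f y \<partial>?N) = (\<integral>\<^sup>+y. f (x + (-1) *\<^sub>R y) \<partial>lborel)"
    by (rule nn_integral_distr) measurable
  then show ?thesis by (simp only: N) simp
qed

text \<open>This is the uniqueness of Haar measure for the translation invariant functional \<open>f \<mapsto> \<integral> f (L x) dx\<close>. In the double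
integral of \<open>f (L x) * g (y + L x)\<close>, integrating over \<open>y\<close> first gives the left-hand side; shifting \<open>x\<close> so that
\<open>L x\<close> becomes \<open>L x - y\<close>, and reflecting \<open>y\<close>, gives the right-hand side.\<close>

lemma nn_integral_linear_proportional:
  fixes L L' :: "'a::euclidean_space \<Rightarrow> 'a" and f g :: "'a \<Rightarrow> ennreal"
  assumes lin: "linear L" and inv: "\<And>y. L (L' y) = y"
    and [measurable]: "f \<in> borel_measurable borel" "g \<in> borel_measurable borel"
  shows "(\<integral>\<^sup>+x. f (L x) \<partial>lborel) * (\<integral>\<^sup>+x. g x \<partial>lborel)
       = (\<integral>\<^sup>+x. g (L x) \<partial>lborel) * (\<integral>\<^sup>+x. f x \<partial>lborel)"
proof -
  have [measurable]: "L \<in> borel_measurable borel"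
    using lin by (intro borel_measurable_continuous_onI linear_continuous_on) (simp only: linear_conv_bounded_linear)
  have "(\<integral>\<^sup>+x. f (L x) \<partial>lborel) * (\<integral>\<^sup>+y. g y \<partial>lborel)
      = (\<integral>\<^sup>+x. (\<integral>\<^sup>+y. f (L x) * g (y + L x) \<partial>lborel) \<partial>lborel)"
    by (simp add: nn_integral_multc nn_integral_cmult nn_integral_lborel_translate)
  also have "\<dots> = (\<integral>\<^sup>+y. (\<integral>\<^sup>+x. f (L x) * g (y + L x) \<partial>lborel) \<partial>lborel)"
    by (rule lborel_pair.Fubini') measurable
  also have "\<dots> = (\<integral>\<^sup>+y. (\<integral>\<^sup>+x. f (L x - y) * g (L x) \<partial>lborel) \<partial>lborel)"
  proof (rule nn_integral_cong)
    fix y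
    have "(\<integral>\<^sup>+x. f (L x - y) * g (L x) \<partial>lborel) = (\<integral>\<^sup>+x. f (L (x + L' y) - y) * g (L (x + L' y)) \<partial>lborel)"
      by (rule nn_integral_lborel_translate[symmetric]) measurable
    then show "(\<integral>\<^sup>+x. f (L x) * g (y + L x) \<partial>lborel) = (\<integral>\<^sup>+x. f (L x - y) * g (L x) \<partial>lborel)"
      by (simp add: linear_add[OF lin] inv add.commute)
  qed
  also have "\<dots> = (\<integral>\<^sup>+x. (\<integral>\<^sup>+y. f (L x - y) * g (L x) \<partial>lborel) \<partial>lborel)"
    by (rule lborel_pair.Fubini'[symmetric]) measurable
  also have "\<dots> = (\<integral>\<^sup>+x. (\<integral>\<^sup>+y. f y \<partial>lborel) * g (L x) \<partial>lborel)"
    by (simp add: nn_integral_multc nn_integral_lborel_reflect)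
  also have "\<dots> = (\<integral>\<^sup>+x. g (L x) \<partial>lborel) * (\<integral>\<^sup>+x. f x \<partial>lborel)"
    by (subst nn_integral_cmult) (auto simp: mult.commute)
  finally show ?thesis .
qed

lemma unit_cell_borel [measurable]: "(unit_cell :: (real ^ 'n::finite) set) \<in> sets borel"
  unfolding unit_cell_def by measurable

lemma emeasure_unit_cell: "emeasure lborel (unit_cell :: (real ^ 'n::finite) set) = 1"
proof (rule antisym)
  have one: "emeasure lborel (cbox 0 (1::real^'n)) = 1" "emeasure lborel (box 0 (1::real^'n)) = 1"
    by (auto simp: emeasure_lborel_cbox_eq emeasure_lborel_box_eq Basis_vec_def inner_axis intro!: prod.neutral)
  have "emeasure lborel (unit_cell :: (real^'n) set) \<le> emeasure lborel (cbox 0 (1::real^'n))"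
    by (rule emeasure_mono) (auto simp: unit_cell_def mem_box_cart less_imp_le)
  with one show "emeasure lborel (unit_cell :: (real ^ 'n::finite) set) \<le> 1" by simp
  have "emeasure lborel (box 0 (1::real^'n)) \<le> emeasure lborel (unit_cell :: (real^'n) set)"
    by (rule emeasure_mono) (auto simp: unit_cell_def mem_box_cart less_imp_le)
  with one show "1 \<le> emeasure lborel (unit_cell :: (real ^ 'n::finite) set)" by simp
qed

lemma unit_cell_tiles:
  shows "x - int_vec (\<chi> r. \<lfloor>x $ r\<rfloor>) \<in> unit_cell"
    and "x - int_vec k \<in> unit_cell \<Longrightarrow> k = (\<chi> r. \<lfloor>x $ r\<rfloor>)"
proof -
  show "x - int_vec (\<chi> r. \<lfloor>x $ r\<rfloor>) \<in> unit_cell"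
    by (auto simp: unit_cell_def int_vec_def) linarith+
  assume "x - int_vec k \<in> unit_cell"
  then have "\<lfloor>x $ r\<rfloor> = k $ r" for r
    by (intro floor_unique) (auto simp: unit_cell_def int_vec_def algebra_simps)
  then show "k = (\<chi> r. \<lfloor>x $ r\<rfloor>)" by (simp add: vec_eq_iff)
qed

lemma int_points_iff_int_vec: "x \<in> int_points \<longleftrightarrow> (\<exists>k. x = int_vec k)"
proof
  assume "x \<in> int_points"
  then have "\<forall>r. \<exists>k. x $ r = real_of_int k" by (auto simp: int_points_def Ints_def)
  then obtain k where "\<And>r. x $ r = real_of_int (k r)" by metis
  then have "x = int_vec (vec_lambda k)" by (simp add: int_vec_def vec_eq_iff)
  then show "\<exists>k. x = int_vec k" ..
qed (auto simp: int_points_def int_vec_def)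

lemma int_vec_eq_iff: "int_vec k = int_vec l \<longleftrightarrow> k = l"
  by (simp add: int_vec_def vec_eq_iff)

text \<open>The unit cell and its preimage under a unimodular map are both fundamental domains of the lattice \<open>\<int>\<^sup>p\<close>. Cutting
the preimage along the translates of the unit cell and moving the pieces back into the unit cell tiles the latter.\<close>

lemma emeasure_unimodular_unit_cell:
  fixes A :: "int ^ 'n::finite ^ 'n"
  assumes "unimodular A"
  shows "emeasure lborel {x. real_matrix A *v x \<in> unit_cell} = 1"
proof -
  let ?L = "\<lambda>x. real_matrix A *v x"
  obtain B where B: "\<And>x. ?L (B *v x) = x" "\<And>x. B *v ?L x = x"
    using unimodular_inverse[OF assms] by blast
  have [measurable]: "?L \<in> borel_measurable borel"
    by (intro borel_measurable_continuous_onI) (simp add: matrix_vector_mult_linear_continuous_on)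
  let ?D = "{x. ?L x \<in> unit_cell}"
  have tile: "\<exists>!k. ?L (x + int_vec k) \<in> unit_cell" for x
  proof -
    let ?q = "int_vec (\<chi> r. \<lfloor>?L x $ r\<rfloor>) :: real ^ 'n"
    have L: "?L (x + int_vec k) = ?L x - (- ?L (int_vec k))" for k
      by (simp add: matrix_vector_right_distrib)
    have "- (B *v ?q) \<in> int_points"
      using unimodular_int_points_iff[OF assms, of "B *v ?q"]
      by (auto simp: B int_points_iff_int_vec int_points_def int_vec_def)
    then obtain k where k: "int_vec k = - (B *v ?q)" by (metis int_points_iff_int_vec)
    have minus: "C *v (- x) = - (C *v x)" for C :: "real ^ 'n ^ 'n" and x
      by (simp add: linear_neg)
    show ?thesis
    proof (rule ex1I)
      have "- ?L (int_vec k) = ?q" by (simp add: k minus B)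
      then show "?L (x + int_vec k) \<in> unit_cell"
        unfolding L using unit_cell_tiles(1)[of "?L x"] by simp
    next
      fix l assume l: "?L (x + int_vec l) \<in> unit_cell"
      have "- ?L (int_vec l) \<in> int_points"
        using real_matrix_int_points[of "int_vec l" A] by (auto simp: int_points_def int_vec_def)
      then obtain l' where l': "- ?L (int_vec l) = int_vec l'" by (metis int_points_iff_int_vec)
      then have "- ?L (int_vec l) = ?q"
        using l unit_cell_tiles(2)[of "?L x" l'] unfolding L by simp
      then have "B *v (- ?L (int_vec l)) = B *v ?q" by simp
      then have "int_vec l = int_vec k" unfolding k minus B by (metis minus_minus)
      then show "l = k" by (simp add: int_vec_eq_iff)
    qed
  qed
  then obtain K where K: "\<And>x. ?L (x + int_vec (K x)) \<in> unit_cell"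
      "\<And>x l. ?L (x + int_vec l) \<in> unit_cell \<Longrightarrow> l = K x"
    by metis
  define X where "X k = {x. ?L x \<in> unit_cell \<and> x - int_vec k \<in> unit_cell}" for k :: "int ^ 'n"
  define Y where "Y k = {x. x \<in> unit_cell \<and> ?L (x + int_vec k) \<in> unit_cell}" for k :: "int ^ 'n"
  have [measurable]: "X k \<in> sets borel" "Y k \<in> sets borel" for k
    unfolding X_def Y_def by measurable
  have X: "?D = (\<Union>k. X k)"
    using unit_cell_tiles(1) unfolding X_def by blast
  have Y: "(\<Union>k. Y k) = unit_cell"
    using K(1) unfolding Y_def by blast
  have "disjoint_family X"
    unfolding disjoint_family_on_def
  proof (intro ballI impI equals0I)
    fix k l x assume "k \<noteq> l" "x \<in> X k \<inter> X l"
    then show False using unit_cell_tiles(2)[of x k] unit_cell_tiles(2)[of x l] by (simp add: X_def)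
  qed
  then have "emeasure lborel ?D = (\<integral>\<^sup>+k. emeasure lborel (X k) \<partial>count_space UNIV)"
    unfolding X by (intro emeasure_UN_countable) simp_all
  also have "\<dots> = (\<integral>\<^sup>+k. emeasure lborel (Y k) \<partial>count_space UNIV)"
  proof (rule nn_integral_cong)
    fix k :: "int ^ 'n"
    have "emeasure lborel (X k) = (\<integral>\<^sup>+x. indicator (X k) x \<partial>lborel)"
      by simp
    also have "\<dots> = (\<integral>\<^sup>+x. indicator (X k) (x + int_vec k) \<partial>lborel)"
      by (rule nn_integral_lborel_translate[symmetric]) measurable
    also have "\<dots> = (\<integral>\<^sup>+x. indicator (Y k) x \<partial>lborel)"
      by (rule nn_integral_cong) (simp add: X_def Y_def indicator_def conj_commute)
    also have "\<dots> = emeasure lborel (Y k)"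
      by simp
    finally show "emeasure lborel (X k) = emeasure lborel (Y k)" .
  qed
  finally have eq: "emeasure lborel ?D = (\<integral>\<^sup>+k. emeasure lborel (Y k) \<partial>count_space UNIV)" .
  have "disjoint_family Y"
    unfolding disjoint_family_on_def
  proof (intro ballI impI equals0I)
    fix k l x assume "k \<noteq> l" "x \<in> Y k \<inter> Y l"
    then show False using K(2)[of x k] K(2)[of x l] by (simp add: Y_def)
  qed
  then have "(\<integral>\<^sup>+k. emeasure lborel (Y k) \<partial>count_space UNIV) = emeasure lborel (\<Union>k. Y k)"
    by (intro emeasure_UN_countable[symmetric]) simp_all
  with eq show ?thesis by (simp only: Y emeasure_unit_cell)
qed

text \<open>The proportionality constant is found by testing with the indicator of the unit cell.\<close>

lemma nn_integral_unimodular: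
  fixes A :: "int ^ 'n::finite ^ 'n"
  assumes "unimodular A" and [measurable]: "f \<in> borel_measurable borel"
  shows "(\<integral>\<^sup>+x. f (real_matrix A *v x) \<partial>lborel) = (\<integral>\<^sup>+x. f x \<partial>lborel)"
proof -
  let ?L = "\<lambda>x. real_matrix A *v x"
  obtain B where B: "\<And>x. ?L (B *v x) = x" "\<And>x. B *v ?L x = x"
    using unimodular_inverse[OF assms(1)] by blast
  have [measurable]: "?L \<in> borel_measurable borel"
    by (intro borel_measurable_continuous_onI) (simp add: matrix_vector_mult_linear_continuous_on)
  have "(\<integral>\<^sup>+x. indicator unit_cell (?L x) \<partial>lborel) = (\<integral>\<^sup>+x. indicator {x. ?L x \<in> unit_cell} x \<partial>lborel)"
    by (intro nn_integral_cong) (auto split: split_indicator)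
  also have "\<dots> = 1"
    using emeasure_unimodular_unit_cell[OF assms(1)] by simp
  finally have "(\<integral>\<^sup>+x. indicator unit_cell (?L x) \<partial>lborel) = 1" .
  then show ?thesis
    using nn_integral_linear_proportional[of ?L "\<lambda>x. B *v x" f "indicator unit_cell"]
    by (simp add: B emeasure_unit_cell)
qed

lemma continuous_on_matrix_vector_mult [continuous_intros]:
  fixes g :: "'a::topological_space \<Rightarrow> real ^ 'n::finite" and B :: "real ^ 'n ^ 'm::finite"
  assumes "continuous_on S g"
  shows "continuous_on S (\<lambda>x. B *v g x)"
  by (rule bounded_linear.continuous_on[OF matrix_vector_mul_bounded_linear assms])

lemma continuous_on_chart [continuous_intros]:
  assumes "continuous_on S g"
  shows "continuous_on S (\<lambda>x. chart v A (g x))"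
  unfolding chart_def by (intro continuous_intros assms)

lemma borel_measurable_chart [measurable]: "chart v A \<in> borel_measurable borel"
proof (rule borel_measurable_continuous_onI)
  have "continuous_on UNIV (\<lambda>x. chart v A ((\<lambda>x. x) x))"
    by (intro continuous_on_chart continuous_on_id)
  then show "continuous_on UNIV (chart v A)" by simp
qed

lemma distr_chart_lborel:
  fixes A :: "int ^ 'n::finite ^ 'n"
  assumes "unimodular A"
  shows "distr lborel borel (chart v A) = lborel"
proof (rule measure_eqI)
  fix S assume "S \<in> sets (distr lborel borel (chart v A))"
  then have [measurable]: "S \<in> sets borel" by simp
  have "emeasure (distr lborel borel (chart v A)) S = (\<integral>\<^sup>+x. indicator S x \<partial>distr lborel borel (chart v A))"
    by (rule nn_integral_indicator[symmetric]) simp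
  also have "\<dots> = (\<integral>\<^sup>+x. indicator S (chart v A x) \<partial>lborel)"
    by (rule nn_integral_distr) measurable
  also have "\<dots> = (\<integral>\<^sup>+x. indicator S (v + x) \<partial>lborel)"
    unfolding chart_def by (rule nn_integral_unimodular[OF assms, of "\<lambda>x. indicator S (v + x)"]) measurable
  also have "\<dots> = (\<integral>\<^sup>+x. indicator S x \<partial>lborel)"
    using nn_integral_lborel_translate[of "indicator S" v] by (simp add: add.commute)
  also have "\<dots> = emeasure lborel S"
    by (rule nn_integral_indicator) simp
  finally show "emeasure (distr lborel borel (chart v A)) S = emeasure lborel S" .
qed simp

lemma set_integral_chart:
  fixes A :: "int ^ 'n::finite ^ 'n" and f :: "real ^ 'n \<Rightarrow> real"
  assumes A: "unimodular A" and [measurable]: "S \<in> sets borel" "f \<in> borel_measurable borel"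
  shows "(LINT x : chart v A ` S | lborel. f x) = (LINT x : S | lborel. f (chart v A x))"
proof -
  obtain B where B: "\<And>x. real_matrix A *v (B *v x) = x" "\<And>x. B *v (real_matrix A *v x) = x"
    using unimodular_inverse[OF A] by blast
  have [measurable]: "(\<lambda>x. B *v (x - v)) \<in> borel_measurable borel"
  proof (rule borel_measurable_continuous_onI)
    have "continuous_on UNIV (\<lambda>x. x - v)" by (intro continuous_intros)
    then show "continuous_on UNIV (\<lambda>x. B *v (x - v))" by (rule continuous_on_matrix_vector_mult)
  qed
  have retract: "B *v (chart v A x - v) = x" for x
    unfolding chart_def by (simp only: add_diff_cancel_left' B)
  have forth: "chart v A (B *v (x - v)) = x" for x
    unfolding chart_def B by simp
  have im: "chart v A x \<in> chart v A ` S \<longleftrightarrow> x \<in> S" for x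
  proof
    assume "chart v A x \<in> chart v A ` S"
    then obtain y where "y \<in> S" "chart v A x = chart v A y" by (rule imageE)
    then show "x \<in> S" using retract by metis
  qed (rule imageI)
  have eq: "chart v A ` S = {x. B *v (x - v) \<in> S}"
  proof (intro set_eqI iffI CollectI)
    fix x assume "x \<in> chart v A ` S"
    then obtain y where y: "y \<in> S" "x = chart v A y" by (elim imageE)
    show "B *v (x - v) \<in> S" unfolding y(2) retract by (rule y(1))
  next
    fix x assume "x \<in> {x. B *v (x - v) \<in> S}"
    then have "chart v A (B *v (x - v)) \<in> chart v A ` S" by (intro imageI) simp
    then show "x \<in> chart v A ` S" by (simp only: forth)
  qed
  define T where "T = chart v A ` S"
  have [measurable]: "T \<in> sets borel"
    unfolding T_def eq by measurable
  have T: "indicat_real T (chart v A x) = indicat_real S x" for x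
    using im[of x] by (simp add: T_def indicator_def)
  have "(LINT x : T | lborel. f x) = (\<integral>x. indicat_real T x *\<^sub>R f x \<partial>distr lborel borel (chart v A))"
    by (simp only: distr_chart_lborel[OF A] set_lebesgue_integral_def)
  also have "\<dots> = (\<integral>x. indicat_real T (chart v A x) *\<^sub>R f (chart v A x) \<partial>lborel)"
    by (rule integral_distr) measurable
  also have "\<dots> = (LINT x : S | lborel. f (chart v A x))"
    by (simp only: T set_lebesgue_integral_def)
  finally show ?thesis by (simp only: T_def)
qed

section \<open>Mixed partial derivatives and Taylor's formula\<close>

text \<open>\<open>partial\<close> is defined through \<open>deriv\<close> and is informative only where a derivative exists; differentiability
makes it the matrix of the total derivative.\<close>

lemma has_derivative_partials:
  fixes h :: "real ^ 'n::finite \<Rightarrow> real"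
  assumes "h differentiable (at x)"
  shows "(h has_derivative (\<lambda>v. \<Sum>r\<in>UNIV. v $ r * partial r h x)) (at x)"
proof -
  obtain D where D: "(h has_derivative D) (at x)"
    using assms by (auto simp: differentiable_def)
  then have lin: "linear D" by (rule has_derivative_linear)
  have p: "partial r h x = D (axis r 1)" for r
  proof -
    have "((\<lambda>t. x + t *\<^sub>R axis r 1) has_derivative (\<lambda>t. t *\<^sub>R axis r 1)) (at 0)"
      by (auto intro!: derivative_eq_intros)
    then have "((\<lambda>t. h (x + t *\<^sub>R axis r 1)) has_derivative (\<lambda>t. D (t *\<^sub>R axis r 1))) (at 0)"
      by (rule has_derivative_compose) (simp add: D)
    then have "((\<lambda>t. h (x + t *\<^sub>R axis r 1)) has_field_derivative D (axis r 1)) (at 0)"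
      by (simp add: has_field_derivative_def linear_scale[OF lin] mult_commute_abs)
    then show ?thesis
      unfolding partial_def by (rule DERIV_imp_deriv)
  qed
  have "D v = (\<Sum>r\<in>UNIV. v $ r * partial r h x)" for v
  proof -
    have "D v = D (\<Sum>r\<in>UNIV. v $ r *\<^sub>R axis r 1)"
      using basis_expansion[of v] by (simp only: scalar_mult_eq_scaleR)
    also have "\<dots> = (\<Sum>r\<in>UNIV. v $ r * partial r h x)"
      by (simp add: linear_sum[OF lin] linear_scale[OF lin] p)
    finally show ?thesis .
  qed
  then have "D = (\<lambda>v. \<Sum>r\<in>UNIV. v $ r * partial r h x)" by (rule ext)
  with D show ?thesis by (simp only:)
qed

lemma has_real_derivative_along_line:
  fixes h :: "real ^ 'n::finite \<Rightarrow> real"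
  assumes "h differentiable (at (x + s *\<^sub>R w))"
  shows "((\<lambda>s. h (x + s *\<^sub>R w)) has_real_derivative (\<Sum>r\<in>UNIV. w $ r * partial r h (x + s *\<^sub>R w))) (at s within S)"
proof -
  have "((\<lambda>s. x + s *\<^sub>R w) has_derivative (\<lambda>t. t *\<^sub>R w)) (at s within S)"
    by (auto intro!: derivative_eq_intros)
  from has_derivative_compose[OF this has_derivative_partials[OF assms]]
  have "((\<lambda>s. h (x + s *\<^sub>R w)) has_derivative (\<lambda>t. \<Sum>r\<in>UNIV. (t *\<^sub>R w) $ r * partial r h (x + s *\<^sub>R w))) (at s within S)" .
  moreover have "(\<lambda>t. \<Sum>r\<in>UNIV. (t *\<^sub>R w) $ r * partial r h (x + s *\<^sub>R w))
      = (*) (\<Sum>r\<in>UNIV. w $ r * partial r h (x + s *\<^sub>R w))"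
    by (simp add: fun_eq_iff sum_distrib_left mult_ac)
  ultimately show ?thesis
    by (simp add: has_field_derivative_def)
qed

lemma partial_eqI:
  fixes h :: "real ^ 'n::finite \<Rightarrow> real"
  assumes "((\<lambda>t. h (x + t *\<^sub>R axis r 1)) has_real_derivative d) (at 0)"
  shows "partial r h x = d"
  unfolding partial_def using assms by (rule DERIV_imp_deriv)

lemma has_real_derivative_partial:
  fixes h :: "real ^ 'n::finite \<Rightarrow> real"
  assumes "h differentiable (at (x + s *\<^sub>R axis r 1))"
  shows "((\<lambda>s. h (x + s *\<^sub>R axis r 1)) has_real_derivative partial r h (x + s *\<^sub>R axis r 1)) (at s within S)"
proof -
  have "(\<Sum>q\<in>UNIV. axis r 1 $ q * partial q h y) = partial r h y" for y
    by (simp add: axis_def if_distrib[of "\<lambda>c. c * _"] cong: if_cong)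
  then show ?thesis
    using has_real_derivative_along_line[OF assms] by simp
qed

lemma cont_diff_Suc_D: "cont_diff (Suc k) h \<Longrightarrow> cont_diff k h"
proof (induction k arbitrary: h)
  case 0
  then show ?case
    by (auto intro!: differentiable_imp_continuous_on differentiable_at_imp_differentiable_on)
qed auto

lemma cont_diff_mono: "j \<le> k \<Longrightarrow> cont_diff k h \<Longrightarrow> cont_diff j h"
  by (induction k rule: dec_induct) (auto dest: cont_diff_Suc_D simp del: cont_diff.simps)

lemma cont_diff_imp_continuous: "cont_diff k h \<Longrightarrow> continuous_on UNIV h"
  using cont_diff_mono[of 0 k] by simp

lemma partial_sum:
  fixes h :: "'a \<Rightarrow> real ^ 'n::finite \<Rightarrow> real"
  assumes "\<And>i. i \<in> S \<Longrightarrow> h i differentiable (at x)"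
  shows "partial r (\<lambda>x. \<Sum>i\<in>S. c i * h i x) x = (\<Sum>i\<in>S. c i * partial r (h i) x)"
proof (rule partial_eqI)
  have "((\<lambda>t. h i (x + t *\<^sub>R axis r 1)) has_real_derivative partial r (h i) x) (at 0)" if "i \<in> S" for i
    using has_real_derivative_partial[of "h i" x 0 r UNIV] assms[OF that] by simp
  then show "((\<lambda>t. \<Sum>i\<in>S. c i * h i (x + t *\<^sub>R axis r 1)) has_real_derivative (\<Sum>i\<in>S. c i * partial r (h i) x)) (at 0)"
    by (intro DERIV_sum DERIV_cmult)
qed

lemma cont_diff_sum:
  fixes h :: "'a \<Rightarrow> real ^ 'n::finite \<Rightarrow> real"
  assumes "finite S" "\<And>i. i \<in> S \<Longrightarrow> cont_diff k (h i)"
  shows "cont_diff k (\<lambda>x. \<Sum>i\<in>S. c i * h i x)"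
  using assms(2)
proof (induction k arbitrary: h)
  case 0
  then show ?case by (auto intro!: continuous_intros)
next
  case (Suc k)
  have "partial r (\<lambda>x. \<Sum>i\<in>S. c i * h i x) = (\<lambda>x. \<Sum>i\<in>S. c i * partial r (h i) x)" for r
    using Suc.prems by (intro ext partial_sum) auto
  then show ?case
    using Suc assms(1) by (auto intro!: differentiable_sum differentiable_mult)
qed

lemma partial_chart:
  fixes A :: "int ^ 'n::finite ^ 'n"
  assumes "h differentiable (at (chart v A y))"
  shows "partial r (\<lambda>y. h (chart v A y)) y = (\<Sum>q\<in>UNIV. real_of_int (A $ q $ r) * partial q h (chart v A y))"
proof (rule partial_eqI)
  let ?w = "map_matrix real_of_int A *v axis r 1"
  have "chart v A (y + t *\<^sub>R axis r 1) = chart v A y + t *\<^sub>R ?w" for t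
    by (simp add: chart_def matrix_vector_right_distrib matrix_vector_mult_scaleR)
  moreover have "?w $ q = real_of_int (A $ q $ r)" for q
    by (simp add: matrix_vector_mult_basis column_def)
  ultimately show "((\<lambda>t. h (chart v A (y + t *\<^sub>R axis r 1))) has_real_derivative
      (\<Sum>q\<in>UNIV. real_of_int (A $ q $ r) * partial q h (chart v A y))) (at 0)"
    using has_real_derivative_along_line[of h "chart v A y" 0 ?w UNIV] assms by simp
qed

lemma differentiable_chart: "chart v A differentiable (at y)"
proof -
  have "(chart v A has_derivative (\<lambda>x. map_matrix real_of_int A *v x)) (at y)"
    unfolding chart_def[abs_def]
    by (auto intro!: derivative_eq_intros bounded_linear_imp_has_derivative)
  then show ?thesis by (rule differentiableI)
qed

lemma cont_diff_chart:
  fixes A :: "int ^ 'n::finite ^ 'n"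
  assumes "cont_diff k h"
  shows "cont_diff k (\<lambda>y. h (chart v A y))"
  using assms
proof (induction k arbitrary: h)
  case 0
  have "continuous_on UNIV (chart v A)"
    using differentiable_chart by (intro differentiable_imp_continuous_on differentiable_at_imp_differentiable_on) auto
  then show ?case using 0 by (auto intro: continuous_on_compose2)
next
  case (Suc k)
  have "partial r (\<lambda>y. h (chart v A y)) = (\<lambda>y. \<Sum>q\<in>UNIV. real_of_int (A $ q $ r) * partial q h (chart v A y))" for r
    using Suc.prems by (intro ext partial_chart) auto
  moreover have "(\<lambda>y. h (chart v A y)) differentiable (at y)" for y
    using differentiable_chain_at[OF differentiable_chart, of h v A y] Suc.prems by (simp add: o_def)
  ultimately show ?case
    using Suc by (auto intro!: cont_diff_sum)
qed

text \<open>Two applications of the mean value theorem, first in direction \<open>r\<close> to the difference in direction \<open>q\<close>, then in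
direction \<open>q\<close>.\<close>

lemma second_difference_mean_value:
  fixes h :: "real ^ 'n::finite \<Rightarrow> real"
  assumes "cont_diff 2 h" "0 < t"
  shows "\<exists>\<xi> \<eta>. 0 < \<xi> \<and> \<xi> < t \<and> 0 < \<eta> \<and> \<eta> < t \<and>
    h (x + t *\<^sub>R axis r 1 + t *\<^sub>R axis q 1) - h (x + t *\<^sub>R axis r 1) - h (x + t *\<^sub>R axis q 1) + h x
      = t\<^sup>2 * partial q (partial r h) (x + \<xi> *\<^sub>R axis r 1 + \<eta> *\<^sub>R axis q 1)"
proof -
  let ?a = "axis r 1 :: real ^ 'n" and ?b = "axis q 1 :: real ^ 'n"
  have d: "h differentiable (at y)" "partial r h differentiable (at y)" for y
    using assms(1) by (auto simp: numeral_2_eq_2)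
  define \<phi> where "\<phi> s = h (x + t *\<^sub>R ?b + s *\<^sub>R ?a) - h (x + s *\<^sub>R ?a)" for s
  have "(\<phi> has_real_derivative partial r h (x + t *\<^sub>R ?b + s *\<^sub>R ?a) - partial r h (x + s *\<^sub>R ?a)) (at s)" for s
    unfolding \<phi>_def by (intro DERIV_diff has_real_derivative_partial d)
  then obtain \<xi> where \<xi>: "0 < \<xi>" "\<xi> < t"
    "\<phi> t - \<phi> 0 = (t - 0) * (partial r h (x + t *\<^sub>R ?b + \<xi> *\<^sub>R ?a) - partial r h (x + \<xi> *\<^sub>R ?a))"
    using MVT2[OF \<open>0 < t\<close>, of \<phi> "\<lambda>s. partial r h (x + t *\<^sub>R ?b + s *\<^sub>R ?a) - partial r h (x + s *\<^sub>R ?a)"]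
    by blast
  define y where "y = x + \<xi> *\<^sub>R ?a"
  have "((\<lambda>s. partial r h (y + s *\<^sub>R ?b)) has_real_derivative partial q (partial r h) (y + s *\<^sub>R ?b)) (at s)" for s
    by (intro has_real_derivative_partial d)
  then obtain \<eta> where \<eta>: "0 < \<eta>" "\<eta> < t"
    "partial r h (y + t *\<^sub>R ?b) - partial r h (y + 0 *\<^sub>R ?b) = (t - 0) * partial q (partial r h) (y + \<eta> *\<^sub>R ?b)"
    using MVT2[OF \<open>0 < t\<close>, of "\<lambda>s. partial r h (y + s *\<^sub>R ?b)"
        "\<lambda>s. partial q (partial r h) (y + s *\<^sub>R ?b)"] by blast
  have "h (x + t *\<^sub>R ?a + t *\<^sub>R ?b) - h (x + t *\<^sub>R ?a) - h (x + t *\<^sub>R ?b) + h x = \<phi> t - \<phi> 0"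
    by (simp add: \<phi>_def add_ac)
  also have "\<dots> = t * (partial r h (y + t *\<^sub>R ?b) - partial r h (y + 0 *\<^sub>R ?b))"
    unfolding \<xi>(3) by (simp add: y_def add_ac)
  also have "\<dots> = t\<^sup>2 * partial q (partial r h) (x + \<xi> *\<^sub>R ?a + \<eta> *\<^sub>R ?b)"
    unfolding \<eta>(3) by (simp add: y_def power2_eq_square)
  finally show ?thesis using \<xi> \<eta> by blast
qed

text \<open>Schwarz's theorem. The second difference is symmetric in the two directions, so the two mixed derivatives agree at
points arbitrarily close to \<open>x\<close>; continuity makes them agree at \<open>x\<close>.\<close>

lemma partial_commute:
  fixes h :: "real ^ 'n::finite \<Rightarrow> real"
  assumes "cont_diff 2 h"
  shows "partial r (partial q h) = partial q (partial r h)"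
proof
  let ?a = "axis r 1 :: real ^ 'n" and ?b = "axis q 1 :: real ^ 'n"
  fix x :: "real ^ 'n"
  let ?F = "partial q (partial r h)" and ?G = "partial r (partial q h)"
  have "\<exists>\<xi> \<eta> \<xi>' \<eta>'. (\<xi> \<in> {0<..<inverse (real (Suc n))} \<and> \<eta> \<in> {0<..<inverse (real (Suc n))} \<and>
      \<xi>' \<in> {0<..<inverse (real (Suc n))} \<and> \<eta>' \<in> {0<..<inverse (real (Suc n))}) \<and>
      ?F (x + \<xi> *\<^sub>R ?a + \<eta> *\<^sub>R ?b) = ?G (x + \<xi>' *\<^sub>R ?b + \<eta>' *\<^sub>R ?a)" for n
  proof -
    define t where "t = inverse (real (Suc n))"
    have t: "0 < t" by (simp add: t_def)
    obtain \<xi> \<eta> where 1: "0 < \<xi>" "\<xi> < t" "0 < \<eta>" "\<eta> < t"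
      "h (x + t *\<^sub>R ?a + t *\<^sub>R ?b) - h (x + t *\<^sub>R ?a) - h (x + t *\<^sub>R ?b) + h x
      = t\<^sup>2 * ?F (x + \<xi> *\<^sub>R ?a + \<eta> *\<^sub>R ?b)"
      using second_difference_mean_value[OF assms t] by blast
    obtain \<xi>' \<eta>' where 2: "0 < \<xi>'" "\<xi>' < t" "0 < \<eta>'" "\<eta>' < t"
      "h (x + t *\<^sub>R ?b + t *\<^sub>R ?a) - h (x + t *\<^sub>R ?b) - h (x + t *\<^sub>R ?a) + h x
      = t\<^sup>2 * ?G (x + \<xi>' *\<^sub>R ?b + \<eta>' *\<^sub>R ?a)"
      using second_difference_mean_value[OF assms t] by blast
    have "t\<^sup>2 * ?F (x + \<xi> *\<^sub>R ?a + \<eta> *\<^sub>R ?b) = t\<^sup>2 * ?G (x + \<xi>' *\<^sub>R ?b + \<eta>' *\<^sub>R ?a)"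
    proof -
      have e: "x + t *\<^sub>R ?b + t *\<^sub>R ?a = x + t *\<^sub>R ?a + t *\<^sub>R ?b"
        by (simp only: add_ac)
      show ?thesis using 1(5) 2(5) unfolding e by linarith
    qed
    then show ?thesis
      using 1 2 t unfolding t_def[symmetric] by (intro exI[of _ \<xi>] exI[of _ \<eta>] exI[of _ \<xi>'] exI[of _ \<eta>']) simp
  qed
  then obtain \<xi> \<eta> \<xi>' \<eta>' where s: "\<And>n. \<xi> n \<in> {0<..<inverse (real (Suc n))} \<and> \<eta> n \<in> {0<..<inverse (real (Suc n))} \<and>
      \<xi>' n \<in> {0<..<inverse (real (Suc n))} \<and> \<eta>' n \<in> {0<..<inverse (real (Suc n))}"
    and eq: "\<And>n. ?F (x + \<xi> n *\<^sub>R ?a + \<eta> n *\<^sub>R ?b) = ?G (x + \<xi>' n *\<^sub>R ?b + \<eta>' n *\<^sub>R ?a)"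
    by metis
  have lim0: "\<zeta> \<longlonglongrightarrow> 0" if "\<And>n. \<zeta> n \<in> {0<..<inverse (real (Suc n))}" for \<zeta>
    using that by (intro tendsto_sandwich[OF _ _ tendsto_const LIMSEQ_inverse_real_of_nat]) (auto intro!: always_eventually less_imp_le)
  have l: "\<xi> \<longlonglongrightarrow> 0" "\<eta> \<longlonglongrightarrow> 0" "\<xi>' \<longlonglongrightarrow> 0" "\<eta>' \<longlonglongrightarrow> 0"
    using s by (auto intro!: lim0)
  have c: "isCont ?F y" "isCont ?G y" for y
    using assms by (auto simp: numeral_2_eq_2 continuous_on_eq_continuous_at)
  have "(\<lambda>n. ?F (x + \<xi> n *\<^sub>R ?a + \<eta> n *\<^sub>R ?b)) \<longlonglongrightarrow> ?F (x + 0 *\<^sub>R ?a + 0 *\<^sub>R ?b)"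
    by (intro isCont_tendsto_compose[OF c(1)] tendsto_intros l)
  moreover have "(\<lambda>n. ?G (x + \<xi>' n *\<^sub>R ?b + \<eta>' n *\<^sub>R ?a)) \<longlonglongrightarrow> ?G (x + 0 *\<^sub>R ?b + 0 *\<^sub>R ?a)"
    by (intro isCont_tendsto_compose[OF c(2)] tendsto_intros l)
  ultimately show "?G x = ?F x"
    unfolding eq by (auto dest: LIMSEQ_unique)
qed

lemma cont_diff_iter_partial: "cont_diff (k + length rs) h \<Longrightarrow> cont_diff k (iter_partial rs h)"
proof (induction rs arbitrary: k)
  case (Cons r rs)
  then have "cont_diff (Suc k + length rs) h" by (simp del: cont_diff.simps)
  then have "cont_diff (Suc k) (iter_partial rs h)" by (rule Cons.IH)
  then show ?case by simp
qed simp

lemma iter_partial_move_front: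
  "cont_diff (length rs + length qs + 1) h \<Longrightarrow> iter_partial (rs @ r # qs) h = iter_partial (r # rs @ qs) h"
proof (induction rs)
  case (Cons q rs)
  have "cont_diff 2 (iter_partial (rs @ qs) h)"
    using Cons.prems by (intro cont_diff_iter_partial) (simp add: add_ac del: cont_diff.simps)
  moreover have "iter_partial (rs @ r # qs) h = partial r (iter_partial (rs @ qs) h)"
    using Cons.IH Cons.prems cont_diff_mono by (simp del: cont_diff.simps add: cont_diff_Suc_D)
  ultimately show ?case by (simp add: partial_commute[of _ q r])
qed simp

lemma iter_partial_mset_cong:
  "mset rs = mset qs \<Longrightarrow> cont_diff (length rs) h \<Longrightarrow> iter_partial rs h = iter_partial qs h"
proof (induction rs arbitrary: qs)
  case (Cons r rs)
  then have "r \<in> set qs" by (metis list.set_intros(1) set_mset_mset)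
  then obtain xs ys where qs: "qs = xs @ r # ys" by (meson split_list)
  with Cons.prems have m: "mset rs = mset (xs @ ys)" by simp
  then have len: "length rs = length (xs @ ys)" by (metis size_mset)
  have "iter_partial qs h = partial r (iter_partial (xs @ ys) h)"
    unfolding qs using Cons.prems len by (subst iter_partial_move_front) (simp_all del: cont_diff.simps)
  then show ?case
    using Cons.IH[OF m] Cons.prems by (simp add: cont_diff_Suc_D del: cont_diff.simps)
qed simp

lemma mset_eq_iff_count_list: "mset rs = mset qs \<longleftrightarrow> (\<forall>r. count_list rs r = count_list qs r)"
  by (simp add: multiset_eq_iff count_mset count_list_eq_length_filter)

lemma ex_list_count: "\<exists>rs. \<forall>r. count_list rs r = (\<alpha> :: nat ^ 'n::finite) $ r"
proof -
  obtain rs where "mset rs = (\<Sum>r\<in>UNIV. replicate_mset (\<alpha> $ r) r)"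
    using ex_mset by blast
  then have "count (mset rs) r = \<alpha> $ r" for r
    by (simp add: count_sum)
  then show ?thesis by (auto simp: count_mset count_list_eq_length_filter)
qed

lemma length_eq_mi_norm:
  fixes \<alpha> :: "nat ^ 'n::finite"
  assumes "\<forall>r. count_list rs r = \<alpha> $ r"
  shows "length rs = mi_norm \<alpha>"
proof -
  have "length rs = (\<Sum>r\<in>set rs. count_list rs r)"
    by (simp add: sum_count_set)
  also have "\<dots> = (\<Sum>r\<in>UNIV. count_list rs r)"
    by (rule sum.mono_neutral_left) (auto simp: count_list_0_iff)
  finally show ?thesis using assms by (simp add: mi_norm_def)
qed

text \<open>Frees \<open>mixed_partial\<close> from the choice operator: any order of differentiation may be used.\<close>

lemma mixed_partial_eq_iter_partial:
  assumes "\<forall>r. count_list rs r = \<alpha> $ r" "cont_diff (mi_norm \<alpha>) h"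
  shows "mixed_partial \<alpha> h = iter_partial rs h"
proof -
  let ?qs = "SOME rs. \<forall>r. count_list rs r = \<alpha> $ r"
  have q: "\<forall>r. count_list ?qs r = \<alpha> $ r"
    using ex_list_count by (rule someI_ex)
  then show ?thesis
    unfolding mixed_partial_def
    using assms length_eq_mi_norm[OF q] by (intro iter_partial_mset_cong) (auto simp: mset_eq_iff_count_list)
qed

lemma mixed_partial_zero [simp]: "cont_diff 0 h \<Longrightarrow> mixed_partial 0 h = h"
  using mixed_partial_eq_iter_partial[of "[]" 0 h] by (simp add: mi_norm_def)

lemma mi_norm_add_axis: "mi_norm (\<alpha> + axis r 1) = mi_norm \<alpha> + 1"
  by (simp add: mi_norm_def sum.distrib axis_def)

lemma mixed_partial_add_axis:
  assumes "cont_diff (mi_norm \<alpha> + 1) h"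
  shows "mixed_partial (\<alpha> + axis r 1) h = partial r (mixed_partial \<alpha> h)"
proof -
  obtain rs where rs: "\<forall>r. count_list rs r = \<alpha> $ r"
    using ex_list_count by blast
  then have "mixed_partial \<alpha> h = iter_partial rs h"
    using assms by (intro mixed_partial_eq_iter_partial) (auto dest: cont_diff_Suc_D simp del: cont_diff.simps)
  moreover have "cont_diff (mi_norm (\<alpha> + axis r 1)) h"
    using assms by (simp only: mi_norm_add_axis)
  then have "mixed_partial (\<alpha> + axis r 1) h = iter_partial (r # rs) h"
    using rs by (intro mixed_partial_eq_iter_partial) (auto simp: axis_def)
  ultimately show ?thesis by simp
qed

lemma cont_diff_mixed_partial:
  assumes "cont_diff (k + mi_norm \<alpha>) h"
  shows "cont_diff k (mixed_partial \<alpha> h)"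
proof -
  obtain rs where rs: "\<forall>r. count_list rs r = \<alpha> $ r"
    using ex_list_count by blast
  then have "mixed_partial \<alpha> h = iter_partial rs h"
    using assms cont_diff_mono[of "mi_norm \<alpha>" "k + mi_norm \<alpha>" h] by (intro mixed_partial_eq_iter_partial) auto
  then show ?thesis
    using assms length_eq_mi_norm[OF rs] by (simp add: cont_diff_iter_partial)
qed

lemma mi_power_add_axis: "mi_power w (\<alpha> + axis r 1) = mi_power w \<alpha> * w $ r"
proof -
  have "(\<Prod>q\<in>UNIV. w $ q ^ axis r 1 $ q) = w $ r"
    by (subst prod.remove[of _ r]) (auto simp: axis_def intro!: prod.neutral)
  then show ?thesis by (simp add: mi_power_def power_add prod.distrib)
qed

lemma mi_fact_add_axis: "mi_fact (\<alpha> + axis r 1) = mi_fact \<alpha> * (real (\<alpha> $ r) + 1)"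
proof -
  have "(\<Prod>q\<in>UNIV - {r}. fact ((\<alpha> + axis r 1) $ q)) = (\<Prod>q\<in>UNIV - {r}. fact (\<alpha> $ q) :: real)"
    by (intro prod.cong) (auto simp: axis_def)
  then show ?thesis
    unfolding mi_fact_def by (subst (1 2) prod.remove[of _ r]) (auto simp: axis_def algebra_simps)
qed

lemma mi_fact_pos: "0 < mi_fact \<alpha>"
  by (simp add: mi_fact_def prod_pos)

lemma mi_fact_nonzero [simp]: "mi_fact \<alpha> \<noteq> 0"
  using mi_fact_pos[of \<alpha>] by simp

lemma finite_vec_box: "finite {a..b :: 'a::{order} ^ 'n::finite}" if "\<And>r. finite {a $ r..b $ r}"
proof -
  have "{a..b} \<subseteq> vec_lambda ` (\<Pi>\<^sub>E r\<in>UNIV. {a $ r..b $ r})"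
  proof
    fix x assume "x \<in> {a..b}"
    then have "vec_nth x \<in> (\<Pi>\<^sub>E r\<in>UNIV. {a $ r..b $ r})" by (auto simp: less_eq_vec_def)
    then have "vec_lambda (vec_nth x) \<in> vec_lambda ` (\<Pi>\<^sub>E r\<in>UNIV. {a $ r..b $ r})" by (rule imageI)
    then show "x \<in> vec_lambda ` (\<Pi>\<^sub>E r\<in>UNIV. {a $ r..b $ r})" by (simp add: vec_nth_inverse)
  qed
  moreover have "finite (vec_lambda ` (\<Pi>\<^sub>E r\<in>UNIV. {a $ r..b $ r}))"
    using that by (intro finite_imageI finite_PiE) auto
  ultimately show ?thesis by (rule finite_subset)
qed

lemma finite_mi_norm: "finite {\<alpha> :: nat ^ 'n::finite. mi_norm \<alpha> = n}"
proof -
  have "{\<alpha> :: nat ^ 'n. mi_norm \<alpha> = n} \<subseteq> {0..vec n}"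
    by (auto simp: less_eq_vec_def mi_norm_def intro!: member_le_sum)
  then show ?thesis by (rule finite_subset) (intro finite_vec_box, simp)
qed

text \<open>Both sides run over the pairs of a multi-index \<open>\<alpha>\<close> of norm \<open>Suc n\<close> and a direction \<open>r\<close> with \<open>\<alpha>\<^sub>r > 0\<close>; on the
right-hand side, the factor \<open>Suc n\<close> of \<open>fact (Suc n)\<close> is written as the sum of the entries \<open>\<alpha>\<^sub>r\<close>. This is the inductive
step of both the multinomial theorem and the formula for the derivatives of \<open>h\<close> along a line.\<close>

lemma sum_multi_index_step:
  fixes G :: "nat ^ 'n::finite \<Rightarrow> real"
  shows "(\<Sum>\<alpha> | mi_norm \<alpha> = n. fact n / mi_fact \<alpha> * mi_power w \<alpha> * (\<Sum>r\<in>UNIV. w $ r * G (\<alpha> + axis r 1)))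
    = (\<Sum>\<alpha> | mi_norm \<alpha> = Suc n. fact (Suc n) / mi_fact \<alpha> * mi_power w \<alpha> * G \<alpha>)"
proof -
  let ?s = "\<lambda>r \<alpha>. fact n * real (\<alpha> $ r) / mi_fact \<alpha> * mi_power w \<alpha> * G \<alpha>"
  let ?t = "\<lambda>r \<alpha>. fact n / mi_fact \<alpha> * mi_power w \<alpha> * (w $ r * G (\<alpha> + axis r 1))"
  have "(\<Sum>\<alpha> | mi_norm \<alpha> = Suc n. fact (Suc n) / mi_fact \<alpha> * mi_power w \<alpha> * G \<alpha>)
      = (\<Sum>\<alpha> | mi_norm \<alpha> = Suc n. \<Sum>r\<in>UNIV. ?s r \<alpha>)"
  proof (intro sum.cong refl)
    fix \<alpha> :: "nat ^ 'n" assume "\<alpha> \<in> {\<alpha>. mi_norm \<alpha> = Suc n}"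
    then have "real (Suc n) = (\<Sum>r\<in>UNIV. real (\<alpha> $ r))" by (simp add: mi_norm_def flip: of_nat_sum)
    then have "fact (Suc n) = fact n * (\<Sum>r\<in>UNIV. real (\<alpha> $ r))" by (simp only: fact_Suc of_nat_mult mult.commute)
    then show "fact (Suc n) / mi_fact \<alpha> * mi_power w \<alpha> * G \<alpha> = (\<Sum>r\<in>UNIV. ?s r \<alpha>)"
      by (simp add: sum_distrib_left sum_distrib_right sum_divide_distrib)
  qed
  also have "\<dots> = (\<Sum>r\<in>UNIV. \<Sum>\<alpha> | mi_norm \<alpha> = Suc n. ?s r \<alpha>)"
    by (rule sum.swap)
  also have "\<dots> = (\<Sum>r\<in>UNIV. \<Sum>\<alpha> | mi_norm \<alpha> = n. ?t r \<alpha>)"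
  proof (rule sum.cong[OF refl])
    fix r :: 'n
    have "(\<Sum>\<alpha> | mi_norm \<alpha> = Suc n. ?s r \<alpha>)
        = (\<Sum>\<alpha> | mi_norm \<alpha> = Suc n \<and> 0 < \<alpha> $ r. ?s r \<alpha>)"
      using finite_mi_norm by (intro sum.mono_neutral_right) auto
    also have "\<dots> = (\<Sum>\<alpha> | mi_norm \<alpha> = n. ?t r \<alpha>)"
    proof (rule sum.reindex_bij_witness[of _ "\<lambda>\<alpha>. \<alpha> + axis r 1" "\<lambda>\<alpha>. \<alpha> - axis r 1"])
      fix \<alpha> :: "nat ^ 'n" assume \<alpha>: "\<alpha> \<in> {\<alpha>. mi_norm \<alpha> = Suc n \<and> 0 < \<alpha> $ r}"
      then show eq: "\<alpha> - axis r 1 + axis r 1 = \<alpha>" by (auto simp: vec_eq_iff axis_def)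
      then show "\<alpha> - axis r 1 \<in> {\<alpha>. mi_norm \<alpha> = n}"
        using mi_norm_add_axis[of "\<alpha> - axis r 1" r] \<alpha> by simp
      have "mi_fact \<alpha> = mi_fact (\<alpha> - axis r 1) * real (\<alpha> $ r)"
        using mi_fact_add_axis[of "\<alpha> - axis r 1" r] \<alpha> unfolding eq by (simp add: of_nat_diff)
      moreover have "mi_power w \<alpha> = mi_power w (\<alpha> - axis r 1) * w $ r"
        using mi_power_add_axis[of w "\<alpha> - axis r 1" r] unfolding eq .
      ultimately show "fact n / mi_fact (\<alpha> - axis r 1) * mi_power w (\<alpha> - axis r 1) * (w $ r * G (\<alpha> - axis r 1 + axis r 1))
          = ?s r \<alpha>"
        unfolding eq using \<alpha> mi_fact_pos[of "\<alpha> - axis r 1"] by simp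
    next
      fix \<alpha> :: "nat ^ 'n" assume "\<alpha> \<in> {\<alpha>. mi_norm \<alpha> = n}"
      then show "\<alpha> + axis r 1 \<in> {\<alpha>. mi_norm \<alpha> = Suc n \<and> 0 < \<alpha> $ r}"
        using mi_norm_add_axis[of \<alpha> r] by (simp add: axis_def)
    qed simp
    finally show "(\<Sum>\<alpha> | mi_norm \<alpha> = Suc n. ?s r \<alpha>)
        = (\<Sum>\<alpha> | mi_norm \<alpha> = n. ?t r \<alpha>)" .
  qed
  also have "\<dots> = (\<Sum>\<alpha> | mi_norm \<alpha> = n. fact n / mi_fact \<alpha> * mi_power w \<alpha> * (\<Sum>r\<in>UNIV. w $ r * G (\<alpha> + axis r 1)))"
    by (subst sum.swap) (simp add: sum_distrib_left)
  finally show ?thesis ..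
qed

lemma mi_norm_eq_0: "{\<alpha> :: nat ^ 'n::finite. mi_norm \<alpha> = 0} = {0}"
  by (auto simp: mi_norm_def vec_eq_iff)

lemma multinomial_sum:
  fixes w :: "real ^ 'n::finite"
  shows "(\<Sum>\<alpha> | mi_norm \<alpha> = n. fact n / mi_fact \<alpha> * mi_power w \<alpha>) = (\<Sum>r\<in>UNIV. w $ r) ^ n"
proof (induction n)
  case 0
  show ?case by (simp add: mi_norm_eq_0 mi_fact_def mi_power_def)
next
  case (Suc n)
  show ?case
    using sum_multi_index_step[of n w "\<lambda>_. 1"]
    unfolding mult_1_right sum_distrib_right[symmetric] Suc by (simp only: power_Suc mult.commute)
qed

text \<open>Apply the one-dimensional formula to \<open>s \<mapsto> h (x + s w)\<close>, whose \<open>k\<close>-th derivative is the sum \<open>D k\<close> over multi-indices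
of norm \<open>k\<close>.\<close>

lemma taylor_integral_remainder:
  fixes h :: "real ^ 'n::finite \<Rightarrow> real"
  assumes "cont_diff n h" "0 < n"
  shows "h (x + w) = (\<Sum>k<n. \<Sum>\<alpha> | mi_norm \<alpha> = k. mi_power w \<alpha> * mixed_partial \<alpha> h x / mi_fact \<alpha>)
    + real n * integral {0..1} (\<lambda>s. (1 - s) ^ (n - 1) *
        (\<Sum>\<alpha> | mi_norm \<alpha> = n. mi_power w \<alpha> * mixed_partial \<alpha> h (x + s *\<^sub>R w) / mi_fact \<alpha>))"
proof -
  define D where "D k s = (\<Sum>\<alpha> | mi_norm \<alpha> = k. fact k / mi_fact \<alpha> * mi_power w \<alpha> * mixed_partial \<alpha> h (x + s *\<^sub>R w))" for k s
  have D0: "D 0 = (\<lambda>s. h (x + s *\<^sub>R w))"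
    using cont_diff_mono[OF _ assms(1), of 0] by (intro ext) (simp add: D_def mi_norm_eq_0 mi_fact_def mi_power_def)
  have "(D k has_vector_derivative D (Suc k) s) (at s within {0..1})" if k: "k < n" for k s
  proof -
    have c: "cont_diff (1 + mi_norm \<alpha>) h" if "mi_norm \<alpha> = k" for \<alpha> :: "nat ^ 'n"
      using that k by (intro cont_diff_mono[OF _ assms(1)]) simp
    then have d: "mixed_partial \<alpha> h differentiable (at y)" if "mi_norm \<alpha> = k" for \<alpha> :: "nat ^ 'n" and y
      using cont_diff_mixed_partial[OF c[OF that]] that by simp
    have p: "partial r (mixed_partial \<alpha> h) = mixed_partial (\<alpha> + axis r 1) h" if "mi_norm \<alpha> = k" for \<alpha> :: "nat ^ 'n" and r
      using mixed_partial_add_axis[of \<alpha> h r] c[OF that] by (simp add: add.commute del: cont_diff.simps)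
    have "(D k has_real_derivative (\<Sum>\<alpha> | mi_norm \<alpha> = k. fact k / mi_fact \<alpha> * mi_power w \<alpha> *
        (\<Sum>r\<in>UNIV. w $ r * partial r (mixed_partial \<alpha> h) (x + s *\<^sub>R w)))) (at s within {0..1})"
      unfolding D_def by (intro DERIV_sum DERIV_cmult has_real_derivative_along_line d) simp
    also have "(\<Sum>\<alpha> | mi_norm \<alpha> = k. fact k / mi_fact \<alpha> * mi_power w \<alpha> *
        (\<Sum>r\<in>UNIV. w $ r * partial r (mixed_partial \<alpha> h) (x + s *\<^sub>R w)))
      = (\<Sum>\<alpha> | mi_norm \<alpha> = k. fact k / mi_fact \<alpha> * mi_power w \<alpha> *
        (\<Sum>r\<in>UNIV. w $ r * mixed_partial (\<alpha> + axis r 1) h (x + s *\<^sub>R w)))"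
      by (intro sum.cong refl) (simp add: p)
    also have "\<dots> = D (Suc k) s"
      unfolding D_def by (rule sum_multi_index_step)
    finally show ?thesis by (simp add: has_real_derivative_iff_has_vector_derivative)
  qed
  then have "h (x + 1 *\<^sub>R w) = (\<Sum>k<n. ((1 - 0) ^ k / fact k) *\<^sub>R D k 0)
      + integral {0..1} (\<lambda>s. ((1 - s) ^ (n - 1) / fact (n - 1)) *\<^sub>R D n s)"
    using Taylor_integral[of n D "\<lambda>s. h (x + s *\<^sub>R w)" 0 1] assms(2) D0 by simp
  also have "(\<Sum>k<n. ((1 - 0) ^ k / fact k) *\<^sub>R D k 0) = (\<Sum>k<n. \<Sum>\<alpha> | mi_norm \<alpha> = k. mi_power w \<alpha> * mixed_partial \<alpha> h x / mi_fact \<alpha>)"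
    by (simp add: D_def sum_distrib_left)
  also have "integral {0..1} (\<lambda>s. ((1 - s) ^ (n - 1) / fact (n - 1)) *\<^sub>R D n s)
     = integral {0..1} (\<lambda>s. real n * ((1 - s) ^ (n - 1) *
        (\<Sum>\<alpha> | mi_norm \<alpha> = n. mi_power w \<alpha> * mixed_partial \<alpha> h (x + s *\<^sub>R w) / mi_fact \<alpha>)))"
  proof (intro arg_cong[of _ _ "integral {0..1}"] ext)
    fix s
    have "fact n = real n * fact (n - 1)" using assms(2) by (simp add: fact_reduce)
    then have "D n s = fact (n - 1) * (real n * (\<Sum>\<alpha> | mi_norm \<alpha> = n. mi_power w \<alpha> * mixed_partial \<alpha> h (x + s *\<^sub>R w) / mi_fact \<alpha>))"
      by (simp add: D_def sum_distrib_left mult_ac)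
    then show "((1 - s) ^ (n - 1) / fact (n - 1)) *\<^sub>R D n s
      = real n * ((1 - s) ^ (n - 1) * (\<Sum>\<alpha> | mi_norm \<alpha> = n. mi_power w \<alpha> * mixed_partial \<alpha> h (x + s *\<^sub>R w) / mi_fact \<alpha>))"
      by simp
  qed
  finally show ?thesis by simp
qed

section \<open>Moments of the gamma coefficients and the decomposition of orthants\<close>

lemma sum_alternating_choose_Suc:
  fixes F :: "nat \<Rightarrow> real"
  shows "(\<Sum>i\<le>Suc n. (-1) ^ i * real (Suc n choose i) * F i)
    = (\<Sum>i\<le>n. (-1) ^ i * real (n choose i) * (F i - F (Suc i)))"
proof -
  have "(\<Sum>i\<le>Suc n. (-1) ^ i * real (Suc n choose i) * F i)
      = F 0 + (\<Sum>i\<le>n. (-1) ^ Suc i * real (Suc n choose Suc i) * F (Suc i))"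
    by (subst sum.atMost_Suc_shift) simp
  also have "(\<Sum>i\<le>n. (-1) ^ Suc i * real (Suc n choose Suc i) * F (Suc i))
      = (\<Sum>i\<le>n. (-1) ^ Suc i * real (n choose Suc i) * F (Suc i)) - (\<Sum>i\<le>n. (-1) ^ i * real (n choose i) * F (Suc i))"
    unfolding sum_subtractf[symmetric] by (intro sum.cong refl) (simp add: algebra_simps)
  also have "F 0 + ((\<Sum>i\<le>n. (-1) ^ Suc i * real (n choose Suc i) * F (Suc i)) - (\<Sum>i\<le>n. (-1) ^ i * real (n choose i) * F (Suc i)))
      = (\<Sum>i\<le>Suc n. (-1) ^ i * real (n choose i) * F i) - (\<Sum>i\<le>n. (-1) ^ i * real (n choose i) * F (Suc i))"
  proof -
    have "(\<Sum>i\<le>Suc n. (-1) ^ i * real (n choose i) * F i) = F 0 + (\<Sum>i\<le>n. (-1) ^ Suc i * real (n choose Suc i) * F (Suc i))"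
      by (subst sum.atMost_Suc_shift) simp
    then show ?thesis by (simp only: add_diff_eq)
  qed
  also have "\<dots> = (\<Sum>i\<le>n. (-1) ^ i * real (n choose i) * (F i - F (Suc i)))"
    unfolding sum_subtractf[symmetric] right_diff_distrib by (simp add: binomial_eq_0 sum_subtractf)
  finally show ?thesis .
qed

text \<open>A finite difference of order \<open>n\<close> vanishes on polynomials of smaller degree: one difference step lowers the degree
by one.\<close>

lemma alternating_choose_power_sum_eq_0:
  fixes x :: real
  assumes "a < n"
  shows "(\<Sum>i\<le>n. (-1) ^ i * real (n choose i) * (x + real i) ^ a) = 0"
  using assms
proof (induction n arbitrary: a x)
  case (Suc n)
  have pow: "(x + real i) ^ a - (x + real (Suc i)) ^ a = (\<Sum>b<a. - real (a choose b) * (x + real i) ^ b)" for i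
  proof -
    have "(x + real (Suc i)) ^ a = ((x + real i) + 1) ^ a" by (simp add: algebra_simps)
    also have "\<dots> = (\<Sum>b\<le>a. real (a choose b) * (x + real i) ^ b)"
      by (subst binomial_ring) simp
    also have "\<dots> = (\<Sum>b<a. real (a choose b) * (x + real i) ^ b) + (x + real i) ^ a"
      by (simp flip: lessThan_Suc_atMost)
    finally show ?thesis by (simp add: sum_negf)
  qed
  have "(\<Sum>i\<le>Suc n. (-1) ^ i * real (Suc n choose i) * (x + real i) ^ a)
      = (\<Sum>i\<le>n. (-1) ^ i * real (n choose i) * (\<Sum>b<a. - real (a choose b) * (x + real i) ^ b))"
    by (simp only: sum_alternating_choose_Suc pow)
  also have "\<dots> = (\<Sum>b<a. - real (a choose b) * (\<Sum>i\<le>n. (-1) ^ i * real (n choose i) * (x + real i) ^ b))"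
    unfolding sum_distrib_left by (subst sum.swap) (simp add: mult_ac)
  also have "\<dots> = 0"
  proof (intro sum.neutral ballI)
    fix b assume "b \<in> {..<a}"
    then have "b < n" using Suc.prems by simp
    then show "- real (a choose b) * (\<Sum>i\<le>n. (-1) ^ i * real (n choose i) * (x + real i) ^ b) = 0"
      by (simp only: Suc.IH mult_zero_right)
  qed
  finally show ?case .
qed simp

text \<open>The \<open>2 m\<close>-th finite difference of \<open>z\<^sup>a\<close>, centred at \<open>0\<close>, is zero. Its central term is nonzero only for \<open>a = 0\<close>, and the
terms for \<open>z = j\<close> and \<open>z = - j\<close> combine to the summand on the left-hand side.\<close>

lemma gamma_coeff_moment:
  assumes "even a" "a < 2 * m"
  shows "(\<Sum>j=1..m. gamma_coeff m j * real j * real j ^ a) = (if a = 0 then 1 else 0)"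
proof -
  define h where "h z = (-1) ^ nat \<bar>z\<bar> * real_of_int z ^ a" for z :: int
  have sgn: "(-1 :: real) ^ i = (-1) ^ m * (-1) ^ nat \<bar>int i - int m\<bar>" for i
  proof (cases "i \<le> m")
    case True
    then have i: "nat \<bar>int i - int m\<bar> = m - i" by linarith
    have m: "(-1 :: real) ^ m = (-1) ^ (m - i) * (-1) ^ i"
      using True by (simp flip: power_add)
    show ?thesis unfolding i m by (simp flip: power_mult_distrib add: mult_ac)
  next
    case False
    then have "nat \<bar>int i - int m\<bar> = i - m" by linarith
    then show ?thesis using False by (simp flip: power_add)
  qed
  have "0 = (\<Sum>i\<le>2 * m. (-1) ^ i * real ((2 * m) choose i) * (- real m + real i) ^ a)"
    using assms(2) by (rule alternating_choose_power_sum_eq_0[symmetric])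
  also have "\<dots> = (-1) ^ m * (\<Sum>i\<le>2 * m. real ((2 * m) choose i) * h (int i - int m))"
    unfolding sum_distrib_left by (intro sum.cong refl) (subst sgn, simp add: h_def mult_ac)
  finally have "(\<Sum>i\<le>2 * m. real ((2 * m) choose i) * h (int i - int m)) = 0"
    by simp
  then have "real ((2 * m) choose m) * h 0 + (\<Sum>j=1..m. real ((2 * m) choose (m + j)) * (h (int j) + h (- int j))) = 0"
    by (simp only: central_binomial_sum_symmetric)
  moreover have "h (int j) + h (- int j) = 2 * (-1) ^ j * real j ^ a" for j
    using assms(1) by (simp add: h_def)
  ultimately have eq: "(\<Sum>j=1..m. real ((2 * m) choose (m + j)) * (2 * (-1) ^ j * real j ^ a)) = - real ((2 * m) choose m) * h 0"
    by simp
  have "(\<Sum>j=1..m. gamma_coeff m j * real j * real j ^ a)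
      = - (\<Sum>j=1..m. real ((2 * m) choose (m + j)) * (2 * (-1) ^ j * real j ^ a)) / real ((2 * m) choose m)"
    unfolding sum_negf[symmetric] sum_divide_distrib
  proof (intro sum.cong refl)
    fix j assume "j \<in> {1..m}"
    then obtain i where "j = Suc i" by (cases j) auto
    then have "gamma_coeff m j * real j = (-1) ^ i * 2 * real ((2 * m) choose (m + j)) / real ((2 * m) choose m)"
      by (simp add: gamma_coeff_def del: of_nat_Suc)
    with \<open>j = Suc i\<close> show "gamma_coeff m j * real j * real j ^ a
      = - (real ((2 * m) choose (m + j)) * (2 * (-1) ^ j * real j ^ a)) / real ((2 * m) choose m)"
      by simp
  qed
  also have "\<dots> = h 0"
    unfolding eq by simp
  also have "h 0 = (if a = 0 then 1 else 0)"
    by (simp add: h_def)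
  finally show ?thesis .
qed

lemma sum_vec_box_prod:
  fixes F :: "'n::finite \<Rightarrow> 'a::order \<Rightarrow> real"
  assumes "\<And>r. finite {a $ r..b $ r}"
  shows "(\<Sum>x\<in>{a..b}. \<Prod>r\<in>UNIV. F r (x $ r)) = (\<Prod>r\<in>UNIV. \<Sum>y\<in>{a $ r..b $ r}. F r y)"
proof -
  have "(\<Prod>r\<in>UNIV. \<Sum>y\<in>{a $ r..b $ r}. F r y) = (\<Sum>g\<in>(\<Pi>\<^sub>E r\<in>UNIV. {a $ r..b $ r}). \<Prod>r\<in>UNIV. F r (g r))"
    using assms by (intro prod_sum_PiE) auto
  also have "\<dots> = (\<Sum>x\<in>{a..b}. \<Prod>r\<in>UNIV. F r (x $ r))"
    by (rule sum.reindex_bij_witness[of _ vec_nth vec_lambda]) (auto simp: less_eq_vec_def PiE_iff)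
  finally show ?thesis ..
qed

text \<open>With \<open>d = \<lceil>y\<rceil>\<close>, the first set consists of the last \<open>min j d\<close> natural numbers below \<open>d\<close> and the second of the first
\<open>min j d\<close> natural numbers; both are empty for negative \<open>y\<close>.\<close>

lemma count_half_line:
  fixes y :: real and N j :: nat
  assumes nonint: "y \<notin> \<int>" and N: "y \<le> real N"
  shows "card {k. k \<le> N \<and> y - real j < real k \<and> real k < y} = card {b. b < j \<and> real b < y}"
proof (cases "y < 0")
  case True
  then have "{k. k \<le> N \<and> y - real j < real k \<and> real k < y} = {}" "{b. b < j \<and> real b < y} = {}" by auto
  then show ?thesis by (simp only:)
next
  case False
  define d where "d = nat \<lceil>y\<rceil>"
  have lt: "real k < y \<longleftrightarrow> k < d" for k
    unfolding d_def by (simp add: less_ceiling_iff nat_less_iff zless_nat_eq_int_zless)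
  have gt: "y - real j < real k \<longleftrightarrow> d \<le> k + j" for k
  proof -
    have "real (k + j) \<noteq> y" using nonint by (metis Ints_of_nat)
    moreover have "\<not> real (k + j) < y \<longleftrightarrow> d \<le> k + j" using lt[of "k + j"] by (simp add: not_less)
    ultimately show ?thesis by auto
  qed
  have "d \<le> N + 1"
    using N lt[of "N + 1"] by linarith
  then have "{k. k \<le> N \<and> y - real j < real k \<and> real k < y} = {d - j..<d}"
    unfolding lt gt by auto
  moreover have "{b. b < j \<and> real b < y} = {..<min j d}"
    unfolding lt by auto
  ultimately show ?thesis by simp
qed

text \<open>The defining series has finitely many nonzero terms, since \<open>gamma_coeff m j = 0\<close> for \<open>j > m\<close>.\<close>

lemma tau_coeff_eq:
  assumes "1 \<le> m"
  shows "tau_coeff m (Suc n) = (\<Sum>j | 1 \<le> j \<and> j \<le> m \<and> n < j \<and> even (j - 1 - n). gamma_coeff m j)"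
proof -
  have zero: "gamma_coeff m j = 0" if "m < j" for j
    using that by (simp add: gamma_coeff_def)
  have "tau_coeff m (Suc n) = (\<Sum>b | Suc n + 2 * b \<le> m. gamma_coeff m (Suc n + 2 * b))"
    unfolding tau_coeff_def
  proof (rule suminf_finite)
    show "finite {b. Suc n + 2 * b \<le> m}" by (rule finite_subset[of _ "{..m}"]) auto
  qed (simp add: zero)
  also have "\<dots> = (\<Sum>j | 1 \<le> j \<and> j \<le> m \<and> n < j \<and> even (j - 1 - n). gamma_coeff m j)"
    by (rule sum.reindex_bij_witness[of _ "\<lambda>j. (j - 1 - n) div 2" "\<lambda>b. Suc n + 2 * b"]) auto
  finally show ?thesis .
qed

text \<open>An interval of length \<open>j\<close> consists of unit intervals whose centres are displaced by \<open>\<beta> / 2\<close> with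
\<open>\<beta> = j - 1, j - 3, \<dots>, 1 - j\<close>. Collecting the weights of all \<open>j\<close> that contribute a given \<open>\<beta>\<close> yields \<open>tau_coeff\<close>.\<close>

lemma sum_gamma_coeff_intervals:
  fixes h :: "int \<Rightarrow> real"
  assumes "1 \<le> m"
  shows "(\<Sum>j=1..m. gamma_coeff m j * (\<Sum>b<j. h (int j - 1 - 2 * int b)))
    = (\<Sum>\<beta>=1 - int m..int m - 1. tau_coeff m (1 + nat \<bar>\<beta>\<bar>) * h \<beta>)"
proof -
  define C where "C j \<beta> \<longleftrightarrow> nat \<bar>\<beta>\<bar> < j \<and> even (j - 1 - nat \<bar>\<beta>\<bar>)" for j \<beta>
  have inner: "(\<Sum>b<j. h (int j - 1 - 2 * int b)) = (\<Sum>\<beta>=1 - int m..int m - 1. if C j \<beta> then h \<beta> else 0)"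
    if j: "j \<in> {1..m}" for j
  proof -
    have "(\<Sum>\<beta>=1 - int m..int m - 1. if C j \<beta> then h \<beta> else 0) = (\<Sum>\<beta> | \<beta> \<in> {1 - int m..int m - 1} \<and> C j \<beta>. h \<beta>)"
      by (rule sum.inter_filter[symmetric]) simp
    also have "\<dots> = (\<Sum>b<j. h (int j - 1 - 2 * int b))"
    proof (rule sum.reindex_bij_witness[of _ "\<lambda>b. int j - 1 - 2 * int b" "\<lambda>\<beta>. nat ((int j - 1 - \<beta>) div 2)"])
      fix \<beta> assume "\<beta> \<in> {\<beta> \<in> {1 - int m..int m - 1}. C j \<beta>}"
      then have b: "\<bar>\<beta>\<bar> < int j" "even (j - 1 - nat \<bar>\<beta>\<bar>)" by (auto simp: C_def)
      then have "even (int (j - 1 - nat \<bar>\<beta>\<bar>))" by (simp only: even_of_nat_iff)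
      moreover have "int (j - 1 - nat \<bar>\<beta>\<bar>) = int j - 1 - \<bar>\<beta>\<bar>" using b by linarith
      ultimately have "even (int j - 1 - \<bar>\<beta>\<bar>)" by (simp only:)
      then have "even (int j - 1 - \<beta>)" by simp
      then obtain c where c: "int j - 1 - \<beta> = 2 * c" by (rule evenE)
      then have "0 \<le> c" "c < int j" using b by linarith+
      with c show "int j - 1 - 2 * int (nat ((int j - 1 - \<beta>) div 2)) = \<beta>" "nat ((int j - 1 - \<beta>) div 2) \<in> {..<j}"
        by auto
      with c \<open>0 \<le> c\<close> show "h (int j - 1 - 2 * int (nat ((int j - 1 - \<beta>) div 2))) = h \<beta>" by simp
    next
      fix b assume "b \<in> {..<j}"
      then have b: "b < j" by simp
      then show "nat ((int j - 1 - (int j - 1 - 2 * int b)) div 2) = b" by simp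
      have "nat \<bar>int j - 1 - 2 * int b\<bar> < j" using b by linarith
      moreover have "even (j - 1 - nat \<bar>int j - 1 - 2 * int b\<bar>)"
      proof -
        have "int (j - 1 - nat \<bar>int j - 1 - 2 * int b\<bar>) = int j - 1 - \<bar>int j - 1 - 2 * int b\<bar>" using b by linarith
        moreover have "even (int j - 1 - \<bar>int j - 1 - 2 * int b\<bar>)" by (simp add: abs_if)
        ultimately have "even (int (j - 1 - nat \<bar>int j - 1 - 2 * int b\<bar>))" by (simp only:)
        then show ?thesis by (simp only: even_of_nat_iff)
      qed
      ultimately show "int j - 1 - 2 * int b \<in> {\<beta> \<in> {1 - int m..int m - 1}. C j \<beta>}"
        using b j by (auto simp: C_def)
    qed
    finally show ?thesis ..
  qed
  have "(\<Sum>j=1..m. gamma_coeff m j * (\<Sum>b<j. h (int j - 1 - 2 * int b)))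
      = (\<Sum>j=1..m. \<Sum>\<beta>=1 - int m..int m - 1. (if C j \<beta> then gamma_coeff m j else 0) * h \<beta>)"
    unfolding sum_distrib_left[symmetric] by (intro sum.cong refl) (simp add: inner sum_distrib_left if_distrib if_distribR cong: if_cong)
  also have "\<dots> = (\<Sum>\<beta>=1 - int m..int m - 1. (\<Sum>j=1..m. if C j \<beta> then gamma_coeff m j else 0) * h \<beta>)"
    by (subst sum.swap) (simp add: sum_distrib_right)
  also have "\<dots> = (\<Sum>\<beta>=1 - int m..int m - 1. tau_coeff m (1 + nat \<bar>\<beta>\<bar>) * h \<beta>)"
  proof (intro sum.cong refl arg_cong2[of _ _ _ _ "(*)"])
    fix \<beta>
    have "(\<Sum>j=1..m. if C j \<beta> then gamma_coeff m j else 0) = (\<Sum>j | j \<in> {1..m} \<and> C j \<beta>. gamma_coeff m j)"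
      by (rule sum.inter_filter[symmetric]) simp
    also have "{j. j \<in> {1..m} \<and> C j \<beta>} = {j. 1 \<le> j \<and> j \<le> m \<and> nat \<bar>\<beta>\<bar> < j \<and> even (j - 1 - nat \<bar>\<beta>\<bar>)}"
      by (auto simp: C_def)
    finally show "(\<Sum>j=1..m. if C j \<beta> then gamma_coeff m j else 0) = tau_coeff m (1 + nat \<bar>\<beta>\<bar>)"
      using tau_coeff_eq[OF assms, of "nat \<bar>\<beta>\<bar>"] by simp
  qed
  finally show ?thesis .
qed

text \<open>For fixed \<open>j\<close>, the intervals of length \<open>j\<close> around \<open>0, 1, 2, \<dots>\<close> cover \<open>z\<close> as often as the \<open>j\<close> half-lines swept out by
their unit pieces. The finite bound \<open>N\<close> only has to exceed all centres whose interval can reach \<open>z\<close>. Excluding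
half-integers \<open>z\<close> avoids all end points.\<close>

lemma half_line_decomposition:
  fixes z :: real
  assumes m: "1 \<le> m" and nonint: "2 * z \<notin> \<int>" and N: "z + real m / 2 \<le> real N"
  shows "(\<Sum>j=1..m. gamma_coeff m j * (\<Sum>k=0..N. of_bool (\<bar>z - real k\<bar> < real j / 2)))
    = (\<Sum>\<beta>=1 - int m..int m - 1. tau_coeff m (1 + nat \<bar>\<beta>\<bar>) * of_bool (0 < z + (1 + real_of_int \<beta>) / 2))"
proof -
  have "(\<Sum>k=0..N. of_bool (\<bar>z - real k\<bar> < real j / 2)) = (\<Sum>b<j. of_bool (0 < z + (1 + real_of_int (int j - 1 - 2 * int b)) / 2) :: real)"
    if "j \<in> {1..m}" for j
  proof -
    have y: "z + real j / 2 \<notin> \<int>"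
    proof
      assume "z + real j / 2 \<in> \<int>"
      then have "2 * (z + real j / 2) - real j \<in> \<int>" by (intro Ints_diff Ints_mult) auto
      then show False using nonint by simp
    qed
    have "(\<Sum>k=0..N. of_bool (\<bar>z - real k\<bar> < real j / 2)) = real (card {k. k \<le> N \<and> z + real j / 2 - real j < real k \<and> real k < z + real j / 2})"
    proof -
      have "\<bar>z - real k\<bar> < real j / 2 \<longleftrightarrow> z + real j / 2 - real j < real k \<and> real k < z + real j / 2" for k
        unfolding abs_less_iff by (auto simp: field_simps)
      moreover have "{0..N} \<inter> {k. Q k} = {k. k \<le> N \<and> Q k}" for Q by auto
      ultimately show ?thesis by (simp add: of_bool_def sum.If_cases)
    qed
    also have "\<dots> = real (card {b. b < j \<and> real b < z + real j / 2})"
      using y N that by (subst count_half_line) auto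
    also have "\<dots> = (\<Sum>b<j. of_bool (0 < z + (1 + real_of_int (int j - 1 - 2 * int b)) / 2))"
    proof -
      have "0 < z + (1 + real_of_int (int j - 1 - 2 * int b)) / 2 \<longleftrightarrow> real b < z + real j / 2" for b
        by (simp add: field_simps)
      moreover have "{..<j} \<inter> {k. Q k} = {k. k < j \<and> Q k}" for Q by auto
      ultimately show ?thesis by (simp add: of_bool_def sum.If_cases)
    qed
    finally show ?thesis .
  qed
  then have "(\<Sum>j=1..m. gamma_coeff m j * (\<Sum>k=0..N. of_bool (\<bar>z - real k\<bar> < real j / 2)))
    = (\<Sum>j=1..m. gamma_coeff m j * (\<Sum>b<j. of_bool (0 < z + (1 + real_of_int (int j - 1 - 2 * int b)) / 2)))"
    by (intro sum.cong refl) simp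
  also have "\<dots> = (\<Sum>\<beta>=1 - int m..int m - 1. tau_coeff m (1 + nat \<bar>\<beta>\<bar>) * of_bool (0 < z + (1 + real_of_int \<beta>) / 2))"
    using sum_gamma_coeff_intervals[OF m, of "\<lambda>\<beta>. of_bool (0 < z + (1 + real_of_int \<beta>) / 2)"] .
  finally show ?thesis .
qed

lemma orthant_decomposition:
  fixes z :: "real ^ 'n::finite"
  assumes m: "1 \<le> m" and nonint: "\<And>r. 2 * z $ r \<notin> \<int>" and N: "\<And>r. z $ r + real m / 2 \<le> real N"
  shows "(\<Sum>j\<in>{1..vec m}. gamma_vec m j * (\<Sum>k\<in>{0..vec N}. \<Prod>r\<in>UNIV. of_bool (\<bar>z $ r - real (k $ r)\<bar> < real (j $ r) / 2)))
    = (\<Sum>\<beta>\<in>{vec (1 - int m)..vec (int m - 1)}. tau_vec m (\<chi> r. 1 + nat \<bar>\<beta> $ r\<bar>) *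
        (\<Prod>r\<in>UNIV. of_bool (0 < z $ r + (1 + real_of_int (\<beta> $ r)) / 2)))"
proof -
  have "(\<Sum>j\<in>{1..vec m}. gamma_vec m j * (\<Sum>k\<in>{0..vec N}. \<Prod>r\<in>UNIV. of_bool (\<bar>z $ r - real (k $ r)\<bar> < real (j $ r) / 2)))
      = (\<Sum>j\<in>{1..vec m}. \<Prod>r\<in>UNIV. gamma_coeff m (j $ r) * (\<Sum>k=0..N. of_bool (\<bar>z $ r - real k\<bar> < real (j $ r) / 2)))"
    unfolding gamma_vec_def prod.distrib
    by (intro sum.cong refl arg_cong2[of _ _ _ _ "(*)"]) (subst sum_vec_box_prod, auto)
  also have "\<dots> = (\<Prod>r\<in>UNIV. \<Sum>j=1..m. gamma_coeff m j * (\<Sum>k=0..N. of_bool (\<bar>z $ r - real k\<bar> < real j / 2)))"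
    by (subst sum_vec_box_prod) auto
  also have "\<dots> = (\<Prod>r\<in>UNIV. \<Sum>\<beta>=1 - int m..int m - 1. tau_coeff m (1 + nat \<bar>\<beta>\<bar>) * of_bool (0 < z $ r + (1 + real_of_int \<beta>) / 2))"
    by (intro prod.cong refl half_line_decomposition m nonint N)
  also have "\<dots> = (\<Sum>\<beta>\<in>{vec (1 - int m)..vec (int m - 1)}. \<Prod>r\<in>UNIV. tau_coeff m (1 + nat \<bar>\<beta> $ r\<bar>) * of_bool (0 < z $ r + (1 + real_of_int (\<beta> $ r)) / 2))"
    by (subst sum_vec_box_prod) auto
  also have "\<dots> = (\<Sum>\<beta>\<in>{vec (1 - int m)..vec (int m - 1)}. tau_vec m (\<chi> r. 1 + nat \<bar>\<beta> $ r\<bar>) *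
        (\<Prod>r\<in>UNIV. of_bool (0 < z $ r + (1 + real_of_int (\<beta> $ r)) / 2)))"
    by (simp add: tau_vec_def prod.distrib)
  finally show ?thesis .
qed

text \<open>Jensen's inequality for \<open>x\<^sup>n\<^sup>+\<^sup>1\<close> with equal weights.\<close>

lemma sum_power_le_card_power_sum:
  fixes a :: "'n::finite \<Rightarrow> real"
  assumes "\<And>r. 0 \<le> a r"
  shows "(\<Sum>r\<in>UNIV. a r) ^ Suc n \<le> real CARD('n) ^ n * (\<Sum>r\<in>UNIV. a r ^ Suc n)"
proof -
  have conv: "convex_on {0..} (\<lambda>x::real. x ^ Suc n)"
  proof (cases "odd (Suc n)")
    case True then show ?thesis by (rule convex_power_odd)
  next
    case False
    then show ?thesis using convex_power_even[of "Suc n"] convex_on_subset by blast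
  qed
  let ?p = "real CARD('n)"
  have p: "?p > 0" by simp
  have "(\<Sum>r\<in>UNIV. (1 / ?p) *\<^sub>R a r) ^ Suc n \<le> (\<Sum>r\<in>UNIV. (1 / ?p) * a r ^ Suc n)"
    using assms by (intro convex_on_sum[OF _ _ conv]) auto
  then have "((\<Sum>r\<in>UNIV. a r) / ?p) ^ Suc n \<le> (\<Sum>r\<in>UNIV. a r ^ Suc n) / ?p"
    by (simp add: sum_divide_distrib)
  then have "(\<Sum>r\<in>UNIV. a r) ^ Suc n / ?p ^ Suc n \<le> (\<Sum>r\<in>UNIV. a r ^ Suc n) / ?p"
    by (simp only: power_divide)
  then have "(\<Sum>r\<in>UNIV. a r) ^ Suc n / ?p ^ Suc n * ?p ^ Suc n \<le> (\<Sum>r\<in>UNIV. a r ^ Suc n) / ?p * ?p ^ Suc n"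
    by (rule mult_right_mono) simp
  then show ?thesis using p by (simp add: mult.commute)
qed

section \<open>The quadrature identity at a point\<close>

lemma mi_power_add: "mi_power x (\<alpha> + \<beta>) = mi_power x \<alpha> * mi_power x \<beta>"
  by (simp add: mi_power_def power_add prod.distrib)

lemma mi_power_0 [simp]: "mi_power x 0 = 1"
  by (simp add: mi_power_def)

lemma continuous_on_mi_power [continuous_intros]:
  "continuous_on S g \<Longrightarrow> continuous_on S (\<lambda>x. mi_power (g x) \<alpha>)"
  unfolding mi_power_def by (intro continuous_intros)

lemma mi_power_half_scaled:
  "mi_power (\<chi> r. real (j $ r) * u $ r / 2) \<alpha> = mi_power (real_vec j) \<alpha> * mi_power u \<alpha> / 2 ^ mi_norm \<alpha>"
  by (simp add: mi_power_def real_vec_def mi_norm_def power_mult_distrib power_divide prod.distrib prod_dividef power_sum)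

lemma finite_nat_vec_box [simp]: "finite {a..b :: nat ^ 'n::finite}"
  by (rule finite_vec_box) simp

lemma finite_int_vec_box [simp]: "finite {a..b :: int ^ 'n::finite}"
  by (rule finite_vec_box) simp

lemma cube_eq_cbox: "{x :: real ^ 'n::finite. \<forall>r. x $ r \<in> {-1..1}} = cbox (-1) 1"
  by (auto simp: mem_box_cart)

lemma set_integral_cbox:
  fixes h :: "'a::euclidean_space \<Rightarrow> real"
  assumes "continuous_on (cbox a b) h"
  shows "set_integrable lborel (cbox a b) h" "(LINT x : cbox a b | lborel. h x) = integral (cbox a b) h"
proof -
  show i: "set_integrable lborel (cbox a b) h"
    unfolding set_integrable_def by (rule borel_integrable_compact[OF compact_cbox assms])
  then show "(LINT x : cbox a b | lborel. h x) = integral (cbox a b) h"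
    by (rule set_borel_integral_eq_integral)
qed

lemma Basis_cart: "(Basis :: (real ^ 'n::finite) set) = range (\<lambda>r. axis r 1)"
  by (auto simp: Basis_vec_def)

lemma inj_axis_one: "inj (\<lambda>r. axis r 1 :: real ^ 'n::finite)"
  by (auto intro!: injI simp: axis_eq_axis)

lemma integral_diagonal_affine:
  fixes f :: "real ^ 'n::finite \<Rightarrow> real" and c :: "'n \<Rightarrow> real"
  assumes c: "\<And>r. c r \<noteq> 0" and [measurable]: "f \<in> borel_measurable borel"
  shows "(\<integral>x. f x \<partial>lborel) = (\<Prod>r\<in>UNIV. \<bar>c r\<bar>) * (\<integral>x. f (t + (\<chi> r. c r * x $ r)) \<partial>lborel)"
proof -
  define c' where "c' = (\<lambda>b :: real ^ 'n. c (axis_index b))"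
  define T where "T = (\<lambda>x. t + (\<Sum>j\<in>Basis. (c' j * (x \<bullet> j)) *\<^sub>R j))"
  define d where "d = (\<Prod>r\<in>UNIV. \<bar>c r\<bar>)"
  have T: "T x = t + (\<chi> r. c r * x $ r)" for x
  proof -
    have "(\<Sum>j\<in>Basis. (c' j * (x \<bullet> j)) *\<^sub>R j) = (\<Sum>r\<in>UNIV. (c r * x $ r) *\<^sub>R axis r 1)"
      unfolding Basis_cart by (subst sum.reindex[OF inj_axis_one]) (simp add: c'_def inner_axis)
    also have "\<dots> = (\<chi> r. c r * x $ r)"
      using basis_expansion[of "\<chi> r. c r * x $ r"] by (simp add: scalar_mult_eq_scaleR)
    finally show ?thesis by (simp add: T_def)
  qed
  have "continuous_on UNIV T"
    unfolding T by (intro continuous_intros)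
  then have [measurable]: "T \<in> borel_measurable borel"
    by (rule borel_measurable_continuous_onI)
  have "(\<Prod>j\<in>Basis. \<bar>c' j\<bar>) = d"
    unfolding Basis_cart d_def by (subst prod.reindex[OF inj_axis_one]) (simp add: c'_def)
  moreover have "lborel = density (distr lborel borel T) (\<lambda>_. ennreal (\<Prod>j\<in>Basis. \<bar>c' j\<bar>))"
    unfolding T_def by (rule lborel_affine_euclidean) (simp add: c'_def c)
  ultimately have "lborel = density (distr lborel borel T) (\<lambda>_. ennreal d)" by simp
  then have "(\<integral>x. f x \<partial>lborel) = (\<integral>x. f x \<partial>density (distr lborel borel T) (\<lambda>_. ennreal d))" by (rule arg_cong)
  also have "\<dots> = (\<integral>x. d *\<^sub>R f x \<partial>distr lborel borel T)"
    by (rule integral_density) (auto simp: d_def prod_nonneg)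
  also have "\<dots> = (\<integral>x. d *\<^sub>R f (T x) \<partial>lborel)"
    by (rule integral_distr) measurable
  also have "\<dots> = d * (\<integral>x. f (T x) \<partial>lborel)"
    by simp
  finally show ?thesis by (simp only: T d_def)
qed

text \<open>Reflection in the coordinate \<open>q\<close> changes the sign of the integrand.\<close>

lemma integral_cube_odd:
  assumes "odd (\<alpha> $ q)"
  shows "integral (cbox (-1) 1) (\<lambda>u :: real ^ 'n::finite. mi_power u \<alpha>) = 0"
proof -
  let ?f = "\<lambda>u :: real ^ 'n. indicat_real (cbox (-1) 1) u * mi_power u \<alpha>"
  let ?c = "\<lambda>r. if r = q then -1 else 1 :: real"
  have f: "?f \<in> borel_measurable borel"
    by (intro borel_measurable_times borel_measurable_indicator borel_measurable_continuous_onI continuous_intros) auto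
  have "(\<integral>u. ?f u \<partial>lborel) = (\<Prod>r\<in>UNIV. \<bar>?c r\<bar>) * (\<integral>u. ?f (0 + (\<chi> r. ?c r * u $ r)) \<partial>lborel)"
    by (rule integral_diagonal_affine) (use f in auto)
  also have "(\<Prod>r\<in>UNIV. \<bar>?c r\<bar>) = 1" by (intro prod.neutral) auto
  also have "(\<lambda>u. ?f (0 + (\<chi> r. ?c r * u $ r))) = (\<lambda>u. - ?f u)"
  proof
    fix u :: "real ^ 'n"
    have "(\<chi> r. ?c r * u $ r) \<in> cbox (-1) 1 \<longleftrightarrow> u \<in> cbox (-1) 1"
      unfolding mem_box_cart by (intro all_cong1) auto
    moreover have "mi_power (\<chi> r. ?c r * u $ r) \<alpha> = - mi_power u \<alpha>"
      unfolding mi_power_def using assms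
      by (subst (1 2) prod.remove[of _ q]) (auto intro!: prod.cong)
    ultimately show "?f (0 + (\<chi> r. ?c r * u $ r)) = - ?f u"
      by (simp add: indicator_def)
  qed
  finally have "(\<integral>u. ?f u \<partial>lborel) = 0" by simp
  moreover have "(LINT u : cbox (-1) (1 :: real ^ 'n) | lborel. mi_power u \<alpha>) = integral (cbox (-1) 1) (\<lambda>u. mi_power u \<alpha>)"
    by (intro set_integral_cbox continuous_intros)
  ultimately show ?thesis by (simp add: set_lebesgue_integral_def)
qed

lemma integral_cube_const: "integral (cbox (-1) (1 :: real ^ 'n::finite)) (\<lambda>u. c) = 2 ^ CARD('n) * (c :: real)"
proof -
  have "measure lborel (cbox (-1) (1 :: real ^ 'n)) = 2 ^ CARD('n)"
    by (subst content_cbox_cart) (auto simp: interval_eq_empty_cart)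
  then show ?thesis by simp
qed

text \<open>The weighted moments factor over the coordinates. For \<open>\<alpha> \<noteq> 0\<close>, a coordinate with an odd exponent makes the integral
vanish and one with a positive even exponent makes the sum vanish.\<close>

lemma gamma_vec_moment:
  fixes \<alpha> :: "nat ^ 'n::finite"
  assumes "mi_norm \<alpha> < 2 * m"
  shows "(\<Sum>j\<in>{1..vec m}. gamma_vec m j * mi_power (real_vec j) (\<alpha> + 1)) * integral (cbox (-1) 1) (\<lambda>u. mi_power u \<alpha>)
    = (if \<alpha> = 0 then 2 ^ CARD('n) else 0)"
proof -
  have "(\<Sum>j\<in>{1..vec m}. gamma_vec m j * mi_power (real_vec j) (\<alpha> + 1))
      = (\<Sum>j\<in>{1..vec m}. \<Prod>r\<in>UNIV. gamma_coeff m (j $ r) * real (j $ r) * real (j $ r) ^ (\<alpha> $ r))"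
    by (simp add: gamma_vec_def mi_power_def real_vec_def prod.distrib mult_ac)
  also have "\<dots> = (\<Prod>r\<in>UNIV. \<Sum>j=1..m. gamma_coeff m j * real j * real j ^ (\<alpha> $ r))"
    by (subst sum_vec_box_prod) auto
  finally have eq: "(\<Sum>j\<in>{1..vec m}. gamma_vec m j * mi_power (real_vec j) (\<alpha> + 1))
    = (\<Prod>r\<in>UNIV. \<Sum>j=1..m. gamma_coeff m j * real j * real j ^ (\<alpha> $ r))" .
  have lt: "\<alpha> $ r < 2 * m" for r
  proof -
    have "\<alpha> $ r \<le> mi_norm \<alpha>" unfolding mi_norm_def by (rule member_le_sum) auto
    then show ?thesis using assms by simp
  qed
  show ?thesis
  proof (cases "\<alpha> = 0")
    case True
    have "(\<Prod>r\<in>UNIV. \<Sum>j=1..m. gamma_coeff m j * real j * real j ^ (\<alpha> $ r)) = 1"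
      using True gamma_coeff_moment[of 0 m] lt by (intro prod.neutral) auto
    then show ?thesis
      unfolding eq using True integral_cube_const[of 1] by simp
  next
    case False
    then obtain q where q: "\<alpha> $ q \<noteq> 0" by (auto simp: vec_eq_iff)
    show ?thesis
    proof (cases "odd (\<alpha> $ q)")
      case True
      then show ?thesis using integral_cube_odd[of \<alpha> q] False by simp
    next
      case even: False
      then have "(\<Prod>r\<in>UNIV. \<Sum>j=1..m. gamma_coeff m j * real j * real j ^ (\<alpha> $ r)) = 0"
        using gamma_coeff_moment[of "\<alpha> $ q" m] lt[of q] q by (intro prod_zero) auto
      then show ?thesis unfolding eq using False by simp
    qed
  qed
qed

text \<open>The remainder as a functional of an arbitrary family of functions in place of the signed lattice sums. It is linear,
so it can be evaluated separately for each cone and each lattice point.\<close>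

definition remainder_functional :: "nat \<Rightarrow> (nat ^ 'n::finite \<Rightarrow> real ^ 'n \<Rightarrow> real) \<Rightarrow> real" where
  "remainder_functional m F = real m / 2 ^ (2 * m + CARD('n) - 1) *
     (\<Sum>\<alpha> | mi_norm \<alpha> = 2 * m. 1 / mi_fact \<alpha> *
        (LINT s : {0..1} | lborel. (1 - s) ^ (2 * m - 1) *
          (LINT u : {x. \<forall>r. x $ r \<in> {-1..1}} | lborel. mi_power u \<alpha> *
            (\<Sum>j\<in>{1 .. vec m}. gamma_vec m j * mi_power (real_vec j) (\<alpha> + 1) *
               F \<alpha> (\<chi> r. s * real (j $ r) * u $ r / 2)))))"

lemma remainder_R_eq_functional:
  "remainder_R m V I t A J f = remainder_functional m (signed_lattice_sum V I t A J f)"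
  by (simp add: remainder_R_def remainder_functional_def)

definition remainder_kernel :: "nat \<Rightarrow> (nat ^ 'n::finite \<Rightarrow> real ^ 'n \<Rightarrow> real) \<Rightarrow> real \<Rightarrow> real ^ 'n \<Rightarrow> real" where
  "remainder_kernel m F s u = (\<Sum>\<alpha> | mi_norm \<alpha> = 2 * m. 1 / mi_fact \<alpha> * ((1 - s) ^ (2 * m - 1) *
      (mi_power u \<alpha> * (\<Sum>j\<in>{1 .. vec m}. gamma_vec m j * mi_power (real_vec j) (\<alpha> + 1) *
               F \<alpha> (\<chi> r. s * real (j $ r) * u $ r / 2)))))"

lemma continuous_on_remainder_kernel:
  fixes F :: "nat ^ 'n::finite \<Rightarrow> real ^ 'n \<Rightarrow> real"
  assumes "\<And>\<alpha>. mi_norm \<alpha> = 2 * m \<Longrightarrow> continuous_on UNIV (F \<alpha>)"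
  shows "continuous_on S (\<lambda>(s, u). remainder_kernel m F s u)"
  unfolding remainder_kernel_def split_beta
  by (intro continuous_intros continuous_on_compose2[OF assms]) (auto simp: finite_mi_norm)

text \<open>Over continuous functions the iterated Lebesgue integrals combine to a single integral over a box in
\<open>\<real> \<times> \<real>\<^sup>p\<close>, from which linearity and the exchange of the order of integration can be read off.\<close>

lemma remainder_functional_eq_integral:
  fixes F :: "nat ^ 'n::finite \<Rightarrow> real ^ 'n \<Rightarrow> real"
  assumes F: "\<And>\<alpha>. mi_norm \<alpha> = 2 * m \<Longrightarrow> continuous_on UNIV (F \<alpha>)"
  shows "remainder_functional m F = real m / 2 ^ (2 * m + CARD('n) - 1) *
    integral (cbox (0, -1) (1, 1)) (\<lambda>(s, u). remainder_kernel m F s u)"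
proof -
  define H where "H \<alpha> s u = mi_power u \<alpha> * (\<Sum>j\<in>{1 .. vec m}. gamma_vec m j * mi_power (real_vec j) (\<alpha> + 1) *
               F \<alpha> (\<chi> r. s * real (j $ r) * u $ r / 2))" for \<alpha> s u
  let ?G = "\<lambda>\<alpha> (s, u). (1 - s) ^ (2 * m - 1) * H \<alpha> s u"
  have contH: "continuous_on S (\<lambda>x. H \<alpha> (f x) (g x))"
    if "mi_norm \<alpha> = 2 * m" "continuous_on S f" "continuous_on S g" for \<alpha> f g and S :: "'b::topological_space set"
    unfolding H_def by (intro continuous_intros continuous_on_compose2[OF F[OF that(1)]] that) auto
  have contG: "continuous_on S (?G \<alpha>)" if "mi_norm \<alpha> = 2 * m" for \<alpha> S
    unfolding split_beta by (intro continuous_intros contH that)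
  have one: "integral (cbox (0, -1) (1, 1)) (?G \<alpha>) = (LINT s : {0..1} | lborel. (1 - s) ^ (2 * m - 1) *
      (LINT u : {x. \<forall>r. x $ r \<in> {-1..1}} | lborel. H \<alpha> s u))" if \<alpha>: "mi_norm \<alpha> = 2 * m" for \<alpha>
  proof -
    have inner: "integral (cbox (-1) 1) (H \<alpha> s) = (LINT u : {x. \<forall>r. x $ r \<in> {-1..1}} | lborel. H \<alpha> s u)" for s
      unfolding cube_eq_cbox by (rule set_integral_cbox(2)[symmetric]) (intro contH \<alpha> continuous_intros)
    have "integral (cbox (0, -1) (1, 1)) (?G \<alpha>) = integral (cbox 0 1) (\<lambda>s. integral (cbox (-1) 1) (\<lambda>u. (1 - s) ^ (2 * m - 1) * H \<alpha> s u))"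
      by (subst integral_prod_continuous[OF contG[OF \<alpha>]]) simp
    also have "\<dots> = integral (cbox 0 1) (\<lambda>s. (1 - s) ^ (2 * m - 1) * integral (cbox (-1) 1) (H \<alpha> s))"
      by simp
    also have "\<dots> = (LINT s : cbox 0 1 | lborel. (1 - s) ^ (2 * m - 1) * integral (cbox (-1) 1) (H \<alpha> s))"
    proof (rule set_integral_cbox(2)[symmetric])
      have "continuous_on ({0..1} \<times> cbox (-1) 1) (\<lambda>(s, u). H \<alpha> s u)"
        unfolding split_beta by (intro contH \<alpha> continuous_intros)
      then have "continuous_on {0..1} (\<lambda>s. integral (cbox (-1) 1) (H \<alpha> s))"
        by (rule integral_continuous_on_param)
      then show "continuous_on (cbox 0 1) (\<lambda>s. (1 - s) ^ (2 * m - 1) * integral (cbox (-1) 1) (H \<alpha> s))"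
        unfolding box_real by (intro continuous_intros)
    qed
    finally show ?thesis by (simp add: inner)
  qed
  have "integral (cbox (0, -1) (1, 1)) (\<lambda>(s, u). remainder_kernel m F s u)
      = integral (cbox (0, -1) (1, 1)) (\<lambda>x. \<Sum>\<alpha> | mi_norm \<alpha> = 2 * m. 1 / mi_fact \<alpha> * ?G \<alpha> x)"
    unfolding remainder_kernel_def H_def case_prod_unfold ..
  also have "\<dots> = (\<Sum>\<alpha> | mi_norm \<alpha> = 2 * m. integral (cbox (0, -1) (1, 1)) (\<lambda>x. 1 / mi_fact \<alpha> * ?G \<alpha> x))"
    using contG by (intro integral_sum integrable_continuous continuous_intros) (auto simp: finite_mi_norm)
  also have "\<dots> = (\<Sum>\<alpha> | mi_norm \<alpha> = 2 * m. 1 / mi_fact \<alpha> * integral (cbox (0, -1) (1, 1)) (?G \<alpha>))"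
    by simp
  also have "\<dots> = (\<Sum>\<alpha> | mi_norm \<alpha> = 2 * m. 1 / mi_fact \<alpha> * (LINT s : {0..1} | lborel. (1 - s) ^ (2 * m - 1) *
      (LINT u : {x. \<forall>r. x $ r \<in> {-1..1}} | lborel. H \<alpha> s u)))"
    by (intro sum.cong refl) (simp only: one mem_Collect_eq)
  finally show ?thesis
    by (simp add: remainder_functional_def H_def)
qed

lemma remainder_functional_sum:
  fixes G :: "'i \<Rightarrow> nat ^ 'n::finite \<Rightarrow> real ^ 'n \<Rightarrow> real"
  assumes "finite S" and G: "\<And>i \<alpha>. i \<in> S \<Longrightarrow> mi_norm \<alpha> = 2 * m \<Longrightarrow> continuous_on UNIV (G i \<alpha>)"
  shows "remainder_functional m (\<lambda>\<alpha> w. \<Sum>i\<in>S. c i * G i \<alpha> w) = (\<Sum>i\<in>S. c i * remainder_functional m (G i))"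
proof -
  have kernel: "remainder_kernel m (\<lambda>\<alpha> w. \<Sum>i\<in>S. c i * G i \<alpha> w) s u = (\<Sum>i\<in>S. c i * remainder_kernel m (G i) s u)" for s u
  proof -
    have "(\<Sum>i\<in>S. c i * remainder_kernel m (G i) s u)
        = (\<Sum>\<alpha> | mi_norm \<alpha> = 2 * m. \<Sum>i\<in>S. c i * (1 / mi_fact \<alpha> * ((1 - s) ^ (2 * m - 1) *
      (mi_power u \<alpha> * (\<Sum>j\<in>{1 .. vec m}. gamma_vec m j * mi_power (real_vec j) (\<alpha> + 1) *
               G i \<alpha> (\<chi> r. s * real (j $ r) * u $ r / 2))))))"
      unfolding remainder_kernel_def sum_distrib_left[of "c _"] by (rule sum.swap)
    also have "\<dots> = remainder_kernel m (\<lambda>\<alpha> w. \<Sum>i\<in>S. c i * G i \<alpha> w) s u"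
      unfolding remainder_kernel_def
    proof (rule sum.cong[OF refl])
      fix \<alpha> :: "nat ^ 'n"
      let ?d = "\<lambda>j :: nat ^ 'n. gamma_vec m j * mi_power (real_vec j) (\<alpha> + 1)"
      let ?w = "\<lambda>j :: nat ^ 'n. \<chi> r. s * real (j $ r) * u $ r / 2"
      have "(\<Sum>j\<in>{1 .. vec m}. ?d j * (\<Sum>i\<in>S. c i * G i \<alpha> (?w j))) = (\<Sum>i\<in>S. c i * (\<Sum>j\<in>{1 .. vec m}. ?d j * G i \<alpha> (?w j)))"
        unfolding sum_distrib_left by (subst sum.swap) (simp add: mult_ac)
      then show "(\<Sum>i\<in>S. c i * (1 / mi_fact \<alpha> * ((1 - s) ^ (2 * m - 1) * (mi_power u \<alpha> * (\<Sum>j\<in>{1 .. vec m}. ?d j * G i \<alpha> (?w j))))))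
          = 1 / mi_fact \<alpha> * ((1 - s) ^ (2 * m - 1) * (mi_power u \<alpha> * (\<Sum>j\<in>{1 .. vec m}. ?d j * (\<Sum>i\<in>S. c i * G i \<alpha> (?w j)))))"
        by (simp add: sum_distrib_left mult_ac)
    qed
    finally show ?thesis ..
  qed
  let ?C = "cbox (0, -1) (1, 1) :: (real \<times> (real ^ 'n)) set"
  have "integral ?C (\<lambda>(s, u). remainder_kernel m (\<lambda>\<alpha> w. \<Sum>i\<in>S. c i * G i \<alpha> w) s u)
      = integral ?C (\<lambda>x. \<Sum>i\<in>S. c i * (case x of (s, u) \<Rightarrow> remainder_kernel m (G i) s u))"
    unfolding case_prod_unfold kernel ..
  also have "\<dots> = (\<Sum>i\<in>S. integral ?C (\<lambda>x. c i * (case x of (s, u) \<Rightarrow> remainder_kernel m (G i) s u)))"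
    using assms by (intro integral_sum integrable_continuous continuous_intros continuous_on_remainder_kernel) auto
  also have "\<dots> = (\<Sum>i\<in>S. c i * integral ?C (\<lambda>(s, u). remainder_kernel m (G i) s u))"
    by simp
  finally have eq: "integral ?C (\<lambda>(s, u). remainder_kernel m (\<lambda>\<alpha> w. \<Sum>i\<in>S. c i * G i \<alpha> w) s u)
      = (\<Sum>i\<in>S. c i * integral ?C (\<lambda>(s, u). remainder_kernel m (G i) s u))" .
  have "remainder_functional m (\<lambda>\<alpha> w. \<Sum>i\<in>S. c i * G i \<alpha> w)
     = real m / 2 ^ (2 * m + CARD('n) - 1) * (\<Sum>i\<in>S. c i * integral ?C (\<lambda>(s, u). remainder_kernel m (G i) s u))"
    unfolding eq[symmetric] using G by (intro remainder_functional_eq_integral continuous_intros) auto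
  also have "\<dots> = (\<Sum>i\<in>S. c i * (real m / 2 ^ (2 * m + CARD('n) - 1) * integral ?C (\<lambda>(s, u). remainder_kernel m (G i) s u)))"
    by (simp add: sum_distrib_left mult_ac)
  also have "\<dots> = (\<Sum>i\<in>S. c i * remainder_functional m (G i))"
    using G by (intro sum.cong refl arg_cong2[of _ _ _ _ "(*)"] remainder_functional_eq_integral[symmetric]) auto
  finally show ?thesis .
qed

text \<open>With \<open>w = j u / 2\<close>, the integral over \<open>s\<close> inside the remainder functional is the remainder of Taylor's formula for
\<open>h (x + w)\<close>. After weighting and integrating over \<open>u\<close>, the Taylor polynomial contributes only its constant term.\<close>

lemma taylor_quadrature:
  fixes h :: "real ^ 'n::finite \<Rightarrow> real"
  assumes m: "1 \<le> m" and h: "cont_diff (2 * m) h"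
  shows "h x = (\<Sum>j\<in>{1..vec m}. gamma_vec m j * mi_power (real_vec j) 1 / 2 ^ CARD('n) *
        integral (cbox (-1) 1) (\<lambda>u. h (x + (\<chi> r. real (j $ r) * u $ r / 2))))
     - remainder_functional m (\<lambda>\<alpha> w. mixed_partial \<alpha> h (x + w))"
proof -
  let ?p = "CARD('n)"
  define w where "w j u = (\<chi> r. real (j $ r) * u $ r / 2)" for j :: "nat ^ 'n" and u :: "real ^ 'n"
  define g where "g j = gamma_vec m j * mi_power (real_vec j) 1" for j :: "nat ^ 'n"
  define T where "T j u = (\<Sum>k<2 * m. \<Sum>\<alpha> | mi_norm \<alpha> = k. mi_power (w j u) \<alpha> * mixed_partial \<alpha> h x / mi_fact \<alpha>)" for j u
  let ?F = "\<lambda>\<alpha> w. mixed_partial \<alpha> h (x + w)"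
  let ?I = "\<lambda>j. integral (cbox (-1) 1) (\<lambda>u. h (x + w j u))"
  let ?c = "\<lambda>j k \<alpha>. mi_power (real_vec j) \<alpha> * (mixed_partial \<alpha> h x / mi_fact \<alpha> / 2 ^ k * integral (cbox (-1) 1) (\<lambda>u. mi_power u \<alpha>))"
  let ?r = "\<lambda>j s u. \<Sum>\<alpha> | mi_norm \<alpha> = 2 * m. mi_power (w j u) \<alpha> * mixed_partial \<alpha> h (x + s *\<^sub>R w j u) / mi_fact \<alpha>"
  have conth: "continuous_on S (\<lambda>u. h (f u))" if "continuous_on S f" for S and f :: "real ^ 'n \<Rightarrow> real ^ 'n"
    using cont_diff_imp_continuous[OF h] that by (rule continuous_on_compose2) auto
  have contw: "continuous_on S (w j)" for S j
    unfolding w_def by (intro continuous_intros) auto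
  have contd: "continuous_on UNIV (mixed_partial \<alpha> h)" if "mi_norm \<alpha> = 2 * m" for \<alpha> :: "nat ^ 'n"
    using cont_diff_mixed_partial[of 0 \<alpha> h] h that by simp
  have contF: "continuous_on UNIV (?F \<alpha>)" if "mi_norm \<alpha> = 2 * m" for \<alpha> :: "nat ^ 'n"
    by (intro continuous_on_compose2[OF contd[OF that]] continuous_intros) auto
  have contT: "continuous_on S (T j)" for S j
    unfolding T_def by (intro continuous_intros contw) (auto simp: mi_fact_pos less_imp_neq[OF mi_fact_pos, symmetric])
  have kernel: "remainder_kernel m ?F s u = (\<Sum>j\<in>{1..vec m}. g j * 2 ^ (2 * m) * ((1 - s) ^ (2 * m - 1) *
      ?r j s u))" for s u
  proof -
    have sw: "(\<chi> r. s * real (j $ r) * u $ r / 2) = s *\<^sub>R w j u" for j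
      by (simp add: w_def vec_eq_iff)
    have "remainder_kernel m ?F s u = (\<Sum>\<alpha> | mi_norm \<alpha> = 2 * m. \<Sum>j\<in>{1..vec m}. g j * 2 ^ (2 * m) * ((1 - s) ^ (2 * m - 1) *
        (mi_power (w j u) \<alpha> * mixed_partial \<alpha> h (x + s *\<^sub>R w j u) / mi_fact \<alpha>)))"
      unfolding remainder_kernel_def sw sum_distrib_left
      by (intro sum.cong refl) (simp add: w_def g_def mi_power_half_scaled mi_power_add)
    then show ?thesis
      by (subst (asm) sum.swap) (simp add: sum_distrib_left)
  qed
  have inner: "integral (cbox 0 1) (\<lambda>s. remainder_kernel m ?F s u)
      = (\<Sum>j\<in>{1..vec m}. g j * 2 ^ (2 * m) / (2 * real m) * (h (x + w j u) - T j u))" for u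
  proof -
    have t: "integral (cbox 0 1) (\<lambda>s. (1 - s) ^ (2 * m - 1) *
        ?r j s u)
        = (h (x + w j u) - T j u) / (2 * real m)" for j
      using taylor_integral_remainder[OF h, of x "w j u"] m by (simp add: T_def field_simps)
    have "integral (cbox 0 1) (\<lambda>s. remainder_kernel m ?F s u)
        = (\<Sum>j\<in>{1..vec m}. integral (cbox 0 1) (\<lambda>s. g j * 2 ^ (2 * m) * ((1 - s) ^ (2 * m - 1) *
      ?r j s u)))"
      unfolding kernel
      by (intro integral_sum integrable_continuous continuous_intros continuous_on_compose2[OF contd])
        (auto simp: less_imp_neq[OF mi_fact_pos, symmetric])
    also have "\<dots> = (\<Sum>j\<in>{1..vec m}. g j * 2 ^ (2 * m) / (2 * real m) * (h (x + w j u) - T j u))"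
      by (intro sum.cong refl) (simp only: integral_mult_right t, simp)
    finally show ?thesis .
  qed
  have sumT: "(\<Sum>j\<in>{1..vec m}. g j * integral (cbox (-1) 1) (T j)) = 2 ^ ?p * h x"
  proof -
    have iT: "integral (cbox (-1) 1) (T j) = (\<Sum>k<2 * m. \<Sum>\<alpha> | mi_norm \<alpha> = k.
        ?c j k \<alpha>)" for j
    proof -
      have "integral (cbox (-1) 1) (T j) = (\<Sum>k<2 * m. integral (cbox (-1) 1) (\<lambda>u. \<Sum>\<alpha> | mi_norm \<alpha> = k.
        mi_power (w j u) \<alpha> * mixed_partial \<alpha> h x / mi_fact \<alpha>))"
        unfolding T_def
        by (intro integral_sum integrable_continuous continuous_intros contw) (auto simp: less_imp_neq[OF mi_fact_pos, symmetric])
      also have "\<dots> = (\<Sum>k<2 * m. \<Sum>\<alpha> | mi_norm \<alpha> = k. integral (cbox (-1) 1) (\<lambda>u.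
        mi_power (w j u) \<alpha> * mixed_partial \<alpha> h x / mi_fact \<alpha>))"
        by (rule sum.cong[OF refl], rule integral_sum)
           (auto simp: finite_mi_norm less_imp_neq[OF mi_fact_pos, symmetric] intro!: integrable_continuous continuous_intros contw)
      also have "\<dots> = (\<Sum>k<2 * m. \<Sum>\<alpha> | mi_norm \<alpha> = k.
        ?c j k \<alpha>)"
      proof (rule sum.cong[OF refl], rule sum.cong[OF refl])
        fix k \<alpha> assume "\<alpha> \<in> {\<alpha> :: nat ^ 'n. mi_norm \<alpha> = k}"
        then have k: "mi_norm \<alpha> = k" by simp
        have "(\<lambda>u. mi_power (w j u) \<alpha> * mixed_partial \<alpha> h x / mi_fact \<alpha>)
            = (\<lambda>u. (mi_power (real_vec j) \<alpha> * (mixed_partial \<alpha> h x / mi_fact \<alpha> / 2 ^ k)) * mi_power u \<alpha>)"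
          unfolding w_def mi_power_half_scaled k by (simp add: mult_ac)
        then show "integral (cbox (-1) 1) (\<lambda>u. mi_power (w j u) \<alpha> * mixed_partial \<alpha> h x / mi_fact \<alpha>)
          = ?c j k \<alpha>"
          by (simp only: integral_mult_right mult.assoc)
      qed
      finally show ?thesis .
    qed
    have "(\<Sum>j\<in>{1..vec m}. g j * integral (cbox (-1) 1) (T j)) = (\<Sum>k<2 * m. \<Sum>j\<in>{1..vec m}. \<Sum>\<alpha> | mi_norm \<alpha> = k.
        g j * ?c j k \<alpha>)"
      unfolding iT sum_distrib_left by (rule sum.swap)
    also have "\<dots> = (\<Sum>k<2 * m. \<Sum>\<alpha> | mi_norm \<alpha> = k. \<Sum>j\<in>{1..vec m}.
        g j * ?c j k \<alpha>)"
      by (rule sum.cong[OF refl]) (rule sum.swap)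
    also have "\<dots> = (\<Sum>k<2 * m. \<Sum>\<alpha> | mi_norm \<alpha> = k. if \<alpha> = (0 :: nat ^ 'n) then 2 ^ ?p * h x else 0)"
    proof (rule sum.cong[OF refl], rule sum.cong[OF refl])
      fix k \<alpha> assume "k \<in> {..<2 * m}" "\<alpha> \<in> {\<alpha> :: nat ^ 'n. mi_norm \<alpha> = k}"
      then have k: "mi_norm \<alpha> < 2 * m" "mi_norm \<alpha> = k" by auto
      have "(\<Sum>j\<in>{1..vec m}. g j * ?c j k \<alpha>)
        = mixed_partial \<alpha> h x / mi_fact \<alpha> / 2 ^ k * ((\<Sum>j\<in>{1..vec m}. gamma_vec m j * mi_power (real_vec j) (\<alpha> + 1)) * integral (cbox (-1) 1) (\<lambda>u. mi_power u \<alpha>))"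
        unfolding sum_distrib_left sum_distrib_right
        by (intro sum.cong refl) (simp add: g_def mi_power_add mult_ac)
      also have "\<dots> = (if \<alpha> = 0 then 2 ^ ?p * h x else 0)"
        unfolding gamma_vec_moment[OF k(1)] using k(2) cont_diff_imp_continuous[OF h]
        by (auto simp: mi_fact_def mi_norm_def)
      finally show "(\<Sum>j\<in>{1..vec m}. g j * ?c j k \<alpha>)
        = (if \<alpha> = 0 then 2 ^ ?p * h x else 0)" .
    qed
    also have "\<dots> = (\<Sum>k<2 * m. if k = 0 then 2 ^ ?p * h x else 0)"
    proof (rule sum.cong[OF refl])
      fix k
      have "(\<Sum>\<alpha> | mi_norm \<alpha> = k. if \<alpha> = (0 :: nat ^ 'n) then 2 ^ ?p * h x else 0)
          = (if (0 :: nat ^ 'n) \<in> {\<alpha>. mi_norm \<alpha> = k} then 2 ^ ?p * h x else 0)"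
        by (rule sum.delta) (rule finite_mi_norm)
      then show "(\<Sum>\<alpha> | mi_norm \<alpha> = k. if \<alpha> = (0 :: nat ^ 'n) then 2 ^ ?p * h x else 0) = (if k = 0 then 2 ^ ?p * h x else 0)"
        by (simp add: mi_norm_def)
    qed
    also have "\<dots> = 2 ^ ?p * h x" using m by simp
    finally show ?thesis .
  qed
  have "integral (cbox (0, -1) (1, 1)) (\<lambda>(s, u). remainder_kernel m ?F s u)
      = integral (cbox (-1) 1) (\<lambda>u. integral (cbox 0 1) (\<lambda>s. remainder_kernel m ?F s u))"
  proof -
    note cont = continuous_on_remainder_kernel[OF contF]
    have "integral (cbox (0, -1) (1, 1)) (\<lambda>(s, u). remainder_kernel m ?F s u)
        = integral (cbox 0 1) (\<lambda>s. integral (cbox (-1) 1) (\<lambda>u. remainder_kernel m ?F s u))"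
      by (subst integral_prod_continuous[OF cont]) simp_all
    also have "\<dots> = integral (cbox (-1) 1) (\<lambda>u. integral (cbox 0 1) (\<lambda>s. remainder_kernel m ?F s u))"
      by (rule integral_swap_continuous[OF cont]) simp
    finally show ?thesis .
  qed
  also have "\<dots> = (\<Sum>j\<in>{1..vec m}. integral (cbox (-1) 1) (\<lambda>u. g j * 2 ^ (2 * m) / (2 * real m) * (h (x + w j u) - T j u)))"
    unfolding inner by (intro integral_sum integrable_continuous continuous_intros contT conth contw) auto
  also have "\<dots> = (\<Sum>j\<in>{1..vec m}. g j * 2 ^ (2 * m) / (2 * real m) * (?I j - integral (cbox (-1) 1) (T j)))"
  proof (rule sum.cong[OF refl])
    fix j
    have "integral (cbox (-1) 1) (\<lambda>u. h (x + w j u) - T j u) = ?I j - integral (cbox (-1) 1) (T j)"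
      by (intro Henstock_Kurzweil_Integration.integral_diff integrable_continuous continuous_intros contT conth contw)
    then show "integral (cbox (-1) 1) (\<lambda>u. g j * 2 ^ (2 * m) / (2 * real m) * (h (x + w j u) - T j u))
        = g j * 2 ^ (2 * m) / (2 * real m) * (?I j - integral (cbox (-1) 1) (T j))"
      by (simp only: integral_mult_right)
  qed
  also have "\<dots> = 2 ^ (2 * m) / (2 * real m) * ((\<Sum>j\<in>{1..vec m}. g j * ?I j) - 2 ^ ?p * h x)"
    unfolding sumT[symmetric] sum_subtractf[symmetric] sum_distrib_left
    by (intro sum.cong refl) (simp add: field_simps)
  finally have I: "integral (cbox (0, -1) (1, 1)) (\<lambda>(s, u). remainder_kernel m ?F s u)
      = 2 ^ (2 * m) / (2 * real m) * ((\<Sum>j\<in>{1..vec m}. g j * ?I j) - 2 ^ ?p * h x)" .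
  have pow: "(2::real) ^ (2 * m + ?p - 1) * 2 = 2 ^ (2 * m) * 2 ^ ?p"
    using m by (simp flip: power_add power_Suc2)
  have "remainder_functional m ?F = ((\<Sum>j\<in>{1..vec m}. g j * ?I j) - 2 ^ ?p * h x) / 2 ^ ?p"
  proof -
    have "remainder_functional m ?F = real m / 2 ^ (2 * m + ?p - 1) * integral (cbox (0, -1) (1, 1)) (\<lambda>(s, u). remainder_kernel m ?F s u)"
      by (rule remainder_functional_eq_integral) (rule contF)
    also have "\<dots> = real m * 2 ^ (2 * m) / (2 * real m * 2 ^ (2 * m + ?p - 1)) * ((\<Sum>j\<in>{1..vec m}. g j * ?I j) - 2 ^ ?p * h x)"
      unfolding I by simp
    also have "real m * 2 ^ (2 * m) / (2 * real m * 2 ^ (2 * m + ?p - 1)) = 1 / 2 ^ ?p"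
    proof -
      have "2 * real m * 2 ^ (2 * m + ?p - 1) = real m * (2 ^ (2 * m) * 2 ^ ?p)"
        unfolding pow[symmetric] by simp
      then show ?thesis using m by simp
    qed
    finally show ?thesis by simp
  qed
  then show ?thesis
    by (simp add: g_def w_def sum_divide_distrib diff_divide_distrib)
qed

section \<open>From cube averages at lattice points to integrals over orthants\<close>

lemma AE_half_integers_avoided:
  "AE y in (lborel :: (real ^ 'n::finite) measure). \<forall>r. 2 * y $ r \<notin> \<int>"
proof -
  have hyperplane: "AE y in (lborel :: (real ^ 'n) measure). y $ r \<noteq> c" for r c
  proof -
    have "negligible {y :: real ^ 'n. y $ r = c}"
      using negligible_standard_hyperplane[of "axis r 1 :: real ^ 'n" c] by (simp add: inner_axis)
    then have "{y :: real ^ 'n. y $ r = c} \<in> null_sets lebesgue"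
      by (simp only: negligible_iff_null_sets)
    then have "AE y in (lebesgue :: (real ^ 'n) measure). y \<notin> {y. y $ r = c}"
      by (rule AE_not_in)
    then show ?thesis by (simp add: AE_completion_iff)
  qed
  have "AE y in (lborel :: (real ^ 'n) measure). \<forall>n::int. y $ r \<noteq> real_of_int n / 2" for r
    by (subst AE_all_countable) (intro allI hyperplane)
  then have "AE y in (lborel :: (real ^ 'n) measure). \<forall>r\<in>UNIV. \<forall>n::int. y $ r \<noteq> real_of_int n / 2"
    by (intro AE_finite_allI) auto
  then show ?thesis
  proof (rule AE_mp, intro AE_I2 impI allI)
    fix y :: "real ^ 'n" and r assume "\<forall>r\<in>UNIV. \<forall>n::int. y $ r \<noteq> real_of_int n / 2"
    then show "2 * y $ r \<notin> \<int>" by (auto elim!: Ints_cases simp: field_simps)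
  qed
qed

lemma integrable_weighted:
  fixes g :: "'a::euclidean_space \<Rightarrow> real"
  assumes g: "integrable lborel g" and [measurable]: "W \<in> borel_measurable borel" and W: "\<And>y. \<bar>W y\<bar> \<le> 1"
  shows "integrable lborel (\<lambda>y. W y * g y)"
proof (rule Bochner_Integration.integrable_bound[OF g])
  have [measurable]: "g \<in> borel_measurable borel"
    using borel_measurable_integrable[OF g] by simp
  show "(\<lambda>y. W y * g y) \<in> borel_measurable lborel" by simp
  show "AE y in lborel. norm (W y * g y) \<le> norm (g y)"
    using W by (intro AE_I2) (simp add: abs_mult mult_left_le_one_le)
qed

lemma integrable_bounded_support:
  fixes g :: "real ^ 'n::finite \<Rightarrow> real"
  assumes "continuous_on UNIV g" "\<And>y r. g y \<noteq> 0 \<Longrightarrow> \<bar>y $ r\<bar> \<le> R"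
  shows "integrable lborel g"
proof -
  have "integrable lborel (\<lambda>y. indicator (cbox (vec (- R)) (vec R)) y *\<^sub>R g y)"
    using assms(1) by (intro borel_integrable_compact) (auto intro: continuous_on_subset)
  moreover have "indicator (cbox (vec (- R)) (vec R)) y *\<^sub>R g y = g y" for y
    using assms(2)[of y] by (auto simp: indicator_def mem_box_cart abs_le_iff minus_le_iff) 
  ultimately show ?thesis by (simp only:)
qed

text \<open>The factor in front of the integral is the Jacobian of \<open>u \<mapsto> x + j u / 2\<close>, so the weighted average over the cube is the
integral of \<open>g\<close> over the box with centre \<open>x\<close> and side lengths \<open>j\<close>.\<close>

lemma integral_cube_scaled:
  fixes g :: "real ^ 'n::finite \<Rightarrow> real" and j :: "nat ^ 'n"
  assumes g: "continuous_on UNIV g" and j: "1 \<le> j"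
  shows "mi_power (real_vec j) 1 / 2 ^ CARD('n) * integral (cbox (-1) 1) (\<lambda>u. g (x + (\<chi> r. real (j $ r) * u $ r / 2)))
    = (\<integral>y. (\<Prod>r\<in>UNIV. of_bool (\<bar>y $ r - x $ r\<bar> \<le> real (j $ r) / 2)) * g y \<partial>lborel)"
proof -
  let ?f = "\<lambda>y. (\<Prod>r\<in>UNIV. of_bool (\<bar>y $ r - x $ r\<bar> \<le> real (j $ r) / 2)) * g y"
  let ?c = "\<lambda>r. real (j $ r) / 2"
  have jpos: "0 < real (j $ r)" for r
    using j by (auto simp: less_eq_vec_def Suc_le_eq)
  have [measurable]: "g \<in> borel_measurable borel"
    using g by (rule borel_measurable_continuous_onI)
  have "(\<integral>y. ?f y \<partial>lborel) = (\<Prod>r\<in>UNIV. \<bar>?c r\<bar>) * (\<integral>u. ?f (x + (\<chi> r. ?c r * u $ r)) \<partial>lborel)"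
    using jpos by (intro integral_diagonal_affine) auto
  also have "(\<Prod>r\<in>UNIV. \<bar>?c r\<bar>) = mi_power (real_vec j) 1 / 2 ^ CARD('n)"
    by (simp add: mi_power_def real_vec_def prod_dividef)
  also have "(\<lambda>u. ?f (x + (\<chi> r. ?c r * u $ r))) = (\<lambda>u. indicator (cbox (-1) 1) u *\<^sub>R g (x + (\<chi> r. real (j $ r) * u $ r / 2)))"
  proof
    fix u :: "real ^ 'n"
    have "\<bar>real (j $ r) * u $ r / 2\<bar> \<le> real (j $ r) / 2 \<longleftrightarrow> -1 \<le> u $ r \<and> u $ r \<le> 1" for r
      using jpos[of r] by (auto simp: abs_mult abs_le_iff)
    then have "(\<Prod>r\<in>UNIV. of_bool (\<bar>(x + (\<chi> r. ?c r * u $ r)) $ r - x $ r\<bar> \<le> real (j $ r) / 2)) = indicat_real (cbox (-1) 1) u"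
      by (auto simp: indicator_def mem_box_cart)
    then show "?f (x + (\<chi> r. ?c r * u $ r)) = indicator (cbox (-1) 1) u *\<^sub>R g (x + (\<chi> r. real (j $ r) * u $ r / 2))"
      by simp
  qed
  also have "(\<integral>u. indicator (cbox (-1) 1) u *\<^sub>R g (x + (\<chi> r. real (j $ r) * u $ r / 2)) \<partial>lborel)
      = integral (cbox (-1) 1) (\<lambda>u. g (x + (\<chi> r. real (j $ r) * u $ r / 2)))"
    unfolding set_lebesgue_integral_def[symmetric]
    by (intro set_integral_cbox continuous_on_compose2[OF g] continuous_intros) auto
  finally show ?thesis ..
qed

definition shifted_orthant :: "'n set \<Rightarrow> int ^ 'n::finite \<Rightarrow> (real ^ 'n) set" where
  "shifted_orthant J \<beta> = (\<lambda>x. x + (\<chi> r. one_on J $ r - (1 + real_of_int (\<beta> $ r)) / 2)) ` pos_orthant J"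

lemma mem_shifted_orthant:
  "y \<in> shifted_orthant J \<beta> \<longleftrightarrow> (\<forall>r. if r \<in> J then 0 < y $ r - one_on J $ r + (1 + real_of_int (\<beta> $ r)) / 2
     else 0 \<le> y $ r - one_on J $ r + (1 + real_of_int (\<beta> $ r)) / 2)"
proof -
  let ?w = "(\<chi> r. one_on J $ r - (1 + real_of_int (\<beta> $ r)) / 2) :: real ^ 'a"
  have "y \<in> shifted_orthant J \<beta> \<longleftrightarrow> y - ?w \<in> pos_orthant J"
    unfolding shifted_orthant_def by (auto intro: rev_image_eqI)
  also have "\<dots> \<longleftrightarrow> (\<forall>r. if r \<in> J then 0 < y $ r - one_on J $ r + (1 + real_of_int (\<beta> $ r)) / 2
     else 0 \<le> y $ r - one_on J $ r + (1 + real_of_int (\<beta> $ r)) / 2)"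
    unfolding pos_orthant_def by (simp add: algebra_simps)
  finally show ?thesis .
qed

lemma shifted_orthant_borel [measurable]: "shifted_orthant J \<beta> \<in> sets borel"
proof -
  have "shifted_orthant J \<beta> = {y. \<forall>r. if r \<in> J then 0 < y $ r - one_on J $ r + (1 + real_of_int (\<beta> $ r)) / 2
     else 0 \<le> y $ r - one_on J $ r + (1 + real_of_int (\<beta> $ r)) / 2}"
    using mem_shifted_orthant by blast
  also have "\<dots> \<in> sets borel" by measurable
  finally show ?thesis .
qed

text \<open>The indicator functions on both sides agree away from the null set of points with a half-integer coordinate, where
\<open>orthant_decomposition\<close> applies to \<open>y - one_on J\<close>. On the complement of this null set it is immaterial which faces of
an orthant are open.\<close>

lemma cube_averages_sum_eq_orthant_integrals:
  fixes g :: "real ^ 'n::finite \<Rightarrow> real"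
  assumes m: "1 \<le> m" and g: "continuous_on UNIV g"
    and supp: "\<And>y r. g y \<noteq> 0 \<Longrightarrow> \<bar>y $ r\<bar> \<le> R" and N: "R + real m / 2 \<le> real N"
  shows "(\<Sum>k\<in>{0..vec N}. \<Sum>j\<in>{1..vec m}. gamma_vec m j * mi_power (real_vec j) 1 / 2 ^ CARD('n) *
        integral (cbox (-1) 1) (\<lambda>u. g (real_vec k + one_on J + (\<chi> r. real (j $ r) * u $ r / 2))))
    = (\<Sum>\<beta>\<in>{vec (1 - int m)..vec (int m - 1)}. tau_vec m (\<chi> r. 1 + nat \<bar>\<beta> $ r\<bar>) * (LINT y : shifted_orthant J \<beta> | lborel. g y))"
proof -
  let ?Q = "\<lambda>k j. gamma_vec m j * mi_power (real_vec j) 1 / 2 ^ CARD('n) *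
        integral (cbox (-1) 1) (\<lambda>u. g (real_vec k + one_on J + (\<chi> r. real (j $ r) * u $ r / 2)))"
  let ?B = "{vec (1 - int m)..vec (int m - 1)} :: (int ^ 'n) set"
  let ?\<tau> = "\<lambda>\<beta> :: int ^ 'n. tau_vec m (\<chi> r. 1 + nat \<bar>\<beta> $ r\<bar>)"
  \<comment> \<open>The indicator of the box with centre \<open>k + one_on J\<close> and side lengths \<open>j\<close>.\<close>
  define W where "W j k y = (\<Prod>r\<in>UNIV. of_bool (\<bar>y $ r - (real_vec k + one_on J) $ r\<bar> \<le> real (j $ r) / 2) :: real)"
    for j k :: "nat ^ 'n" and y :: "real ^ 'n"
  let ?l = "\<lambda>y. \<Sum>k\<in>{0..vec N}. \<Sum>j\<in>{1..vec m}. gamma_vec m j * (W j k y * g y)"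
  let ?r = "\<lambda>y. \<Sum>\<beta>\<in>?B. ?\<tau> \<beta> * (indicat_real (shifted_orthant J \<beta>) y * g y)"
  have gi: "integrable lborel g" using g supp by (rule integrable_bounded_support)
  have Wm: "W j k \<in> borel_measurable borel" for j k
    unfolding W_def by measurable
  have W1: "\<bar>W j k y\<bar> \<le> 1" for j k y
    unfolding W_def by (simp add: abs_prod prod_le_1)
  have Wi: "integrable lborel (\<lambda>y. W j k y * g y)" for j k
    by (rule integrable_weighted[OF gi Wm W1])
  have Oi: "integrable lborel (\<lambda>y. indicat_real (shifted_orthant J \<beta>) y * g y)" for \<beta>
    by (rule integrable_weighted[OF gi]) (auto simp: indicator_def)
  have "(\<Sum>k\<in>{0..vec N}. \<Sum>j\<in>{1..vec m}. ?Q k j)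
      = (\<Sum>k\<in>{0..vec N}. \<Sum>j\<in>{1..vec m}. gamma_vec m j * (\<integral>y. W j k y * g y \<partial>lborel))"
  proof (rule sum.cong[OF refl], rule sum.cong[OF refl])
    fix k j :: "nat ^ 'n" assume "j \<in> {1..vec m}"
    then have j: "1 \<le> j" by simp
    show "?Q k j
      = gamma_vec m j * (\<integral>y. W j k y * g y \<partial>lborel)"
      unfolding W_def integral_cube_scaled[OF g j, symmetric] by simp
  qed
  also have "\<dots> = (\<Sum>k\<in>{0..vec N}. \<integral>y. (\<Sum>j\<in>{1..vec m}. gamma_vec m j * (W j k y * g y)) \<partial>lborel)"
    using Wi by (intro sum.cong refl) (subst Bochner_Integration.integral_sum, auto)
  also have "\<dots> = (\<integral>y. ?l y \<partial>lborel)"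
    using Wi by (intro Bochner_Integration.integral_sum[symmetric] Bochner_Integration.integrable_sum) auto
  also have "\<dots> = (\<integral>y. ?r y \<partial>lborel)"
  proof (rule integral_cong_AE)
    show "AE y in lborel. ?l y
        = ?r y"
      using AE_half_integers_avoided
    proof (rule AE_mp, intro AE_I2 impI)
      fix y :: "real ^ 'n" assume y: "\<forall>r. 2 * y $ r \<notin> \<int>"
      show "?l y
        = ?r y"
      proof (cases "g y = 0")
        case False
        define z where "z = y - one_on J"
        have z: "2 * z $ r \<notin> \<int>" for r
        proof
          assume "2 * z $ r \<in> \<int>"
          moreover have "2 * one_on J $ r \<in> \<int>" by (simp add: one_on_def)
          ultimately have "2 * z $ r + 2 * one_on J $ r \<in> \<int>" by (rule Ints_add)
          then show False using y by (simp add: z_def)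
        qed
        have half: "z $ r + (1 + real_of_int b) / 2 \<noteq> 0" "\<bar>z $ r - real k\<bar> \<noteq> real l / 2" for r b k l
        proof -
          have ne: "2 * z $ r \<noteq> of_int c" for c using z[of r] by (metis Ints_of_int)
          show "z $ r + (1 + real_of_int b) / 2 \<noteq> 0"
            using ne[of "- 1 - b"] by (auto simp: add_divide_distrib)
          show "\<bar>z $ r - real k\<bar> \<noteq> real l / 2"
            using ne[of "int l + 2 * int k"] ne[of "2 * int k - int l"] by (auto simp: abs_if)
        qed
        have zN: "z $ r + real m / 2 \<le> real N" for r
        proof -
          have "0 \<le> one_on J $ r" by (simp add: one_on_def)
          then have "z $ r \<le> R" using supp[OF False, of r] by (simp add: z_def)
          then show ?thesis using N by simp
        qed
        have Wz: "W j k y = (\<Prod>r\<in>UNIV. of_bool (\<bar>z $ r - real (k $ r)\<bar> < real (j $ r) / 2))" for j k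
          unfolding W_def
        proof (intro prod.cong refl arg_cong[of _ _ of_bool])
          fix r
          have "y $ r - (real_vec k + one_on J) $ r = z $ r - real (k $ r)"
            by (simp add: z_def real_vec_def)
          moreover have "\<bar>z $ r - real (k $ r)\<bar> \<noteq> real (j $ r) / 2"
            by (rule half)
          ultimately show "(\<bar>y $ r - (real_vec k + one_on J) $ r\<bar> \<le> real (j $ r) / 2) = (\<bar>z $ r - real (k $ r)\<bar> < real (j $ r) / 2)"
            by auto
        qed
        have Oz: "indicat_real (shifted_orthant J \<beta>) y = (\<Prod>r\<in>UNIV. of_bool (0 < z $ r + (1 + real_of_int (\<beta> $ r)) / 2))" for \<beta>
        proof -
          have "y \<in> shifted_orthant J \<beta> \<longleftrightarrow> (\<forall>r. 0 < z $ r + (1 + real_of_int (\<beta> $ r)) / 2)"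
            unfolding mem_shifted_orthant
          proof (intro all_cong1)
            fix r
            show "(if r \<in> J then 0 < y $ r - one_on J $ r + (1 + real_of_int (\<beta> $ r)) / 2
              else 0 \<le> y $ r - one_on J $ r + (1 + real_of_int (\<beta> $ r)) / 2) = (0 < z $ r + (1 + real_of_int (\<beta> $ r)) / 2)"
              using half(1)[of r "\<beta> $ r"] by (auto simp: z_def)
          qed
          then show ?thesis by (auto simp: indicator_def)
        qed
        have "?l y
            = (\<Sum>j\<in>{1..vec m}. gamma_vec m j * (\<Sum>k\<in>{0..vec N}. W j k y)) * g y"
          by (subst sum.swap) (simp add: sum_distrib_left sum_distrib_right mult_ac)
        also have "\<dots> = (\<Sum>\<beta>\<in>?B. ?\<tau> \<beta> * indicat_real (shifted_orthant J \<beta>) y) * g y"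
          unfolding Wz Oz using orthant_decomposition[OF m z zN] by simp
        finally show ?thesis by (simp only: sum_distrib_right mult.assoc)
      qed simp
    qed
  qed (use Wi Oi in \<open>auto intro!: borel_measurable_sum borel_measurable_times dest: borel_measurable_integrable\<close>)
  also have "\<dots> = (\<Sum>\<beta>\<in>?B. ?\<tau> \<beta> * (LINT y : shifted_orthant J \<beta> | lborel. g y))"
    unfolding set_lebesgue_integral_def using Oi by (subst Bochner_Integration.integral_sum) auto
  finally show ?thesis .
qed

text \<open>If \<open>f\<close> is not integrable, the left-hand integral is zero by convention, while the right-hand one is nonnegative.\<close>

lemma set_integral_abs_bound:
  fixes f g :: "'a \<Rightarrow> real"
  assumes "set_integrable M S g" "\<And>x. x \<in> S \<Longrightarrow> \<bar>f x\<bar> \<le> g x"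
  shows "\<bar>LINT x : S | M. f x\<bar> \<le> (LINT x : S | M. g x)"
proof -
  have ge: "\<bar>indicator S x *\<^sub>R f x\<bar> \<le> indicator S x *\<^sub>R g x" for x
    using assms(2)[of x] by (auto simp: indicator_def)
  show ?thesis
  proof (cases "integrable M (\<lambda>x. indicator S x *\<^sub>R f x)")
    case True
    have "\<bar>LINT x : S | M. f x\<bar> \<le> (\<integral>x. \<bar>indicator S x *\<^sub>R f x\<bar> \<partial>M)"
      unfolding set_lebesgue_integral_def by (rule integral_abs_bound)
    also have "\<dots> \<le> (\<integral>x. indicator S x *\<^sub>R g x \<partial>M)"
      using True assms(1) ge unfolding set_integrable_def by (intro integral_mono) auto
    finally show ?thesis by (simp add: set_lebesgue_integral_def)
  next
    case False
    have "0 \<le> (\<integral>x. indicator S x *\<^sub>R g x \<partial>M)"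
      by (rule Bochner_Integration.integral_nonneg) (use ge in \<open>meson abs_ge_zero order_trans\<close>)
    then show ?thesis
      using False by (simp add: set_lebesgue_integral_def not_integrable_integral_eq)
  qed
qed

lemma integral_abs_power: "integral {-1..1} (\<lambda>y::real. \<bar>y\<bar> ^ n) = 2 / (real n + 1)"
proof -
  have "((\<lambda>y::real. \<bar>y\<bar> ^ n) has_integral (1 ^ Suc n / Suc n - 0 ^ Suc n / Suc n)) {0..1}"
  proof (rule has_integral_eq[OF _ fundamental_theorem_of_calculus])
    fix y :: real
    show "((\<lambda>y. y ^ Suc n / Suc n) has_vector_derivative y ^ n) (at y within {0..1})"
      using DERIV_cdivide[OF DERIV_pow[of "Suc n" y "{0..1}"], of "Suc n"]
      by (simp add: has_real_derivative_iff_has_vector_derivative[symmetric] del: power_Suc of_nat_Suc)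
  qed auto
  then have a: "((\<lambda>y::real. \<bar>y\<bar> ^ n) has_integral 1 / (real n + 1)) {0..1}" by (simp add: add.commute)
  then have b: "((\<lambda>y::real. \<bar>y\<bar> ^ n) has_integral 1 / (real n + 1)) {-1..0}"
    using has_integral_reflect_real[of "\<lambda>y::real. \<bar>y\<bar> ^ n" "1 / (real n + 1)" 1 0] by simp
  have "((\<lambda>y::real. \<bar>y\<bar> ^ n) has_integral (1 / (real n + 1) + 1 / (real n + 1))) {-1..1}"
    by (rule has_integral_combine[OF _ _ b a]) auto
  then show ?thesis by (simp add: integral_unique)
qed

text \<open>The integrand, cut off to the cube, is a product of functions of the single coordinates.\<close>

lemma integral_cube_coordinate_power:
  "integral (cbox (-1) 1) (\<lambda>u :: real ^ 'n::finite. \<bar>u $ q\<bar> ^ n) = 2 ^ CARD('n) / (real n + 1)"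
proof -
  define F where "F r y = indicat_real {-1..1} y * (if r = q then \<bar>y\<bar> ^ n else 1)" for r :: 'n and y :: real
  have [measurable]: "F r \<in> borel_measurable borel" for r unfolding F_def by measurable
  have F0: "0 \<le> F r y" for r y by (simp add: F_def)
  have F1: "(\<integral>\<^sup>+y. ennreal (F r y) \<partial>lborel) = ennreal (if r = q then 2 / (real n + 1) else 2)" for r
  proof -
    have c: "continuous_on {-1..1} (\<lambda>y::real. if r = q then \<bar>y\<bar> ^ n else 1)"
      by (cases "r = q") (auto intro!: continuous_intros)
    then have i: "set_integrable lborel {-1..1} (\<lambda>y. if r = q then \<bar>y\<bar> ^ n else 1 :: real)"
      using set_integral_cbox(1)[of "-1" 1 "\<lambda>y. if r = q then \<bar>y\<bar> ^ n else 1 :: real"] by simp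
    then have "integrable lborel (F r)" by (simp add: set_integrable_def F_def[abs_def])
    then have "(\<integral>\<^sup>+y. ennreal (F r y) \<partial>lborel) = ennreal (\<integral>y. F r y \<partial>lborel)"
      using F0 by (intro nn_integral_eq_integral) auto
    also have "(\<integral>y. F r y \<partial>lborel) = (LINT y : {-1..1} | lborel. if r = q then \<bar>y\<bar> ^ n else 1)"
      by (simp add: set_lebesgue_integral_def F_def[abs_def])
    also have "\<dots> = integral {-1..1} (\<lambda>y. if r = q then \<bar>y\<bar> ^ n else 1)"
      using i by (rule set_borel_integral_eq_integral)
    also have "\<dots> = (if r = q then 2 / (real n + 1) else 2)"
      by (simp add: integral_abs_power)
    finally show ?thesis .
  qed
  have prodF: "(\<Prod>r\<in>UNIV. F r (u $ r)) = indicator (cbox (-1) 1) u *\<^sub>R \<bar>u $ q\<bar> ^ n" for u :: "real ^ 'n"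
  proof -
    have "(\<Prod>r\<in>UNIV. F r (u $ r)) = (\<Prod>r\<in>UNIV. indicat_real {-1..1} (u $ r)) * (\<Prod>r\<in>UNIV. if r = q then \<bar>u $ r\<bar> ^ n else 1)"
      unfolding F_def by (rule prod.distrib)
    also have "(\<Prod>r\<in>UNIV. if r = q then \<bar>u $ r\<bar> ^ n else 1) = \<bar>u $ q\<bar> ^ n"
      by (simp add: prod.delta)
    also have "(\<Prod>r\<in>UNIV. indicat_real {-1..1} (u $ r)) = indicator (cbox (-1) 1) u"
      by (auto simp: indicator_def mem_box_cart)
    finally show ?thesis by simp
  qed
  have "(\<integral>\<^sup>+u. ennreal (\<Prod>r\<in>UNIV. F r (u $ r)) \<partial>(lborel :: (real ^ 'n) measure))
      = (\<integral>\<^sup>+u. (\<Prod>b\<in>Basis. ennreal (F (axis_index b) (u \<bullet> b))) \<partial>(lborel :: (real ^ 'n) measure))"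
    unfolding Basis_cart using F0
    by (subst prod.reindex[OF inj_axis_one]) (simp add: prod_ennreal inner_axis)
  also have "\<dots> = (\<Prod>b\<in>(Basis :: (real ^ 'n) set). (\<integral>\<^sup>+y. ennreal (F (axis_index b) y) \<partial>lborel))"
    by (rule nn_integral_lborel_prod) auto
  also have "\<dots> = (\<Prod>r\<in>UNIV. ennreal (if r = q then 2 / (real n + 1) else 2))"
    unfolding Basis_cart by (subst prod.reindex[OF inj_axis_one]) (simp add: F1)
  also have "\<dots> = ennreal (\<Prod>r\<in>UNIV. if r = q then 2 / (real n + 1) else 2)"
    by (rule prod_ennreal) simp
  also have "(\<Prod>r\<in>UNIV. if r = q then 2 / (real n + 1) else 2 :: real) = (\<Prod>r\<in>UNIV. 2 * (if r = q then 1 / (real n + 1) else 1))"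
    by (intro prod.cong) auto
  also have "\<dots> = 2 ^ CARD('n) / (real n + 1)"
    unfolding prod.distrib by (simp add: prod.delta)
  finally have "(\<integral>\<^sup>+u. ennreal (indicator (cbox (-1) 1) u *\<^sub>R \<bar>u $ q\<bar> ^ n) \<partial>(lborel :: (real ^ 'n) measure)) = ennreal (2 ^ CARD('n) / (real n + 1))"
    unfolding prodF .
  moreover have i: "integrable lborel (\<lambda>u :: real ^ 'n. indicator (cbox (-1) 1) u *\<^sub>R \<bar>u $ q\<bar> ^ n)"
    by (intro borel_integrable_compact continuous_intros) auto
  ultimately have "(\<integral>u. indicator (cbox (-1) 1) u *\<^sub>R \<bar>u $ q\<bar> ^ n \<partial>(lborel :: (real ^ 'n) measure)) = 2 ^ CARD('n) / (real n + 1)"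
    by (subst integral_eq_nn_integral) auto
  then show ?thesis
    using set_integral_cbox(2)[of "-1" 1 "\<lambda>u :: real ^ 'n. \<bar>u $ q\<bar> ^ n"]
    by (simp add: set_lebesgue_integral_def continuous_intros)
qed

section \<open>The bound on the remainder\<close>

lemma set_integral_one_minus_power: "(LINT s : {0..1} | lborel. (1 - s) ^ n) = 1 / (real n + 1)"
proof -
  let ?F = "\<lambda>s :: real. - ((1 - s) ^ Suc n) / real (Suc n)"
  have "(LINT s | lborel. indicator {0..1} s *\<^sub>R (1 - s) ^ n) = ?F 1 - ?F 0"
  proof (rule integral_FTC_atLeastAtMost)
    fix x :: real
    have "(?F has_real_derivative (1 - x) ^ n) (at x within {0..1})"
      by (rule derivative_eq_intros refl | simp del: power_Suc of_nat_Suc)+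
    then show "(?F has_vector_derivative (1 - x) ^ n) (at x within {0..1})"
      by (simp only: has_real_derivative_iff_has_vector_derivative)
  qed (auto intro!: continuous_intros)
  then show ?thesis by (simp add: set_lebesgue_integral_def add.commute)
qed

lemma mi_power_nonneg: "(\<And>r. 0 \<le> x $ r) \<Longrightarrow> 0 \<le> mi_power x \<alpha>"
  unfolding mi_power_def by (intro prod_nonneg) auto

lemma abs_mi_power: "\<bar>mi_power u \<alpha>\<bar> = mi_power (\<chi> r. \<bar>u $ r\<bar>) \<alpha>"
  by (simp add: mi_power_def abs_prod power_abs)

text \<open>The sum factors over the coordinates; all factors but the one for \<open>q\<close> are equal.\<close>

lemma sum_gamma_vec_coordinate_power:
  "(\<Sum>j\<in>{1..vec m}. \<bar>gamma_vec m j\<bar> * mi_power (real_vec j) 1 * real (j $ (q :: 'n::finite)) ^ n)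
    = (\<Sum>j=1..m. \<bar>gamma_coeff m j\<bar> * real j * real j ^ n) * (\<Sum>j=1..m. \<bar>gamma_coeff m j\<bar> * real j) ^ (CARD('n) - 1)"
proof -
  let ?F = "\<lambda>r (y::nat). \<bar>gamma_coeff m y\<bar> * real y * (if r = q then real y ^ n else 1)"
  have "\<bar>gamma_vec m j\<bar> * mi_power (real_vec j) 1 * real (j $ q) ^ n = (\<Prod>r\<in>UNIV. ?F r (j $ r))" for j :: "nat ^ 'n"
    by (simp add: gamma_vec_def mi_power_def real_vec_def abs_prod prod.distrib prod.delta)
  then have "(\<Sum>j\<in>{1..vec m}. \<bar>gamma_vec m j\<bar> * mi_power (real_vec j) 1 * real (j $ q) ^ n)
      = (\<Prod>r\<in>UNIV. \<Sum>y=1..m. ?F r y)"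
    using sum_vec_box_prod[of 1 "vec m" ?F] by simp
  also have "\<dots> = (\<Sum>y=1..m. ?F q y) * (\<Prod>r\<in>UNIV - {q}. \<Sum>y=1..m. ?F r y)"
    by (rule prod.remove) auto
  also have "(\<Prod>r\<in>UNIV - {q}. \<Sum>y=1..m. ?F r y) = (\<Prod>r\<in>UNIV - {q}. \<Sum>y=1..m. \<bar>gamma_coeff m y\<bar> * real y)"
    by (intro prod.cong) auto
  finally show ?thesis by (simp add: card_Diff_singleton)
qed

lemma abs_offset_le:
  fixes u :: "real ^ 'n::finite"
  assumes s: "s \<in> {0..1}" and u: "\<forall>r. u $ r \<in> {-1..1}" and j: "j \<in> {1..vec m}"
  shows "\<bar>(\<chi> r. s * real (j $ r) * u $ r / 2) $ r\<bar> \<le> real m / 2"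
proof -
  have "\<bar>u $ r\<bar> \<le> 1" using u by (auto simp: abs_le_iff minus_le_iff)
  moreover have "j $ r \<le> m" using j by (auto simp: less_eq_vec_def)
  then have "s * real (j $ r) \<le> 1 * real m" using s by (intro mult_mono) auto
  ultimately have "s * real (j $ r) * \<bar>u $ r\<bar> \<le> real m * 1" using s by (intro mult_mono) auto
  then show ?thesis using s by (simp add: abs_mult)
qed

text \<open>The integrand for \<open>\<alpha>\<close> is bounded by \<open>E \<alpha>\<close>, in which \<open>M\<close> has replaced the values of \<open>F\<close>. The multinomial theorem and the power mean inequality bound
the sum over \<open>\<alpha>\<close> by \<open>H\<close>, a combination of powers of single coordinates, whose integral and
coefficient sums are known exactly. The product of \<open>T\<close> (one coordinate, high power) and \<open>S ^ (p - 1)\<close> (the other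
coordinates) is what produces the exponent \<open>(p + 1) / 2\<close> of \<open>pi m\<close>.\<close>

lemma remainder_functional_bound:
  fixes F :: "nat ^ 'n::finite \<Rightarrow> real ^ 'n \<Rightarrow> real"
  assumes m: "1 \<le> m"
    and F: "\<And>\<alpha> w. mi_norm \<alpha> = 2 * m \<Longrightarrow> (\<forall>r. \<bar>w $ r\<bar> \<le> real m / 2) \<Longrightarrow> \<bar>F \<alpha> w\<bar> \<le> M"
  shows "\<bar>remainder_functional m F\<bar> \<le> M * (1.0331 * (pi * real m) powr ((real CARD('n) + 1) / 2) / fact (2 * m + 1))
              * (kappa * real CARD('n) * real m) ^ (2 * m)"
proof -
  let ?p = "CARD('n)"
  let ?C = "cbox (-1) 1 :: (real ^ 'n) set"
  let ?Z = "\<lambda>\<alpha> s u. \<Sum>j\<in>{1 .. vec m}. gamma_vec m j * mi_power (real_vec j) (\<alpha> + 1) *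
    F \<alpha> (\<chi> r. s * real (j $ r) * u $ r / 2)"
  \<comment> \<open>\<open>a j\<close> is the absolute weight of \<open>j\<close> times the volume of the box with side lengths \<open>j\<close>.\<close>
  define a where "a j = \<bar>gamma_vec m j\<bar> * mi_power (real_vec j) 1" for j :: "nat ^ 'n"
  define E where "E \<alpha> u = mi_power (\<chi> r. \<bar>u $ r\<bar>) \<alpha> * (\<Sum>j\<in>{1..vec m}. a j * mi_power (real_vec j) \<alpha>) * M" for \<alpha> and u :: "real ^ 'n"
  have j0: "0 \<le> mi_power (real_vec j) \<alpha>" for j \<alpha> :: "nat ^ 'n"
    by (rule mi_power_nonneg) (simp add: real_vec_def)
  have a0: "0 \<le> a j" for j using j0 by (simp add: a_def)
  have M0: "0 \<le> M"
  proof -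
    have "mi_norm (axis q (2 * m)) = 2 * m" for q :: 'n by (simp add: mi_norm_def axis_def)
    then have "\<bar>F (axis undefined (2 * m)) 0\<bar> \<le> M" by (rule F) simp
    then show ?thesis by linarith
  qed
  have contE: "continuous_on S (E \<alpha>)" for S \<alpha>
    unfolding E_def by (intro continuous_intros)
  have outer: "\<bar>LINT s : {0..1} | lborel. (1 - s) ^ (2 * m - 1) * (LINT u : {x. \<forall>r. x $ r \<in> {-1..1}} | lborel. mi_power u \<alpha> * ?Z \<alpha> s u)\<bar>
      \<le> integral ?C (E \<alpha>) / (2 * real m)" if \<alpha>: "mi_norm \<alpha> = 2 * m" for \<alpha> :: "nat ^ 'n"
  proof -
    let ?I = "\<lambda>s. LINT u : {x. \<forall>r. x $ r \<in> {-1..1}} | lborel. mi_power u \<alpha> * ?Z \<alpha> s u"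
    have inner: "\<bar>?I s\<bar> \<le> integral ?C (E \<alpha>)" if s: "s \<in> {0..1}" for s
    proof -
      have "\<bar>?I s\<bar> \<le> (LINT u : ?C | lborel. E \<alpha> u)"
        unfolding cube_eq_cbox
      proof (rule set_integral_abs_bound)
        show "set_integrable lborel ?C (E \<alpha>)" by (rule set_integral_cbox) (rule contE)
        fix u assume u: "u \<in> ?C"
        have off: "\<bar>F \<alpha> (\<chi> r. s * real (j $ r) * u $ r / 2)\<bar> \<le> M" if j: "j \<in> {1..vec m}" for j
          using u unfolding cube_eq_cbox[symmetric] by (intro F[OF \<alpha>] allI abs_offset_le[OF s _ j]) simp
        have "\<bar>?Z \<alpha> s u\<bar>
            \<le> (\<Sum>j\<in>{1 .. vec m}. a j * mi_power (real_vec j) \<alpha> * M)"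
        proof (rule order_trans[OF sum_abs sum_mono])
          fix j assume "j \<in> {1 .. vec m :: nat ^ 'n}"
          then have "a j * mi_power (real_vec j) \<alpha> * \<bar>F \<alpha> (\<chi> r. s * real (j $ r) * u $ r / 2)\<bar> \<le> a j * mi_power (real_vec j) \<alpha> * M"
            using a0 j0 off by (intro mult_left_mono) auto
          then show "\<bar>gamma_vec m j * mi_power (real_vec j) (\<alpha> + 1) * F \<alpha> (\<chi> r. s * real (j $ r) * u $ r / 2)\<bar> \<le> a j * mi_power (real_vec j) \<alpha> * M"
            using j0 by (simp add: a_def abs_mult mi_power_add mult_ac)
        qed
        then have "\<bar>mi_power u \<alpha>\<bar> * \<bar>?Z \<alpha> s u\<bar>
            \<le> \<bar>mi_power u \<alpha>\<bar> * (\<Sum>j\<in>{1 .. vec m}. a j * mi_power (real_vec j) \<alpha> * M)"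
          by (rule mult_left_mono) simp
        then show "\<bar>mi_power u \<alpha> * ?Z \<alpha> s u\<bar> \<le> E \<alpha> u"
          by (simp only: abs_mult E_def abs_mi_power sum_distrib_right mult.assoc)
      qed
      also have "\<dots> = integral ?C (E \<alpha>)" by (rule set_integral_cbox) (rule contE)
      finally show ?thesis .
    qed
    have "\<bar>LINT s : {0..1} | lborel. (1 - s) ^ (2 * m - 1) * ?I s\<bar> \<le> (LINT s : {0..1} | lborel. (1 - s) ^ (2 * m - 1) * integral ?C (E \<alpha>))"
    proof (rule set_integral_abs_bound)
      show "set_integrable lborel {0..1} (\<lambda>s::real. (1 - s) ^ (2 * m - 1) * integral ?C (E \<alpha>))"
        by (rule borel_integrable_atLeastAtMost') (intro continuous_intros)
      fix s :: real assume "s \<in> {0..1}"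
      then show "\<bar>(1 - s) ^ (2 * m - 1) * ?I s\<bar> \<le> (1 - s) ^ (2 * m - 1) * integral ?C (E \<alpha>)"
        using inner[of s] by (simp add: abs_mult power_abs mult_left_mono)
    qed
    also have "\<dots> = (LINT s : {0..1} | lborel. (1 - s) ^ (2 * m - 1)) * integral ?C (E \<alpha>)"
      by (rule set_integral_mult_left)
    also have "\<dots> = integral ?C (E \<alpha>) / (2 * real m)"
      unfolding set_integral_one_minus_power using m by (simp add: of_nat_diff)
    finally show ?thesis .
  qed
  define c where "c = M * real ?p ^ (2 * m - 1) / fact (2 * m)"
  have c0: "0 \<le> c" using M0 by (simp add: c_def)
  define H where "H u = (\<Sum>j\<in>{1..vec m}. \<Sum>r\<in>UNIV. c * (a j * real (j $ r) ^ (2 * m)) * \<bar>u $ r\<bar> ^ (2 * m))" for u :: "real ^ 'n"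
  define T where "T = (\<Sum>j=1..m. \<bar>gamma_coeff m j\<bar> * real j * real j ^ (2 * m))"
  define S where "S = (\<Sum>j=1..m. \<bar>gamma_coeff m j\<bar> * real j)"
  have T0: "0 \<le> T" and S0: "0 \<le> S" unfolding T_def S_def by (auto intro!: sum_nonneg)
  have EH: "(\<Sum>\<alpha> | mi_norm \<alpha> = 2 * m. 1 / mi_fact \<alpha> * E \<alpha> u) \<le> H u" for u
  proof -
    define w where "w j = (\<chi> r. real (j $ r) * \<bar>u $ r\<bar>)" for j :: "nat ^ 'n"
    have wE: "mi_power (\<chi> r. \<bar>u $ r\<bar>) \<alpha> * mi_power (real_vec j) \<alpha> = mi_power (w j) \<alpha>" for j \<alpha>
      by (simp add: w_def mi_power_def real_vec_def power_mult_distrib prod.distrib mult.commute)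
    have "(\<Sum>\<alpha> | mi_norm \<alpha> = 2 * m. 1 / mi_fact \<alpha> * E \<alpha> u)
        = (\<Sum>\<alpha> | mi_norm \<alpha> = 2 * m. \<Sum>j\<in>{1..vec m}. M / fact (2 * m) * a j * (fact (2 * m) / mi_fact \<alpha> * mi_power (w j) \<alpha>))"
      unfolding E_def sum_distrib_left sum_distrib_right wE[symmetric] by (simp add: mult_ac)
    also have "\<dots> = (\<Sum>j\<in>{1..vec m}. M / fact (2 * m) * a j * (\<Sum>r\<in>UNIV. w j $ r) ^ (2 * m))"
      unfolding multinomial_sum[symmetric] sum_distrib_left by (rule sum.swap)
    also have "\<dots> \<le> (\<Sum>j\<in>{1..vec m}. M / fact (2 * m) * a j * (real ?p ^ (2 * m - 1) * (\<Sum>r\<in>UNIV. (w j $ r) ^ (2 * m))))"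
    proof (intro sum_mono mult_left_mono)
      fix j
      have "Suc (2 * m - 1) = 2 * m" using m by simp
      then show "(\<Sum>r\<in>UNIV. w j $ r) ^ (2 * m) \<le> real ?p ^ (2 * m - 1) * (\<Sum>r\<in>UNIV. (w j $ r) ^ (2 * m))"
        using sum_power_le_card_power_sum[of "\<lambda>r. w j $ r" "2 * m - 1"] by (simp add: w_def del: power_Suc)
    qed (use M0 a0 in auto)
    also have "\<dots> = H u"
      unfolding H_def c_def w_def sum_distrib_left by (simp add: power_mult_distrib mult_ac)
    finally show ?thesis .
  qed
  have contH: "continuous_on X H" for X
    unfolding H_def by (intro continuous_intros)
  have "(\<Sum>\<alpha> | mi_norm \<alpha> = 2 * m. 1 / mi_fact \<alpha> * integral ?C (E \<alpha>)) = integral ?C (\<lambda>u. \<Sum>\<alpha> | mi_norm \<alpha> = 2 * m. 1 / mi_fact \<alpha> * E \<alpha> u)"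
    by (subst Henstock_Kurzweil_Integration.integral_sum) (auto simp: finite_mi_norm intro!: integrable_continuous continuous_intros contE)
  also have "\<dots> \<le> integral ?C H"
    using EH by (intro Henstock_Kurzweil_Integration.integral_le integrable_continuous continuous_intros contE contH)
      (auto simp: less_imp_neq[OF mi_fact_pos, symmetric])
  also have "\<dots> = (\<Sum>j\<in>{1..vec m}. \<Sum>r\<in>UNIV. c * (a j * real (j $ r) ^ (2 * m)) * (2 ^ ?p / (real (2 * m) + 1)))"
  proof -
    have "integral ?C H = (\<Sum>j\<in>{1..vec m}. integral ?C (\<lambda>u. \<Sum>r\<in>UNIV. c * (a j * real (j $ r) ^ (2 * m)) * \<bar>u $ r\<bar> ^ (2 * m)))"
      unfolding H_def by (intro Henstock_Kurzweil_Integration.integral_sum integrable_continuous continuous_intros) auto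
    also have "\<dots> = (\<Sum>j\<in>{1..vec m}. \<Sum>r\<in>UNIV. integral ?C (\<lambda>u. c * (a j * real (j $ r) ^ (2 * m)) * \<bar>u $ r\<bar> ^ (2 * m)))"
      by (rule sum.cong[OF refl]) (intro Henstock_Kurzweil_Integration.integral_sum integrable_continuous continuous_intros; simp)
    finally show ?thesis by (simp only: Henstock_Kurzweil_Integration.integral_mult_right integral_cube_coordinate_power)
  qed
  also have "\<dots> = c * (2 ^ ?p / (real (2 * m) + 1)) * (\<Sum>r\<in>UNIV. \<Sum>j\<in>{1..vec m}. a j * real (j $ r) ^ (2 * m))"
    by (subst sum.swap) (simp add: sum_distrib_left mult_ac)
  also have "(\<Sum>r\<in>(UNIV :: 'n set). \<Sum>j\<in>{1..vec m}. a j * real (j $ r) ^ (2 * m)) = real ?p * (T * S ^ (?p - 1))"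
    unfolding a_def T_def S_def sum_gamma_vec_coordinate_power by simp
  finally have sumE: "(\<Sum>\<alpha> | mi_norm \<alpha> = 2 * m. 1 / mi_fact \<alpha> * integral ?C (E \<alpha>))
      \<le> c * (2 ^ ?p / (real (2 * m) + 1)) * (real ?p * (T * S ^ (?p - 1)))" .
  let ?K = "real m / 2 ^ (2 * m + ?p - 1)"
  have "\<bar>remainder_functional m F\<bar> \<le> ?K * (\<Sum>\<alpha> | mi_norm \<alpha> = 2 * m. 1 / mi_fact \<alpha> * (integral ?C (E \<alpha>) / (2 * real m)))"
    unfolding remainder_functional_def abs_mult
  proof (intro mult_mono order_trans[OF sum_abs sum_mono])
    fix \<alpha> assume "\<alpha> \<in> {\<alpha> :: nat ^ 'n. mi_norm \<alpha> = 2 * m}"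
    then have "mi_norm \<alpha> = 2 * m" by simp
    from outer[OF this] show "\<bar>1 / mi_fact \<alpha> * (LINT s : {0..1} | lborel. (1 - s) ^ (2 * m - 1) *
          (LINT u : {x. \<forall>r. x $ r \<in> {-1..1}} | lborel. mi_power u \<alpha> * ?Z \<alpha> s u))\<bar> \<le> 1 / mi_fact \<alpha> * (integral ?C (E \<alpha>) / (2 * real m))"
      unfolding abs_mult using mi_fact_pos[of \<alpha>] by (intro mult_mono) auto
  qed auto
  also have "\<dots> = ?K / (2 * real m) * (\<Sum>\<alpha> | mi_norm \<alpha> = 2 * m. 1 / mi_fact \<alpha> * integral ?C (E \<alpha>))"
    by (simp add: sum_distrib_left mult_ac)
  also have "\<dots> \<le> ?K / (2 * real m) * (c * (2 ^ ?p / (real (2 * m) + 1)) * (real ?p * (T * S ^ (?p - 1))))"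
    using sumE by (rule mult_left_mono) simp
  also have "\<dots> = M / fact (2 * m + 1) * (real ?p ^ (2 * m) / 2 ^ (2 * m)) * (T * S ^ (?p - 1))"
  proof -
    have "2 ^ (2 * m + ?p - 1) * 2 = (2 :: real) ^ (2 * m) * 2 ^ ?p"
      using m by (simp flip: power_add power_Suc2)
    then have K: "?K / (2 * real m) = 1 / (2 ^ (2 * m) * 2 ^ ?p)"
      using m by (simp add: field_simps)
    have f: "fact (2 * m + 1) = fact (2 * m) * (real (2 * m) + 1)" by simp
    have p: "real ?p ^ (2 * m) = real ?p ^ (2 * m - 1) * real ?p"
      using m by (simp flip: power_Suc2)
    have ne: "real (2 * m) + 1 \<noteq> 0" "fact (2 * m) \<noteq> (0::real)" by (simp_all add: add_nonneg_eq_0_iff)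
    show ?thesis unfolding K f p c_def using ne by (simp add: divide_simps)
  qed
  also have "\<dots> \<le> M / fact (2 * m + 1) * (real ?p ^ (2 * m) / 2 ^ (2 * m)) * (1.0331 * (pi * real m) * (4 * kappa\<^sup>2 * real m ^ 2) ^ m * sqrt (pi * real m) ^ (?p - 1))"
  proof (intro mult_left_mono mult_mono power_mono)
    show "T \<le> 1.0331 * (pi * real m) * (4 * kappa\<^sup>2 * real m ^ 2) ^ m"
      unfolding T_def using m by (rule sum_gamma_coeff_power_le)
    show "S \<le> sqrt (pi * real m)"
      unfolding S_def using m by (rule sum_gamma_coeff_abs_times_le)
  qed (use M0 S0 in auto)
  also have "\<dots> = M * (1.0331 * ((pi * real m) * sqrt (pi * real m) ^ (?p - 1)) / fact (2 * m + 1)) * (kappa * real ?p * real m) ^ (2 * m)"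
  proof -
    have "(4 * kappa\<^sup>2 * real m ^ 2) ^ m = 2 ^ (2 * m) * (kappa * real m) ^ (2 * m)"
      unfolding power_mult power_mult_distrib[symmetric] by (simp add: power_mult_distrib)
    then show ?thesis by (simp add: power_mult_distrib mult_ac)
  qed
  also have "(pi * real m) * sqrt (pi * real m) ^ (?p - 1) = (pi * real m) powr ((real ?p + 1) / 2)"
  proof -
    have pos: "0 < pi * real m" using m by simp
    have "sqrt (pi * real m) ^ (?p - 1) = ((pi * real m) powr (1 / 2)) ^ (?p - 1)"
      using pos by (simp add: powr_half_sqrt)
    also have "\<dots> = (pi * real m) powr (real (?p - 1) * (1 / 2))"
      using m by (intro powr_power) auto
    finally have "(pi * real m) * sqrt (pi * real m) ^ (?p - 1) = (pi * real m) powr 1 * (pi * real m) powr (real (?p - 1) * (1 / 2))"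
      using pos by simp
    also have "\<dots> = (pi * real m) powr (1 + real (?p - 1) * (1 / 2))"
      by (rule powr_add[symmetric])
    also have "1 + real (?p - 1) * (1 / 2) = (real ?p + 1) / 2"
      by (simp add: of_nat_diff Suc_leI field_simps)
    finally show ?thesis .
  qed
  finally show ?thesis .
qed

section \<open>Cones, polytopes, and the summation formula\<close>

lemma partial_outside_support:
  fixes h :: "real ^ 'n::finite \<Rightarrow> real"
  assumes h: "\<And>y r. R < \<bar>y $ r\<bar> \<Longrightarrow> h y = 0" and x: "R < \<bar>x $ r\<bar>"
  shows "partial q h x = 0"
proof -
  have "((\<lambda>t. \<bar>(x + t *\<^sub>R axis q 1) $ r\<bar>) \<longlongrightarrow> \<bar>(x + 0 *\<^sub>R axis q 1) $ r\<bar>) (nhds 0)"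
    by (intro tendsto_intros filterlim_ident)
  then have "eventually (\<lambda>t. R < \<bar>(x + t *\<^sub>R axis q 1) $ r\<bar>) (nhds 0)"
    using x by (intro order_tendstoD) auto
  then have "eventually (\<lambda>t. h (x + t *\<^sub>R axis q 1) = 0) (nhds 0)"
    by (rule eventually_mono) (rule h)
  then have "((\<lambda>t. h (x + t *\<^sub>R axis q 1)) has_real_derivative 0) (at 0) \<longleftrightarrow> ((\<lambda>t. 0) has_real_derivative 0) (at 0)"
    by (intro DERIV_cong_ev) auto
  then show ?thesis by (intro partial_eqI) auto
qed

lemma mixed_partial_outside_support:
  fixes h :: "real ^ 'n::finite \<Rightarrow> real"
  assumes h: "\<And>y r. R < \<bar>y $ r\<bar> \<Longrightarrow> h y = 0"
  shows "R < \<bar>x $ r\<bar> \<Longrightarrow> mixed_partial \<alpha> h x = 0"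
proof -
  have "R < \<bar>x $ r\<bar> \<Longrightarrow> iter_partial rs h x = 0" for rs x r
  proof (induction rs arbitrary: x r)
    case (Cons q rs)
    then show ?case using partial_outside_support[of R "iter_partial rs h" x r q] by simp
  qed (simp add: h)
  then show "R < \<bar>x $ r\<bar> \<Longrightarrow> mixed_partial \<alpha> h x = 0" unfolding mixed_partial_def .
qed

text \<open>A lattice point with a coordinate above \<open>N\<close> is moved by \<open>one_on J + u\<close> to a point that still lies outside the support.\<close>

lemma infsum_bounded_support:
  fixes \<phi> :: "real ^ 'n::finite \<Rightarrow> real"
  assumes \<phi>: "\<And>y r. R < \<bar>y $ r\<bar> \<Longrightarrow> \<phi> y = 0" and u: "\<And>r. \<bar>u $ r\<bar> \<le> c" and N: "R + c \<le> real N"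
  shows "(\<Sum>\<^sub>\<infinity>k\<in>UNIV. \<phi> (real_vec k + one_on J + u)) = (\<Sum>k\<in>{0..vec N}. \<phi> (real_vec k + one_on J + u))"
proof -
  have "(\<Sum>\<^sub>\<infinity>k\<in>UNIV. \<phi> (real_vec k + one_on J + u)) = (\<Sum>\<^sub>\<infinity>k\<in>{0..vec N}. \<phi> (real_vec k + one_on J + u))"
  proof (rule infsum_cong_neutral)
    fix k :: "nat ^ 'n" assume "k \<in> UNIV - {0..vec N}"
    then obtain r where r: "N < k $ r" by (auto simp: less_eq_vec_def not_le)
    have "0 \<le> one_on J $ r" by (simp add: one_on_def)
    then have "R < (real_vec k + one_on J + u) $ r" using r u[of r] N by (simp add: real_vec_def)
    then have "R < \<bar>(real_vec k + one_on J + u) $ r\<bar>" by linarith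
    then show "\<phi> (real_vec k + one_on J + u) = 0" by (rule \<phi>)
  qed auto
  then show ?thesis by simp
qed

text \<open>The quadrature identity at each of the points \<open>k + one_on J\<close>, added up; the cube averages become integrals over
orthants.\<close>

lemma cone_summation_formula:
  fixes g :: "real ^ 'n::finite \<Rightarrow> real"
  assumes m: "1 \<le> m" and g: "cont_diff (2 * m) g"
    and supp: "\<And>y r. R < \<bar>y $ r\<bar> \<Longrightarrow> g y = 0" and N: "R + real m / 2 \<le> real N"
  shows "remainder_functional m (\<lambda>\<alpha> w. \<Sum>k\<in>{0..vec N}. mixed_partial \<alpha> g (real_vec k + one_on J + w))
    = (\<Sum>\<beta>\<in>{vec (1 - int m)..vec (int m - 1)}. tau_vec m (\<chi> r. 1 + nat \<bar>\<beta> $ r\<bar>) * (LINT y : shifted_orthant J \<beta> | lborel. g y))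
      - (\<Sum>k\<in>{0..vec N}. g (real_vec k + one_on J))"
proof -
  let ?B = "{vec (1 - int m)..vec (int m - 1)} :: (int ^ 'n) set"
  let ?\<tau> = "\<lambda>\<beta> :: int ^ 'n. tau_vec m (\<chi> r. 1 + nat \<bar>\<beta> $ r\<bar>)"
  have cont: "continuous_on UNIV (\<lambda>w. mixed_partial \<alpha> g (x + w))" if "mi_norm \<alpha> = 2 * m" for \<alpha> and x :: "real ^ 'n"
  proof -
    have "continuous_on UNIV (mixed_partial \<alpha> g)"
      using cont_diff_mixed_partial[of 0 \<alpha> g] g that by simp
    then show ?thesis
      by (rule continuous_on_compose2) (intro continuous_intros, simp)
  qed
  let ?Q = "\<lambda>k. \<Sum>j\<in>{1..vec m}. gamma_vec m j * mi_power (real_vec j) 1 / 2 ^ CARD('n) *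
        integral (cbox (-1) 1) (\<lambda>u. g (real_vec k + one_on J + (\<chi> r. real (j $ r) * u $ r / 2)))"
  have "remainder_functional m (\<lambda>\<alpha> w. \<Sum>k\<in>{0..vec N}. 1 * mixed_partial \<alpha> g (real_vec k + one_on J + w))
      = (\<Sum>k\<in>{0..vec N}. 1 * remainder_functional m (\<lambda>\<alpha> w. mixed_partial \<alpha> g (real_vec k + one_on J + w)))"
    by (rule remainder_functional_sum[where c = "\<lambda>_. 1" and G = "\<lambda>k \<alpha> w. mixed_partial \<alpha> g (real_vec k + one_on J + w)"])
      (simp, rule cont)
  also have "\<dots> = (\<Sum>k\<in>{0..vec N}. ?Q k - g (real_vec k + one_on J))"
  proof (rule sum.cong[OF refl])
    fix k
    show "1 * remainder_functional m (\<lambda>\<alpha> w. mixed_partial \<alpha> g (real_vec k + one_on J + w)) = ?Q k - g (real_vec k + one_on J)"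
      using taylor_quadrature[OF m g, of "real_vec k + one_on J"] by linarith
  qed
  also have "\<dots> = (\<Sum>k\<in>{0..vec N}. ?Q k) - (\<Sum>k\<in>{0..vec N}. g (real_vec k + one_on J))"
    by (simp only: sum_subtractf)
  also have "(\<Sum>k\<in>{0..vec N}. ?Q k) = (\<Sum>\<beta>\<in>?B. ?\<tau> \<beta> * (LINT y : shifted_orthant J \<beta> | lborel. g y))"
  proof (rule cube_averages_sum_eq_orthant_integrals[OF m cont_diff_imp_continuous[OF g] _ N])
    show "\<bar>y $ r\<bar> \<le> R" if "g y \<noteq> 0" for y r
      using supp[of y r] that by linarith
  qed
  finally show ?thesis by (simp only: mult_1)
qed

lemma remainder_functional_cong:
  fixes F G :: "nat ^ 'n::finite \<Rightarrow> real ^ 'n \<Rightarrow> real"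
  assumes "\<And>\<alpha> w. mi_norm \<alpha> = 2 * m \<Longrightarrow> (\<And>r. \<bar>w $ r\<bar> \<le> real m / 2) \<Longrightarrow> F \<alpha> w = G \<alpha> w"
  shows "remainder_functional m F = remainder_functional m G"
  unfolding remainder_functional_def set_lebesgue_integral_def
proof (intro arg_cong2[of _ _ _ _ "(*)"] refl sum.cong Bochner_Integration.integral_cong)
  fix \<alpha> :: "nat ^ 'n" and s :: real assume \<alpha>: "\<alpha> \<in> {\<alpha>. mi_norm \<alpha> = 2 * m}"
  let ?Z = "\<lambda>F u. \<Sum>j\<in>{1 .. vec m}. gamma_vec m j * mi_power (real_vec j) (\<alpha> + 1) *
    F \<alpha> (\<chi> r. s * real (j $ r) * u $ r / 2)"
  let ?I = "\<lambda>F. \<integral>u. indicat_real {x. \<forall>r. x $ r \<in> {-1..1}} u *\<^sub>R (mi_power u \<alpha> * ?Z F u) \<partial>lborel"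
  have "?I F = ?I G" if s: "s \<in> {0..1}"
  proof (intro Bochner_Integration.integral_cong refl)
    fix u :: "real ^ 'n"
    have "F \<alpha> (\<chi> r. s * real (j $ r) * u $ r / 2) = G \<alpha> (\<chi> r. s * real (j $ r) * u $ r / 2)"
      if u: "\<forall>r. u $ r \<in> {-1..1}" and j: "j \<in> {1..vec m}" for j
    proof (rule assms)
      show "mi_norm \<alpha> = 2 * m" using \<alpha> by simp
    qed (rule abs_offset_le[OF s u j])
    then show "indicat_real {x. \<forall>r. x $ r \<in> {-1..1}} u *\<^sub>R (mi_power u \<alpha> * ?Z F u)
      = indicat_real {x. \<forall>r. x $ r \<in> {-1..1}} u *\<^sub>R (mi_power u \<alpha> * ?Z G u)"
      by (cases "\<forall>r. u $ r \<in> {-1..1}") (simp_all del: atLeastAtMost_iff cong: sum.cong)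
  qed
  then show "indicat_real {0..1} s *\<^sub>R ((1 - s) ^ (2 * m - 1) * ?I F) = indicat_real {0..1} s *\<^sub>R ((1 - s) ^ (2 * m - 1) * ?I G)"
  proof (cases "s \<in> {0..1}")
    case False
    then have "indicat_real {0..1} s = 0" by (rule indicator_simps(2))
    then show ?thesis by (simp only: scaleR_zero_left)
  qed (simp only:)
qed

lemma bounded_support_chart:
  fixes A :: "int ^ 'n::finite ^ 'n" and f :: "real ^ 'n \<Rightarrow> real"
  assumes A: "unimodular A" and f: "\<And>x. f x \<noteq> 0 \<Longrightarrow> norm x \<le> L"
  obtains R where "\<And>y r. R < \<bar>y $ r\<bar> \<Longrightarrow> f (chart v A y) = 0"
proof -
  obtain B where "\<And>x. real_matrix A *v (B *v x) = x" and B: "\<And>x. B *v (real_matrix A *v x) = x"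
    using unimodular_inverse[OF A] by blast
  have "continuous_on (cball 0 L) (\<lambda>x. x - v)" by (intro continuous_intros)
  then have "continuous_on (cball 0 L) (\<lambda>x. B *v (x - v))" by (rule continuous_on_matrix_vector_mult)
  then have "bounded ((\<lambda>x. B *v (x - v)) ` cball 0 L)"
    by (intro compact_imp_bounded compact_continuous_image) auto
  then obtain R where "\<forall>z\<in>(\<lambda>x. B *v (x - v)) ` cball 0 L. norm z \<le> R"
    unfolding bounded_iff by blast
  then have R: "norm (B *v (x - v)) \<le> R" if "x \<in> cball 0 L" for x
    using that by blast
  show thesis
  proof (rule that)
    fix y :: "real ^ 'n" and r assume y: "R < \<bar>y $ r\<bar>"
    show "f (chart v A y) = 0"
    proof (rule ccontr)
      assume "f (chart v A y) \<noteq> 0"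
      then have "chart v A y \<in> cball 0 L" using f[of "chart v A y"] by simp
      then have "norm (B *v (chart v A y - v)) \<le> R" by (rule R)
      then have "norm y \<le> R" by (simp only: chart_def add_diff_cancel_left' B)
      then show False using component_le_norm_cart[of y r] y by linarith
    qed
  qed
qed

text \<open>The integer points of the orthant with the faces \<open>J\<close> removed are the points \<open>k + one_on J\<close> with \<open>k \<ge> 0\<close>, and a chart
with integral apex and unimodular matrix preserves integrality in both directions.\<close>

lemma chart_lattice_bij:
  fixes A :: "int ^ 'n::finite ^ 'n"
  assumes A: "unimodular A" and v: "v \<in> int_points"
  shows "inj (\<lambda>k. chart v A (real_vec k + one_on J))"
    and "range (\<lambda>k. chart v A (real_vec k + one_on J)) = cone_at v A J \<inter> int_points"
proof -
  obtain B where "\<And>x. real_matrix A *v (B *v x) = x" and B: "\<And>x. B *v (real_matrix A *v x) = x"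
    using unimodular_inverse[OF A] by blast
  show "inj (\<lambda>k. chart v A (real_vec k + one_on J))"
  proof (rule injI)
    fix k l :: "nat ^ 'n" assume "chart v A (real_vec k + one_on J) = chart v A (real_vec l + one_on J)"
    then have "real_matrix A *v (real_vec k + one_on J) = real_matrix A *v (real_vec l + one_on J)"
      by (simp only: chart_def add_left_cancel)
    then have "B *v (real_matrix A *v (real_vec k + one_on J)) = B *v (real_matrix A *v (real_vec l + one_on J))"
      by (simp only:)
    then have "real_vec k = real_vec l" by (simp only: B add_right_cancel)
    then show "k = l" by (simp add: real_vec_def vec_eq_iff)
  qed
  have int: "chart v A y \<in> int_points \<longleftrightarrow> y \<in> int_points" for y
  proof -
    have "chart v A y \<in> int_points \<longleftrightarrow> real_matrix A *v y \<in> int_points"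
    proof
      assume "chart v A y \<in> int_points"
      then have "v $ r + (real_matrix A *v y) $ r - v $ r \<in> \<int>" for r
        using v unfolding int_points_def chart_def by (intro Ints_diff) auto
      then show "real_matrix A *v y \<in> int_points" by (simp add: int_points_def)
    qed (use v in \<open>auto simp: int_points_def chart_def\<close>)
    then show ?thesis by (simp only: unimodular_int_points_iff[OF A])
  qed
  have orth: "y \<in> pos_orthant J \<and> y \<in> int_points \<longleftrightarrow> (\<exists>k. y = real_vec k + one_on J)" for y
  proof
    assume y: "y \<in> pos_orthant J \<and> y \<in> int_points"
    then obtain z where z: "y = int_vec z" by (auto simp: int_points_iff_int_vec)
    have "y = real_vec (\<chi> r. nat (z $ r - (if r \<in> J then 1 else 0))) + one_on J"
    proof (subst vec_eq_iff, rule allI)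
      fix r
      have "if r \<in> J then 0 < y $ r else 0 \<le> y $ r"
        using y by (simp add: pos_orthant_def)
      then have "if r \<in> J then 0 < z $ r else 0 \<le> z $ r"
        by (cases "r \<in> J") (simp_all add: z int_vec_def)
      then show "y $ r = (real_vec (\<chi> r. nat (z $ r - (if r \<in> J then 1 else 0))) + one_on J) $ r"
        by (cases "r \<in> J") (simp_all add: z int_vec_def real_vec_def one_on_def)
    qed
    then show "\<exists>k. y = real_vec k + one_on J" ..
  qed (auto simp: pos_orthant_def int_points_def real_vec_def one_on_def add_nonneg_pos)
  have "cone_at v A J \<inter> int_points = chart v A ` (pos_orthant J \<inter> int_points)"
    unfolding cone_at_def using int by auto
  also have "pos_orthant J \<inter> int_points = range (\<lambda>k. real_vec k + one_on J)"
  proof (rule set_eqI)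
    fix y show "y \<in> pos_orthant J \<inter> int_points \<longleftrightarrow> y \<in> range (\<lambda>k. real_vec k + one_on J)"
      unfolding Int_iff orth by (simp only: image_iff bex_UNIV)
  qed
  finally show "range (\<lambda>k. chart v A (real_vec k + one_on J)) = cone_at v A J \<inter> int_points"
    by (simp only: image_image)
qed

lemma sum_lattice_cone:
  fixes A :: "int ^ 'n::finite ^ 'n" and f :: "real ^ 'n \<Rightarrow> real"
  assumes A: "unimodular A" and v: "v \<in> int_points"
    and D: "finite D" "D \<subseteq> int_points" "\<And>x. x \<in> int_points \<Longrightarrow> f x \<noteq> 0 \<Longrightarrow> x \<in> D"
    and supp: "\<And>y r. R < \<bar>y $ r\<bar> \<Longrightarrow> f (chart v A y) = 0" and N: "R \<le> real N"
  shows "(\<Sum>x\<in>D. indicator (cone_at v A J) x * f x) = (\<Sum>k\<in>{0..vec N}. f (chart v A (real_vec k + one_on J)))"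
proof -
  let ?\<phi> = "\<lambda>k. chart v A (real_vec k + one_on J)"
  let ?K = "{k. f (?\<phi> k) \<noteq> 0}"
  have K: "?K \<subseteq> {0..vec N}"
  proof
    fix k assume k: "k \<in> ?K"
    have "k $ r \<le> N" for r
    proof (rule ccontr)
      assume r: "\<not> k $ r \<le> N"
      have "0 \<le> one_on J $ r" by (simp add: one_on_def)
      then have "R < \<bar>(real_vec k + one_on J) $ r\<bar>" using r N by (simp add: real_vec_def)
      then have "f (?\<phi> k) = 0" by (rule supp)
      with k show False by simp
    qed
    then show "k \<in> {0..vec N}" by (simp add: less_eq_vec_def)
  qed
  have "(\<Sum>k\<in>{0..vec N}. f (?\<phi> k)) = (\<Sum>k\<in>?K. f (?\<phi> k))"
    using K by (intro sum.mono_neutral_right) auto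
  also have "\<dots> = (\<Sum>x\<in>?\<phi> ` ?K. f x)"
    by (subst sum.reindex[OF inj_on_subset[OF chart_lattice_bij(1)[OF A v] subset_UNIV]]) (simp add: o_def)
  also have "?\<phi> ` ?K = {x \<in> D. x \<in> cone_at v A J \<and> f x \<noteq> 0}"
  proof -
    have "?\<phi> ` ?K = {x \<in> range ?\<phi>. f x \<noteq> 0}" by auto
    also have "\<dots> = {x \<in> D. x \<in> cone_at v A J \<and> f x \<noteq> 0}"
    proof (intro set_eqI iffI)
      fix x assume "x \<in> {x \<in> range ?\<phi>. f x \<noteq> 0}"
      then show "x \<in> {x \<in> D. x \<in> cone_at v A J \<and> f x \<noteq> 0}"
        unfolding chart_lattice_bij(2)[OF A v] using D(3)[of x] by simp
    next
      fix x assume "x \<in> {x \<in> D. x \<in> cone_at v A J \<and> f x \<noteq> 0}"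
      then show "x \<in> {x \<in> range ?\<phi>. f x \<noteq> 0}"
        unfolding chart_lattice_bij(2)[OF A v] using subsetD[OF D(2), of x] by simp
    qed
    finally show ?thesis .
  qed
  also have "(\<Sum>x\<in>{x \<in> D. x \<in> cone_at v A J \<and> f x \<noteq> 0}. f x) = (\<Sum>x\<in>D. indicator (cone_at v A J) x * f x)"
    using D(1) by (intro sum.mono_neutral_cong_left) (auto simp: indicator_def)
  finally show ?thesis ..
qed

text \<open>The translation of the cone is a translation of the orthant in the coordinates of the chart.\<close>

lemma translated_cone_eq_chart_image:
  "(\<lambda>y. y + real_matrix A *v (\<chi> r. one_on J $ r - (1 + real_of_int (\<beta> $ r)) / 2)) ` cone_at v A J
    = chart v A ` shifted_orthant J \<beta>"
  unfolding cone_at_def shifted_orthant_def image_image chart_def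
  by (simp add: matrix_vector_right_distrib add.assoc)

lemma integral_polytope_vertices:
  assumes "integral_polytope P"
  shows "finite (vertices P)" "vertices P \<subseteq> int_points" "bounded P"
proof -
  obtain S where S: "finite S" "S \<subseteq> int_points" "P = convex hull S"
    using assms by (auto simp: integral_polytope_def)
  then have "vertices P \<subseteq> S"
    by (auto simp: vertices_def dest: extreme_point_of_convex_hull)
  with S show "finite (vertices P)" "vertices P \<subseteq> int_points"
    by (auto intro: finite_subset)
  show "bounded P" using S by (simp add: finite_imp_bounded_convex_hull)
qed

lemma finite_bounded_int_points:
  fixes X :: "(real ^ 'n::finite) set"
  assumes "bounded X"
  shows "finite (X \<inter> int_points)"
proof -
  obtain L where L: "\<forall>x\<in>X. norm x \<le> L" using assms unfolding bounded_iff by blast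
  have "X \<inter> int_points \<subseteq> int_vec ` {vec (- \<lceil>L\<rceil>)..vec \<lceil>L\<rceil>}"
  proof
    fix x assume x: "x \<in> X \<inter> int_points"
    then obtain k where k: "x = int_vec k" by (auto simp: int_points_iff_int_vec)
    have abs_k: "\<bar>real_of_int (k $ r)\<bar> \<le> L" for r
    proof -
      have "norm x \<le> L" using L x by blast
      moreover have "\<bar>x $ r\<bar> \<le> norm x" by (rule component_le_norm_cart)
      moreover have "x $ r = real_of_int (k $ r)" by (simp add: k int_vec_def)
      ultimately show ?thesis by linarith
    qed
    have "- \<lceil>L\<rceil> \<le> k $ r \<and> k $ r \<le> \<lceil>L\<rceil>" for r
    proof -
      have "real_of_int \<bar>k $ r\<bar> \<le> real_of_int \<lceil>L\<rceil>"
        unfolding of_int_abs using abs_k[of r] le_of_int_ceiling[of L] by (rule order_trans)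
      then show ?thesis by (simp only: of_int_le_iff abs_le_iff) simp
    qed
    then have "k \<in> {vec (- \<lceil>L\<rceil>)..vec \<lceil>L\<rceil>}"
      by (simp add: less_eq_vec_def)
    then show "x \<in> int_vec ` {vec (- \<lceil>L\<rceil>)..vec \<lceil>L\<rceil>}" using k by blast
  qed
  then show ?thesis by (rule finite_subset) simp
qed

lemma polytope_summation_formula:
  fixes P V :: "(real ^ 'n::finite) set" and I :: "real ^ 'n \<Rightarrow> 'i set"
  assumes m: "1 \<le> m" and P: "integral_polytope P" and V: "V = vertices P"
    and I: "\<And>v. v \<in> V \<Longrightarrow> finite (I v)"
    and A: "\<And>v i. v \<in> V \<Longrightarrow> i \<in> I v \<Longrightarrow> unimodular (A v i)"
    and decomposition: "\<And>x. (indicator P x :: real) =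
           (\<Sum>v\<in>V. \<Sum>i\<in>I v. (-1) ^ t v i * indicator (cone_at v (A v i) (J v i)) x)"
    and f: "cont_diff (2 * m) f" and supp: "compactly_supported f"
  shows "(\<Sum>k\<in>P \<inter> int_points. f k) = approx_A m V I t A J f - remainder_R m V I t A J f"
proof -
  let ?B = "{vec (1 - int m)..vec (int m - 1)} :: (int ^ 'n) set"
  let ?\<tau> = "\<lambda>\<beta> :: int ^ 'n. tau_vec m (\<chi> r. 1 + nat \<bar>\<beta> $ r\<bar>)"
  have finV: "finite V" and intV: "V \<subseteq> int_points" and bP: "bounded P"
    unfolding V by (fact integral_polytope_vertices[OF P])+
  have bf: "bounded (support_on UNIV f)"
    using supp unfolding compactly_supported_def
    by (meson bounded_subset closure_subset compact_imp_bounded)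
  then obtain L where "\<forall>x\<in>support_on UNIV f. norm x \<le> L"
    unfolding bounded_iff by blast
  then have L: "norm x \<le> L" if "f x \<noteq> 0" for x
    using that by (simp add: support_on_def)
  define g where "g v i y = f (chart v (A v i) y)" for v i y
  define R where "R v i = (SOME R. \<forall>y r. R < \<bar>y $ r\<bar> \<longrightarrow> g v i y = 0)" for v i
  have R: "g v i y = 0" if vi: "v \<in> V" "i \<in> I v" and y: "R v i < \<bar>y $ r\<bar>" for v i y r
  proof -
    obtain R0 where "\<And>y r. R0 < \<bar>y $ r\<bar> \<Longrightarrow> f (chart v (A v i) y) = 0"
      by (rule bounded_support_chart[where v = v, OF A[OF vi] L]) blast+
    then have "\<exists>R. \<forall>y r. R < \<bar>y $ r\<bar> \<longrightarrow> g v i y = 0" unfolding g_def by blast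
    then have "\<forall>y r. R v i < \<bar>y $ r\<bar> \<longrightarrow> g v i y = 0" unfolding R_def by (rule someI_ex)
    then show ?thesis using y by blast
  qed
  define N where "N v i = nat \<lceil>R v i + real m / 2\<rceil>" for v i
  have N: "R v i + real m / 2 \<le> real (N v i)" for v i
    unfolding N_def by linarith
  have gC: "cont_diff (2 * m) (g v i)" for v i
    unfolding g_def by (rule cont_diff_chart[OF f])
  define S where "S v i = (\<Sum>k\<in>{0..vec (N v i)}. g v i (real_vec k + one_on (J v i)))" for v i
  define Q where "Q v i \<beta> = (LINT y : shifted_orthant (J v i) \<beta> | lborel. g v i y)" for v i \<beta>
  define G where "G = (\<lambda>(v, i) \<alpha> w. \<Sum>k\<in>{0..vec (N v i)}. mixed_partial \<alpha> (g v i) (real_vec k + one_on (J v i) + w))"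
  \<comment> \<open>A finite set of lattice points that serves the polytope and all cones simultaneously.\<close>
  define D where "D = (P \<union> support_on UNIV f) \<inter> int_points"
  have D: "finite D" "D \<subseteq> int_points" "\<And>x. x \<in> int_points \<Longrightarrow> f x \<noteq> 0 \<Longrightarrow> x \<in> D"
    unfolding D_def using bP bf by (auto intro!: finite_bounded_int_points simp: support_on_def)
  have sumS: "(\<Sum>k\<in>P \<inter> int_points. f k) = (\<Sum>v\<in>V. \<Sum>i\<in>I v. (-1) ^ t v i * S v i)"
  proof -
  let ?c = "\<lambda>v i x. (-1) ^ t v i * (indicator (cone_at v (A v i) (J v i)) x * f x)"
    have "(\<Sum>k\<in>P \<inter> int_points. f k) = (\<Sum>x\<in>D. indicator P x * f x)"
      using D(1) by (intro sum.mono_neutral_cong_left) (auto simp: D_def indicator_def)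
    also have "\<dots> = (\<Sum>x\<in>D. \<Sum>v\<in>V. \<Sum>i\<in>I v. ?c v i x)"
      unfolding decomposition sum_distrib_right by (simp only: mult.assoc)
    also have "\<dots> = (\<Sum>v\<in>V. \<Sum>x\<in>D. \<Sum>i\<in>I v. ?c v i x)"
      by (rule sum.swap)
    also have "\<dots> = (\<Sum>v\<in>V. \<Sum>i\<in>I v. \<Sum>x\<in>D. ?c v i x)"
      by (rule sum.cong[OF refl]) (rule sum.swap)
    also have "\<dots> = (\<Sum>v\<in>V. \<Sum>i\<in>I v. (-1) ^ t v i * S v i)"
    proof (rule sum.cong[OF refl], rule sum.cong[OF refl])
      fix v i assume vi: "v \<in> V" "i \<in> I v"
      have "(\<Sum>x\<in>D. indicator (cone_at v (A v i) (J v i)) x * f x) = S v i"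
        unfolding S_def g_def
      proof (rule sum_lattice_cone[OF A[OF vi] _ D])
        show "v \<in> int_points" using intV vi(1) by (rule subsetD)
        have "0 \<le> real m / 2" by simp
        with N[of v i] show "R v i \<le> real (N v i)" by linarith
        show "f (chart v (A v i) y) = 0" if "R v i < \<bar>y $ r\<bar>" for y r
          using R[OF vi that] by (simp only: g_def)
      qed
      then show "(\<Sum>x\<in>D. ?c v i x) = (-1) ^ t v i * S v i"
        by (simp flip: sum_distrib_left)
    qed
    finally show ?thesis .
  qed
  have approx: "approx_A m V I t A J f = (\<Sum>v\<in>V. \<Sum>i\<in>I v. (-1) ^ t v i *
      (\<Sum>\<beta>\<in>?B. ?\<tau> \<beta> * Q v i \<beta>))"
  proof -
    have fm: "f \<in> borel_measurable borel"
      using cont_diff_imp_continuous[OF f] by (rule borel_measurable_continuous_onI)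
    have "approx_A m V I t A J f = (\<Sum>\<beta>\<in>?B. \<Sum>v\<in>V. \<Sum>i\<in>I v.
        (-1) ^ t v i * (?\<tau> \<beta> * Q v i \<beta>))"
      unfolding approx_A_def sum_distrib_left translated_cone_eq_chart_image
    proof (rule sum.cong[OF refl], rule sum.cong[OF refl], rule sum.cong[OF refl])
      fix \<beta> :: "int ^ 'n" and v i assume "v \<in> V" "i \<in> I v"
      then have "(LINT x : chart v (A v i) ` shifted_orthant (J v i) \<beta> | lborel. f x) = Q v i \<beta>"
        unfolding Q_def g_def using A fm by (intro set_integral_chart) auto
      then show "?\<tau> \<beta> * ((-1) ^ t v i * (LINT x : chart v (A v i) ` shifted_orthant (J v i) \<beta> | lborel. f x))
        = (-1) ^ t v i * (?\<tau> \<beta> * Q v i \<beta>)"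
        by simp
    qed
    also have "\<dots> = (\<Sum>v\<in>V. \<Sum>\<beta>\<in>?B. \<Sum>i\<in>I v.
        (-1) ^ t v i * (?\<tau> \<beta> * Q v i \<beta>))"
      by (rule sum.swap)
    also have "\<dots> = (\<Sum>v\<in>V. \<Sum>i\<in>I v. \<Sum>\<beta>\<in>?B.
        (-1) ^ t v i * (?\<tau> \<beta> * Q v i \<beta>))"
      by (rule sum.cong[OF refl]) (rule sum.swap)
    finally show ?thesis by (simp only: sum_distrib_left)
  qed
  have pairs: "(\<Sum>v\<in>V. \<Sum>i\<in>I v. (-1) ^ t v i * H (v, i)) = (\<Sum>x\<in>(SIGMA v:V. I v). (-1) ^ t (fst x) (snd x) * H x)"
    for H :: "(real ^ 'n) \<times> 'i \<Rightarrow> real"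
  proof -
    have "(\<Sum>v\<in>V. \<Sum>i\<in>I v. (-1) ^ t v i * H (v, i)) = (\<Sum>(v, i)\<in>(SIGMA v:V. I v). (-1) ^ t v i * H (v, i))"
      using finV I by (intro sum.Sigma) blast+
    then show ?thesis by (simp only: case_prod_unfold prod.collapse)
  qed
  have "remainder_R m V I t A J f = remainder_functional m (\<lambda>\<alpha> w. \<Sum>x\<in>(SIGMA v:V. I v). (-1) ^ t (fst x) (snd x) * G x \<alpha> w)"
    unfolding remainder_R_eq_functional
  proof (rule remainder_functional_cong)
    fix \<alpha> :: "nat ^ 'n" and w :: "real ^ 'n" assume w: "\<And>r. \<bar>w $ r\<bar> \<le> real m / 2"
    have "signed_lattice_sum V I t A J f \<alpha> w = (\<Sum>v\<in>V. \<Sum>i\<in>I v. (-1) ^ t v i * G (v, i) \<alpha> w)"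
      unfolding signed_lattice_sum_def g_def[symmetric]
    proof (rule sum.cong[OF refl], rule sum.cong[OF refl], rule arg_cong2[of _ _ _ _ "(*)", OF refl])
      fix v i assume vi: "v \<in> V" "i \<in> I v"
      show "(\<Sum>\<^sub>\<infinity>k\<in>UNIV. mixed_partial \<alpha> (\<lambda>y. g v i y) (real_vec k + one_on (J v i) + w)) = G (v, i) \<alpha> w"
        unfolding G_def prod.case
      proof (rule infsum_bounded_support[where R = "R v i" and c = "real m / 2"])
        show "mixed_partial \<alpha> (g v i) y = 0" if "R v i < \<bar>y $ r\<bar>" for y r
          by (rule mixed_partial_outside_support[OF R[OF vi] that])
      qed (rule w, rule N)
    qed
    also have "\<dots> = (\<Sum>x\<in>(SIGMA v:V. I v). (-1) ^ t (fst x) (snd x) * G x \<alpha> w)"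
      by (rule pairs)
    finally show "signed_lattice_sum V I t A J f \<alpha> w = (\<Sum>x\<in>(SIGMA v:V. I v). (-1) ^ t (fst x) (snd x) * G x \<alpha> w)" .
  qed
  also have "\<dots> = (\<Sum>x\<in>(SIGMA v:V. I v). (-1) ^ t (fst x) (snd x) * remainder_functional m (G x))"
  proof (rule remainder_functional_sum[where c = "\<lambda>x. (-1) ^ t (fst x) (snd x)" and G = G])
    show "finite (SIGMA v:V. I v)" using finV I by (intro finite_SigmaI)
    fix x and \<alpha> :: "nat ^ 'n" assume "x \<in> (SIGMA v:V. I v)" and \<alpha>: "mi_norm \<alpha> = 2 * m"
    obtain v i where x: "x = (v, i)" by (cases x)
    have "cont_diff 0 (mixed_partial \<alpha> (g v i))"
      by (rule cont_diff_mixed_partial) (simp only: add_0 \<alpha> gC)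
    then have c: "continuous_on UNIV (mixed_partial \<alpha> (g v i))" by simp
    have "continuous_on UNIV (\<lambda>w. mixed_partial \<alpha> (g v i) (a + w))" for a
      by (rule continuous_on_compose2[OF c]) (intro continuous_intros, simp)
    then show "continuous_on UNIV (G x \<alpha>)"
      unfolding x G_def prod.case by (intro continuous_on_sum)
  qed
  also have "\<dots> = (\<Sum>v\<in>V. \<Sum>i\<in>I v. (-1) ^ t v i * remainder_functional m (G (v, i)))"
    by (rule pairs[symmetric])
  also have "\<dots> = (\<Sum>v\<in>V. \<Sum>i\<in>I v. (-1) ^ t v i *
      ((\<Sum>\<beta>\<in>?B. ?\<tau> \<beta> * Q v i \<beta>) - S v i))"
  proof (rule sum.cong[OF refl], rule sum.cong[OF refl], rule arg_cong2[of _ _ _ _ "(*)", OF refl])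
    fix v i assume vi: "v \<in> V" "i \<in> I v"
    show "remainder_functional m (G (v, i)) = (\<Sum>\<beta>\<in>?B. ?\<tau> \<beta> * Q v i \<beta>) - S v i"
      unfolding G_def prod.case Q_def S_def by (rule cone_summation_formula[OF m gC R[OF vi] N])
  qed
  also have "\<dots> = approx_A m V I t A J f - (\<Sum>k\<in>P \<inter> int_points. f k)"
    unfolding approx sumS by (simp only: right_diff_distrib sum_subtractf)
  finally show ?thesis by simp
qed

theorem corollary4p3:
  fixes m :: nat
    and P V :: "(real ^ 'n::finite) set"
    and I :: "real ^ 'n \<Rightarrow> 'i set"
    and t :: "real ^ 'n \<Rightarrow> 'i \<Rightarrow> nat"
    and A :: "real ^ 'n \<Rightarrow> 'i \<Rightarrow> int ^ 'n ^ 'n"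
    and J :: "real ^ 'n \<Rightarrow> 'i \<Rightarrow> 'n set"
    and f :: "real ^ 'n \<Rightarrow> real"
  assumes "m \<ge> 1"
    and "integral_polytope P" and "aff_dim P = int CARD('n)"
    and "V = vertices P"
    and "\<And>v. v \<in> V \<Longrightarrow> finite (I v)"
    and "\<And>v i. v \<in> V \<Longrightarrow> i \<in> I v \<Longrightarrow> t v i \<in> {0, 1}"
    and "\<And>v i. v \<in> V \<Longrightarrow> i \<in> I v \<Longrightarrow> unimodular (A v i)"
    and "\<And>x. (indicator P x :: real) =
           (\<Sum>v\<in>V. \<Sum>i\<in>I v. (-1) ^ t v i * indicator (cone_at v (A v i) (J v i)) x)"
    and "cont_diff (2 * m) f" and "compactly_supported f"
  shows "(\<Sum>k\<in>P \<inter> int_points. f k) = approx_A m V I t A J f - remainder_R m V I t A J f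
    \<and> (\<forall>M :: real.
          (\<forall>\<alpha> u. mi_norm \<alpha> = 2 * m \<and> (\<forall>r. \<bar>u $ r\<bar> \<le> real m / 2) \<longrightarrow>
              \<bar>signed_lattice_sum V I t A J f \<alpha> u\<bar> \<le> M) \<longrightarrow>
          \<bar>remainder_R m V I t A J f\<bar> \<le>
            M * (1.0331 * (pi * real m) powr ((real CARD('n) + 1) / 2) / fact (2 * m + 1))
              * (kappa * real CARD('n) * real m) ^ (2 * m))
    \<and> (\<exists>s\<in>{0<..<1}. Lambda_star = Lambda_fun s \<and> (\<forall>s'\<in>{0<..<1}. Lambda_fun s' \<le> Lambda_fun s))
    \<and> 0.3081 \<le> Lambda_star \<and> Lambda_star < 0.3082
    \<and> 0.27754 \<le> kappa \<and> kappa < 0.27755"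
proof (intro conjI allI impI)
  show "(\<Sum>k\<in>P \<inter> int_points. f k) = approx_A m V I t A J f - remainder_R m V I t A J f"
    by (rule polytope_summation_formula[OF assms(1,2,4,5,7,8,9,10)])
  show "\<bar>remainder_R m V I t A J f\<bar> \<le>
            M * (1.0331 * (pi * real m) powr ((real CARD('n) + 1) / 2) / fact (2 * m + 1))
              * (kappa * real CARD('n) * real m) ^ (2 * m)"
    if M: "\<forall>\<alpha> u. mi_norm \<alpha> = 2 * m \<and> (\<forall>r. \<bar>u $ r\<bar> \<le> real m / 2) \<longrightarrow> \<bar>signed_lattice_sum V I t A J f \<alpha> u\<bar> \<le> M" for M
    unfolding remainder_R_eq_functional
  proof (rule remainder_functional_bound[OF assms(1)])
    show "\<bar>signed_lattice_sum V I t A J f \<alpha> w\<bar> \<le> M" if "mi_norm \<alpha> = 2 * m" "\<forall>r. \<bar>w $ r\<bar> \<le> real m / 2" for \<alpha> w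
      using M that by blast
  qed
  show "\<exists>s\<in>{0<..<1}. Lambda_star = Lambda_fun s \<and> (\<forall>s'\<in>{0<..<1}. Lambda_fun s' \<le> Lambda_fun s)"
    using Lambda_star_max by metis
  show "0.3081 \<le> Lambda_star" "Lambda_star < 0.3082"
    using Lambda_star_lower Lambda_star_upper by simp_all
  show "0.27754 \<le> kappa" "kappa < 0.27755"
    by (fact kappa_bounds)+
qed

end
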